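(* Let $\mathcal A$ be a finite nonempty family of tags. In tag $A$, let $(\mathcal P_A,\mathcal T_A,Y_A)$ be a positive-mass input to the cellular joint construction (see context; $\mathcal P_A$ parents, $\mathcal T_A$ children, $Y_A$ shading), all supported in a fixed dilation of $A$, and let $\mathcal Q_A$ be its finite active half-open cell set. Assume that, for fixed $C_{\rm comp},C_{\rm mass}$, $$|\mathcal A|+\max_{A\in\mathcal A}(|\mathcal P_A|+|\mathcal T_A|+|\mathcal Q_A|)\le\delta^{-C_{\rm comp}},\qquad\delta^{C_{\rm mass}}\le M_A(Y_A)\le\delta^{-C_{\rm mass}}\quad(A\in\mathcal A).$$ Run the three steps (J1), (R1), (R2) of the joint construction independently in every tag, write $\mu_A,\omega_A,d_A$ for the three local dyadic parameters (inner multiplicity level, edge-weight level, right-degree level), and denote the local graph edge set by $E_{2,A}$, the child shading output by $Y_{{\rm reg},A}$ and the loss by $L_{\rm reg}(A)$. Put $$\mathcal Q_A^+=\{Q:\text{some }(P,Q)\in E_{2,A}\},\qquad v_A(Q)=|U(\mathcal T_A,Y_{{\rm reg},A})\cap N_{Ca}(Q)|.$$ There is a structural $C_v\ge1$, independent of $A$, such that every $Q\in\mathcal Q_A^+$ satisfies $$\frac{\omega_A}{2\mu_A}\le v_A(Q)\le C_va^3 .$$ Define the number of positive volume levels by $$J_v(A):=1+\max\Bigl\{0,\Bigl\lceil\log_2\Bigl(\frac{2C_va^3\mu_A}{\omega_A}\Bigr)\Bigr\rceil\Bigr\}.$$ If $\mathcal Q_A^+=\varnothing$, set $J_v(A)=1$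 and declare the local-volume output empty; the positive-mass hypothesis and the mass bound of the joint construction exclude this case for every tag retained below. Synchronize $\mu_A,\omega_A,d_A$ by a whole-tag selection. Only then, independently in each selected tag, perform the saturated local-volume selection (see context), and call its child output $Y_{1,A}$ and its parent shading $Z_A$. Put $L_{\rm reg}^{\max}:=\max_AL_{\rm reg}(A)$ and $J_v^{\max}:=\max_AJ_v(A)$. There exist a whole-tag subfamily $\mathcal A_1\subset\mathcal A$, dyadic numbers $\mu_*,\omega_*,d_*$, and level counts $L_\mu,L_\omega,L_d\le C\log(2/\delta)$ such that $$\mu_*\le\mu_A<2\mu_*,\quad\omega_*\le\omega_A<2\omega_*,\quad d_*\le d_A<2d_*\qquad(A\in\mathcal A_1);$$ every $A\in\mathcal A_1$ satisfies the local conclusions (P2) if $x\in Y_{1,A}(T)$ and $T$ is a child of $P$, then $x\in Z_A(P)$; (P3) $\mu_A\le\sum_{T\in\mathcal T_P}\mathbf 1_{Y_{1,A}(T)}<2\mu_A$ on $U(\mathcal T_P,Y_{1,A})$, for each parent $P$, where $\mathcal T_P$ is the set of children of $P$; (P4) $d_A\le\sum_P\mathbf 1_{Z_A(P)}<2d_A$ on $\bigcup_PZ_A(P)$; (P5) $\sum_{T\in\mathcal T_A}\mathbf 1_{Y_{1,A}(T)}<4\mu_Ad_A$ at every child point; and $$M_A(Y_{1,A})\ge[J_v(A)L_{\rm reg}(A)]^{-1}M_A(Y_A),$$ while globally $$\sum_{A\in\mathcal A_1}M_A(Y_{1,A})\ge[L_\mu L_\omega L_dJ_v^{\max}L_{\rm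 reg}^{\max}]^{-1}\sum_{A\in\mathcal A}M_A(Y_A).\qquad(\mathrm{G1})$$ Suppose in addition that the common scales determine the same resolved-angle parameters $A_{\rm ang},B_{\rm ang},K,q_{\rm res}$ in every tag. Run the resolved angular selection (see context) independently in each $A\in\mathcal A_1$, with outputs $Y_{2,A},\theta_A,d_{\angle,A}$. There is a whole-tag subfamily $\mathcal A_2\subset\mathcal A_1$ and dyadic $\theta_*,d_{\angle,*}$, with $$\theta_*\le\theta_A<2\theta_*,\qquad d_{\angle,*}\le d_{\angle,A}<2d_{\angle,*}\qquad(A\in\mathcal A_2),$$ for which all local angular conclusions (A1)–(A4) of the context hold and $$\sum_{A\in\mathcal A_2}M_A(Y_{2,A})\ge\frac{c_{\rm ang}^{\min}}{2L_\theta^{\rm tag}L_{d_\angle}^{\rm tag}}\sum_{A\in\mathcal A_1}M_A(Y_{1,A}),\qquad c_{\rm ang}^{\min}:=\min_{A\in\mathcal A_1}\frac{A_{\rm ang}^{-K}}{J_\theta(A)J_d(A)},\qquad(\mathrm{G2})$$ where $L_\theta^{\rm tag},L_{d_\angle}^{\rm tag}\le C\log(2/\delta)$. In particular the common input degree $d_*$ permits one global low/high split (by degree), and in the high case the synchronized output degree is $d_{\angle,*}$. Finally, suppose there are a common $m_*>0$ and fixed constants $0<c_-\le c_+<\infty$ such that a represented fine mass $F_A(V)$ on every whole-tubelet subshading $V$ obeys $$c_-m_*M_A(V)\le F_A(V)\le c_+m_*M_A(V).$$ Then (G1) and (G2) hold for $\sum_AF_A$ in place of $\sum_AM_A$, with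 the additional (loss) factor $c_+/c_-$. Thus the selected tags carry the same polylogarithmic fraction of represented fine mass and, whenever the labelled denominator is comparable to that mass at the fixed density level, of the labelled denominator.
   Context: Families are finite and labelled; sums and cardinalities count labels, and coincident carriers with different labels are distinct. $|\cdot|$ is Lebesgue measure in $\mathbb R^3$ or labelled cardinality; $N_s(E)$ is the open $s$-neighbourhood; $U(\mathcal F,Y)=\bigcup_{F\in\mathcal F}Y(F)$. $\delta$ is the small scale parameter and $a$ the common shortest parent scale. Tags $A$ are labels of bounded ambient regions (balls) of $\mathbb R^3$; each tag has its own copy of $\mathbb R^3$ and of every grid cell, so constructions in different tags do not interact. A whole-tag selection or subfamily keeps or discards complete tags. $M_A(Y)=\sum_{T\in\mathcal T_A}|Y(T)|$. The children are also called tubelets; a whole-tubelet subshading $V$ assigns to tubelet labels measurable subsets $V(T)\subset Y_A(T)$. The labelled denominator is the sum of the carrier volumes $|T|$ over child labels. $C$ denotes fixed (structural) constants, in the level-count bounds also depending on $C_{\rm comp},C_{\rm mass}$. A low/high split is a case distinction according to whether the input right degree lies below or above a threshold; the angular selection is used in the high case. Joint construction in a tag. Fix $0<c_0\le10^{-3}$, $h=c_0a$, $\mathcal Q_h=\{h(k+[0,1)^3):k\in\mathbb Z^3\}$. Parents $P\in\mathcal P_A$ are labelled, arbitrarily oriented rectangular $a\times b\times r$ boxes, $a\le b\le r$, each with an ordered orthonormal side frame $(e_a,e_b,e_r)$ and a fixed enlargement of comparable side lengths that carries its parent shading. $\mathcal P_A$ is nonempty, $\mathcal T_A=\bigsqcup_P\mathcal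 T_P$, each child $T\in\mathcal T_P$ is contained in the box $P$ and has a measurable shading $Y_A(T)\subset T$, and $0<M_A(Y_A)<\infty$; active cells are those carrying positive shaded mass. Put $N_{\max}=\max_P|\mathcal T_P|$, $f_P=\sum_{T\in\mathcal T_P}\mathbf 1_{Y_A(T)}$. (J1) Choose $\mu_A=2^{k_0}$, $0\le k_0\le\lceil\log_2N_{\max}\rceil$, so that $Y_0(T)=Y_A(T)\cap\{\mu_A\le f_P<2\mu_A\}$ ($T\in\mathcal T_P$) has $M_A(Y_0)\ge(1+\lceil\log_2N_{\max}\rceil)^{-1}M_A(Y_A)$. (R1) Let $\omega_{PQ}=\sum_{T\in\mathcal T_P}|Y_0(T)\cap Q|$, $E_A^+=\{(P,Q):\omega_{PQ}>0\}$, $\Omega_A=\sum_{E_A^+}\omega_e$. Delete weights below $\Omega_A/(2|E_A^+|)$ and keep the heaviest dyadic class $E_{1,A}$, on which $\omega_A\le\omega_e<2\omega_A$; it carries at least $\Omega_A/[2(1+\lceil\log_2(2|E_A^+|)\rceil)]$. (R2) Choose a dyadic $d_A$ such that the cells with $E_{1,A}$-degree in $[d_A,2d_A)$ carry the greatest $E_{1,A}$-weight, and let $E_{2,A}$ consist of all $E_{1,A}$-edges at those cells. Then $Y_{{\rm reg},A}(T)=Y_0(T)\cap\bigcup_{Q:(P,Q)\in E_{2,A}}Q$ for $T\in\mathcal T_P$, and $L_{\rm reg}(A)=(1+\lceil\log_2N_{\max}\rceil)\cdot2(1+\lceil\log_2(2|E_A^+|)\rceil)\cdot2(1+\lceil\log_2|E_{1,A}|\rceil)$.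 The mass bound of the joint construction is $M_A(Y_{{\rm reg},A})\ge L_{\rm reg}(A)^{-1}M_A(Y_A)$. Saturated local-volume selection. Partition $\mathcal Q_A^+$ according to which of the $J_v(A)$ half-open dyadic intervals covering $[\omega_A/(2\mu_A),C_va^3]$ contains $v_A(Q)$; choose a class maximizing the sum of its incident edge weights; retain every $E_{2,A}$-edge at each chosen cell, giving $E_{3,A}$. Then $Z_A(P)=\bigcup_{Q:(P,Q)\in E_{3,A}}Q$ and $Y_{1,A}(T)=Y_0(T)\cap Z_A(P)$ for $T\in\mathcal T_P$. Resolved angular selection. Let $\alpha=a/r$, $q_{\rm res}=a/b$, $L_+=\max\{1,\log\alpha^{-1}\}$, $A_{\rm ang}=e^{L_+^{1/2}}$, $B_{\rm ang}=e^{L_+^{3/4}}$, $K=1+\lceil\log_{B_{\rm ang}}(q_{\rm res}^{-1})\rceil$, $J_\theta(A)=1+\lceil\log_2(q_{\rm res}^{-1})\rceil$, $J_d(A)=1+\lceil\log_2(2A_{\rm ang}^K)\rceil$. With $TP=\operatorname{span}\{e_b,e_r\}$ and the plane angle $\min\{1,\arccos|\langle n,n'\rangle|\}$ ($n,n'$ unit normals), the resolved diameter of a nonempty family of parents is the maximum over pairs $P,P'$ of $\max\{q_{\rm res},\operatorname{angle}(TP,TP')\}$. Applied to the edge set $E_{3,A}$, the angular selection theorem gives an edge subset with parent shading $Z_A^\angle(P)$ (the union of the cells of the retained edges at $P$), a dyadic $d_{\angle,A}$ and $\theta_A\in[q_{\rm res},1]$ such that: (A1) every retained cell has parent degree in $[d_{\angle,A},2d_{\angle,A})$;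 (A2) the resolved diameter of its incident parent family lies in $[\theta_A,2\theta_A)$; (A3) every subfamily containing at least an $A_{\rm ang}^{-1}$ fraction of the parents incident to a retained cell has resolved diameter larger than $\theta_A/B_{\rm ang}$; (A4) $\sum_P|Z_A^\angle(P)|\ge c_{{\rm ang},A}\sum_P|Z_A(P)|$ with $c_{{\rm ang},A}\ge A_{\rm ang}^{-K}/(J_\theta(A)J_d(A))$, and, with an absolute constant $C$, $c_{{\rm ang},A}^{-1}\le C(1+L_+)^2\exp(L_+^{3/4}+2L_+^{1/2})$, so that $c_{{\rm ang},A}^{-1}=O(1)$ when $\log\alpha^{-1}\le1$ and $c_{{\rm ang},A}=\alpha^{o(1)}$ as $\alpha\downarrow0$. The corresponding child shading $Y_{2,A}(T)=Y_{1,A}(T)\cap Z_A^\angle(P)$ ($T\in\mathcal T_P$) retains at least the fraction $c_{{\rm ang},A}/2$ of $M_A(Y_{1,A})$. *)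

theory Defs
  imports "HOL-Analysis.Analysis"
begin

type_synonym pt = "real ^ 3"

abbreviation vol :: "pt set \<Rightarrow> real" where
  "vol \<equiv> measure lebesgue"

definition dyadic :: "real \<Rightarrow> bool" where
  "dyadic x \<longleftrightarrow> (\<exists>k::int. x = 2 powi k)"

definition nbhd :: "real \<Rightarrow> pt set \<Rightarrow> pt set" where
  "nbhd s E = (\<Union>y\<in>E. ball y s)"

definition grid_cell :: "real \<Rightarrow> int ^ 3 \<Rightarrow> pt set" where
  "grid_cell h k = {x. \<forall>i. h * of_int (k $ i) \<le> x $ i \<and> x $ i < h * (of_int (k $ i) + 1)}"

definition grid :: "real \<Rightarrow> pt set set" where
  "grid h = range (grid_cell h)"

text \<open>
  The data living in one tag. Parents and children are labels; the disjoint union of the sets of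
  children of the parents is encoded by the map \<open>parent\<close>. The shortest side \<open>a\<close> of the parent boxes
  is common to all tags and is therefore not a field; the other two sides may depend on the tag.
  The ambient region of the tag is the ball with the given centre and radius.
\<close>

record ('p, 't) tag =
  centre :: pt
  radius :: real
  side_b :: real
  side_r :: real
  parents :: "'p set"
  box_centre :: "'p \<Rightarrow> pt"
  frame_a :: "'p \<Rightarrow> pt"
  frame_b :: "'p \<Rightarrow> pt"
  frame_r :: "'p \<Rightarrow> pt"
  children :: "'t set"
  parent :: "'t \<Rightarrow> 'p"
  carrier :: "'t \<Rightarrow> pt set"
  shading :: "'t \<Rightarrow> pt set"

definition kids :: "('p, 't) tag \<Rightarrow> 'p \<Rightarrow> 't set" where
  "kids D P = {T \<in> children D. parent D T = P}"

text \<open>The box of a parent dilated by the factor \<open>s\<close> about its centre; \<open>s = 1\<close> is the box itself.\<close>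

definition box_of :: "real \<Rightarrow> real \<Rightarrow> ('p, 't) tag \<Rightarrow> 'p \<Rightarrow> pt set" where
  "box_of s a D P = {x. \<bar>(x - box_centre D P) \<bullet> frame_a D P\<bar> \<le> s * a / 2 \<and>
                        \<bar>(x - box_centre D P) \<bullet> frame_b D P\<bar> \<le> s * side_b D / 2 \<and>
                        \<bar>(x - box_centre D P) \<bullet> frame_r D P\<bar> \<le> s * side_r D / 2}"

definition orthonormal_frame :: "pt \<Rightarrow> pt \<Rightarrow> pt \<Rightarrow> bool" where
  "orthonormal_frame u v w \<longleftrightarrow>
     norm u = 1 \<and> norm v = 1 \<and> norm w = 1 \<and> u \<bullet> v = 0 \<and> u \<bullet> w = 0 \<and> v \<bullet> w = 0"

definition mass :: "('p, 't) tag \<Rightarrow> ('t \<Rightarrow> pt set) \<Rightarrow> real" where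
  "mass D Y = (\<Sum>T\<in>children D. vol (Y T))"

definition denominator :: "('p, 't) tag \<Rightarrow> real" where
  "denominator D = (\<Sum>T\<in>children D. vol (carrier D T))"

definition overlap :: "'t set \<Rightarrow> ('t \<Rightarrow> pt set) \<Rightarrow> pt \<Rightarrow> real" where
  "overlap S Y x = (\<Sum>T\<in>S. indicator (Y T) x)"

definition active_cells :: "real \<Rightarrow> ('p, 't) tag \<Rightarrow> pt set set" where
  "active_cells h D = {Q \<in> grid h. 0 < (\<Sum>T\<in>children D. vol (shading D T \<inter> Q))}"

text \<open>
  A positive-mass input to the joint construction with grid parameter \<open>c0\<close>, supported in the
  \<open>dil\<close>-fold dilation of the ambient ball, whose radius is bounded by the structural constant \<open>R0\<close>;
  \<open>enl\<close> is the fixed enlargement factor of the parent boxes that carry the parent shadings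
  (every grid cell meeting the box is contained in the enlarged box).
  The total mass is automatically finite, since the shadings lie in bounded boxes.
\<close>

definition tag_input :: "real \<Rightarrow> real \<Rightarrow> real \<Rightarrow> real \<Rightarrow> real \<Rightarrow> ('p, 't) tag \<Rightarrow> bool" where
  "tag_input c0 dil enl R0 a D \<longleftrightarrow>
     0 < radius D \<and> radius D \<le> R0 \<and>
     0 < a \<and> a \<le> side_b D \<and> side_b D \<le> side_r D \<and>
     finite (parents D) \<and> parents D \<noteq> {} \<and> finite (children D) \<and>
     parent D ` children D \<subseteq> parents D \<and>
     (\<forall>P\<in>parents D.
        orthonormal_frame (frame_a D P) (frame_b D P) (frame_r D P) \<and>
        box_of 1 a D P \<subseteq> ball (centre D) (dil * radius D) \<and>
        (\<forall>Q\<in>grid (c0 * a). Q \<inter> box_of 1 a D P \<noteq> {} \<longrightarrow> Q \<subseteq> box_of enl a D P)) \<and>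
     (\<forall>T\<in>children D.
        carrier D T \<in> sets lebesgue \<and> carrier D T \<subseteq> box_of 1 a D (parent D T) \<and>
        shading D T \<in> sets lebesgue \<and> shading D T \<subseteq> carrier D T) \<and>
     0 < mass D (shading D)"

definition N_max :: "('p, 't) tag \<Rightarrow> nat" where
  "N_max D = Max ((\<lambda>P. card (kids D P)) ` parents D)"

definition Y0 :: "('p, 't) tag \<Rightarrow> real \<Rightarrow> 't \<Rightarrow> pt set" where
  "Y0 D mu T = {x \<in> shading D T.
     mu \<le> overlap (kids D (parent D T)) (shading D) x \<and>
     overlap (kids D (parent D T)) (shading D) x < 2 * mu}"

fun edge_weight :: "('p, 't) tag \<Rightarrow> real \<Rightarrow> 'p \<times> pt set \<Rightarrow> real" where
  "edge_weight D mu (P, Q) = (\<Sum>T\<in>kids D P. vol (Y0 D mu T \<inter> Q))"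

definition E_plus :: "real \<Rightarrow> ('p, 't) tag \<Rightarrow> real \<Rightarrow> ('p \<times> pt set) set" where
  "E_plus h D mu = {e \<in> parents D \<times> grid h. 0 < edge_weight D mu e}"

definition E1 :: "real \<Rightarrow> ('p, 't) tag \<Rightarrow> real \<Rightarrow> real \<Rightarrow> ('p \<times> pt set) set" where
  "E1 h D mu om = {e \<in> E_plus h D mu.
     sum (edge_weight D mu) (E_plus h D mu) / (2 * real (card (E_plus h D mu))) \<le> edge_weight D mu e \<and>
     om \<le> edge_weight D mu e \<and> edge_weight D mu e < 2 * om}"

definition incident :: "('p \<times> pt set) set \<Rightarrow> pt set \<Rightarrow> 'p set" where
  "incident E Q = {P. (P, Q) \<in> E}"

definition right_degree :: "('p \<times> pt set) set \<Rightarrow> pt set \<Rightarrow> real" where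
  "right_degree E Q = real (card (incident E Q))"

definition E2 :: "real \<Rightarrow> ('p, 't) tag \<Rightarrow> real \<Rightarrow> real \<Rightarrow> real \<Rightarrow> ('p \<times> pt set) set" where
  "E2 h D mu om d = {e \<in> E1 h D mu om.
     d \<le> right_degree (E1 h D mu om) (snd e) \<and> right_degree (E1 h D mu om) (snd e) < 2 * d}"

text \<open>\<open>joint_run h D mu om d\<close>: the numbers \<open>mu\<close>, \<open>om\<close>, \<open>d\<close> are admissible choices of the inner
  multiplicity level, the edge-weight level and the right-degree level. Maximality over all dyadic
  values expresses that the heaviest class is kept; \<open>mu\<close> is only required to retain the stated
  fraction of the mass.\<close>

definition joint_run :: "real \<Rightarrow> ('p, 't) tag \<Rightarrow> real \<Rightarrow> real \<Rightarrow> real \<Rightarrow> bool" where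
  "joint_run h D mu om d \<longleftrightarrow>
     (\<exists>k0::nat. mu = 2 ^ k0 \<and> int k0 \<le> \<lceil>log 2 (real (N_max D))\<rceil>) \<and>
     mass D (Y0 D mu) \<ge> inverse (1 + of_int \<lceil>log 2 (real (N_max D))\<rceil>) * mass D (shading D) \<and>
     dyadic om \<and>
     (\<forall>om'. dyadic om' \<longrightarrow>
        sum (edge_weight D mu) (E1 h D mu om') \<le> sum (edge_weight D mu) (E1 h D mu om)) \<and>
     dyadic d \<and>
     (\<forall>d'. dyadic d' \<longrightarrow>
        sum (edge_weight D mu) (E2 h D mu om d') \<le> sum (edge_weight D mu) (E2 h D mu om d))"

definition parent_shading :: "('p \<times> pt set) set \<Rightarrow> 'p \<Rightarrow> pt set" where
  "parent_shading E P = \<Union>{Q. (P, Q) \<in> E}"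

definition restrict_to :: "('p, 't) tag \<Rightarrow> ('t \<Rightarrow> pt set) \<Rightarrow> ('p \<times> pt set) set \<Rightarrow> 't \<Rightarrow> pt set" where
  "restrict_to D Y E T = Y T \<inter> parent_shading E (parent D T)"

definition Y_reg :: "real \<Rightarrow> ('p, 't) tag \<Rightarrow> real \<Rightarrow> real \<Rightarrow> real \<Rightarrow> 't \<Rightarrow> pt set" where
  "Y_reg h D mu om d = restrict_to D (Y0 D mu) (E2 h D mu om d)"

definition L_reg :: "real \<Rightarrow> ('p, 't) tag \<Rightarrow> real \<Rightarrow> real \<Rightarrow> real" where
  "L_reg h D mu om =
     (1 + of_int \<lceil>log 2 (real (N_max D))\<rceil>) *
     (2 * (1 + of_int \<lceil>log 2 (2 * real (card (E_plus h D mu)))\<rceil>)) *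
     (2 * (1 + of_int \<lceil>log 2 (real (card (E1 h D mu om)))\<rceil>))"

definition Q_plus :: "real \<Rightarrow> ('p, 't) tag \<Rightarrow> real \<Rightarrow> real \<Rightarrow> real \<Rightarrow> pt set set" where
  "Q_plus h D mu om d = snd ` E2 h D mu om d"

definition local_volume ::
    "real \<Rightarrow> real \<Rightarrow> ('p, 't) tag \<Rightarrow> real \<Rightarrow> real \<Rightarrow> real \<Rightarrow> pt set \<Rightarrow> real" where
  "local_volume s h D mu om d Q = vol ((\<Union>T\<in>children D. Y_reg h D mu om d T) \<inter> nbhd s Q)"

definition J_v :: "real \<Rightarrow> real \<Rightarrow> real \<Rightarrow> ('p, 't) tag \<Rightarrow> real \<Rightarrow> real \<Rightarrow> real \<Rightarrow> nat" where
  "J_v Cv a h D mu om d =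
     (if Q_plus h D mu om d = {} then 1
      else 1 + nat (max 0 \<lceil>log 2 (2 * Cv * a ^ 3 * mu / om)\<rceil>))"

text \<open>The edges at the cells of the \<open>j\<close>-th volume class. The half-open dyadic intervals start at the
  lower bound \<open>om / (2 * mu)\<close>, which is itself a power of two; those with \<open>j < J_v\<close> cover the range
  of the local volumes.\<close>

definition volume_class ::
    "real \<Rightarrow> real \<Rightarrow> ('p, 't) tag \<Rightarrow> real \<Rightarrow> real \<Rightarrow> real \<Rightarrow> nat \<Rightarrow> ('p \<times> pt set) set" where
  "volume_class s h D mu om d j = {e \<in> E2 h D mu om d.
     2 ^ j * (om / (2 * mu)) \<le> local_volume s h D mu om d (snd e) \<and>
     local_volume s h D mu om d (snd e) < 2 ^ Suc j * (om / (2 * mu))}"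

definition volume_selection ::
    "real \<Rightarrow> real \<Rightarrow> real \<Rightarrow> real \<Rightarrow> ('p, 't) tag \<Rightarrow> real \<Rightarrow> real \<Rightarrow> real \<Rightarrow> ('p \<times> pt set) set \<Rightarrow> bool" where
  "volume_selection Cv a s h D mu om d E \<longleftrightarrow>
     (\<exists>j < J_v Cv a h D mu om d. E = volume_class s h D mu om d j \<and>
        (\<forall>i < J_v Cv a h D mu om d.
           sum (edge_weight D mu) (volume_class s h D mu om d i) \<le> sum (edge_weight D mu) E))"

definition alpha :: "real \<Rightarrow> ('p, 't) tag \<Rightarrow> real" where
  "alpha a D = a / side_r D"

definition q_res :: "real \<Rightarrow> ('p, 't) tag \<Rightarrow> real" where
  "q_res a D = a / side_b D"

definition L_plus :: "real \<Rightarrow> ('p, 't) tag \<Rightarrow> real" where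
  "L_plus a D = max 1 (ln (inverse (alpha a D)))"

definition A_ang :: "real \<Rightarrow> ('p, 't) tag \<Rightarrow> real" where
  "A_ang a D = exp (L_plus a D powr (1/2))"

definition B_ang :: "real \<Rightarrow> ('p, 't) tag \<Rightarrow> real" where
  "B_ang a D = exp (L_plus a D powr (3/4))"

definition K_ang :: "real \<Rightarrow> ('p, 't) tag \<Rightarrow> nat" where
  "K_ang a D = 1 + nat \<lceil>log (B_ang a D) (inverse (q_res a D))\<rceil>"

definition J_theta :: "real \<Rightarrow> ('p, 't) tag \<Rightarrow> nat" where
  "J_theta a D = 1 + nat \<lceil>log 2 (inverse (q_res a D))\<rceil>"

definition J_d :: "real \<Rightarrow> ('p, 't) tag \<Rightarrow> nat" where
  "J_d a D = 1 + nat \<lceil>log 2 (2 * A_ang a D ^ K_ang a D)\<rceil>"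

definition c_floor :: "real \<Rightarrow> ('p, 't) tag \<Rightarrow> real" where
  "c_floor a D = inverse (A_ang a D ^ K_ang a D) / (real (J_theta a D) * real (J_d a D))"

definition tangent_plane :: "('p, 't) tag \<Rightarrow> 'p \<Rightarrow> pt set" where
  "tangent_plane D P = span {frame_b D P, frame_r D P}"

text \<open>A plane has two unit normals, which differ by a sign; the angle does not depend on the choice.\<close>

definition unit_normal :: "pt set \<Rightarrow> pt" where
  "unit_normal V = (SOME n. norm n = 1 \<and> (\<forall>v\<in>V. n \<bullet> v = 0))"

definition plane_angle :: "pt set \<Rightarrow> pt set \<Rightarrow> real" where
  "plane_angle V W = min 1 (arccos \<bar>unit_normal V \<bullet> unit_normal W\<bar>)"

definition resolved_diameter :: "real \<Rightarrow> ('p, 't) tag \<Rightarrow> 'p set \<Rightarrow> real" where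
  "resolved_diameter a D S =
     Max ((\<lambda>(P, P'). max (q_res a D) (plane_angle (tangent_plane D P) (tangent_plane D P'))) ` (S \<times> S))"

text \<open>\<open>angular_output a D E F th d c\<close>: the edge subset \<open>F\<close> of \<open>E\<close>, the angle \<open>th\<close>, the degree \<open>d\<close>
  and the retention constant \<open>c\<close> form an output of the angular selection applied to \<open>E\<close>. The numerical
  upper bounds on \<open>inverse c\<close> are not included, as they follow from \<open>c_floor a D \<le> c\<close>.\<close>

definition angular_output ::
    "real \<Rightarrow> ('p, 't) tag \<Rightarrow> ('p \<times> pt set) set \<Rightarrow> ('p \<times> pt set) set \<Rightarrow> real \<Rightarrow> real \<Rightarrow> real \<Rightarrow> bool" where
  "angular_output a D E F th d c \<longleftrightarrow>
     F \<subseteq> E \<and> dyadic d \<and> q_res a D \<le> th \<and> th \<le> 1 \<and>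
     (\<forall>Q\<in>snd ` F. d \<le> right_degree F Q \<and> right_degree F Q < 2 * d) \<and>
     (\<forall>Q\<in>snd ` F. th \<le> resolved_diameter a D (incident F Q) \<and>
                   resolved_diameter a D (incident F Q) < 2 * th) \<and>
     (\<forall>Q\<in>snd ` F. \<forall>S \<subseteq> incident F Q.
        inverse (A_ang a D) * real (card (incident F Q)) \<le> real (card S) \<longrightarrow>
        th / B_ang a D < resolved_diameter a D S) \<and>
     (c_floor a D \<le> c \<and>
      c * (\<Sum>P\<in>parents D. vol (parent_shading E P)) \<le> (\<Sum>P\<in>parents D. vol (parent_shading F P)))"

definition subshading :: "('p, 't) tag \<Rightarrow> ('t \<Rightarrow> pt set) \<Rightarrow> bool" where
  "subshading D V \<longleftrightarrow> (\<forall>T\<in>children D. V T \<in> sets lebesgue \<and> V T \<subseteq> shading D T)"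

definition represents_mass ::
    "real \<Rightarrow> real \<Rightarrow> real \<Rightarrow> ('p, 't) tag \<Rightarrow> (('t \<Rightarrow> pt set) \<Rightarrow> real) \<Rightarrow> bool" where
  "represents_mass cm cp m D F \<longleftrightarrow>
     (\<forall>V. subshading D V \<longrightarrow> cm * m * mass D V \<le> F V \<and> F V \<le> cp * m * mass D V)"

end

theory Submission
  imports Defs
begin

text \<open>
  The theorem combines finitely many pigeonhole steps, first inside each tag and then between tags.

  Inside a tag the masses of the selected shadings are sums of weights of edges between parents and grid cells
  (\<open>mass_restrict_to\<close>), because the cells of the grid are disjoint. Each local step sorts points, edges
  or cells into dyadic classes and keeps the heaviest class; its loss is, up to a factor \<open>2\<close>, the number
  of classes, which is one plus the rounded-up logarithm of the ratio of the extreme values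
  (\<open>heaviest_dyadic_class\<close>, \<open>heaviest_level\<close>). This gives the loss \<open>L_reg\<close> of the joint construction
  (\<open>L_reg_bounds\<close>) and the loss \<open>J_v\<close> of the volume selection (\<open>E2_weight_le\<close>). The volume levels
  start at \<open>om / (2 mu)\<close>, since a cell of weight \<open>om\<close> and multiplicity below \<open>2 mu\<close> has at least this
  shaded volume, and end at a multiple of \<open>a ^ 3\<close>, since a neighbourhood of a cell lies in a cube
  (\<open>local_volume_bounds\<close>). The volume selection keeps or discards whole cells and therefore preserves
  the right degrees and the inner multiplicities; the pointwise conclusions follow.

  The angular selection exists by iteration (\<open>stable_subfamily\<close>): as long as a substantial subfamily
  of the parents at a cell has much smaller resolved diameter, pass to it. Since resolved diameters
  lie between \<open>q_res\<close> and \<open>1\<close>, at most \<open>K\<close> steps occur. Two more pigeonhole steps make angle and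
  degree constant. The bound for the retention constant is a computation with its definition
  (\<open>inverse_c_floor_le\<close>).

  Between tags, all parameters lie in a range that is polynomial in \<open>\<delta>\<close>, so each of them takes only
  \<open>O(log (2 / \<delta>))\<close> dyadic values (\<open>card_dyadic_values\<close>). For the multiplicities, weights and degrees this
  follows from the bounds on cardinalities and masses; for the angles one also needs that the boxes
  are not too thin, which follows from the mass bound and the volume \<open>a b r\<close> of a box
  (\<open>q_res_lower\<close>). The tags are weighed by their masses \<^emph>\<open>before\<close> the local step that follows, and
  the heaviest class is kept. Each kept tag then retains its local fraction, and summation gives the
  global inequalities. Represented fine mass and the labelled denominator are comparable with the
  labelled mass, so the same inequalities hold for them up to the ratio of the comparison constants
  (\<open>comparable_sums\<close>).
\<close>

section \<open>Heaviest classes and dyadic levels\<close>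

lemma dyadic_pos: "dyadic x \<Longrightarrow> 0 < x"
  by (auto simp: dyadic_def)

lemma dyadic_eq_floor_log: "dyadic x \<Longrightarrow> x = 2 powi \<lfloor>log 2 x\<rfloor>"
proof -
  assume "dyadic x"
  then obtain k :: int where k: "x = 2 powi k"
    by (auto simp: dyadic_def)
  have "log 2 (2 powr real_of_int k) = k"
    by simp
  then have "log 2 x = k"
    by (simp add: k powr_real_of_int')
  then show ?thesis
    by (simp add: k)
qed

lemma powi_floor_log:
  fixes x :: real
  assumes "0 < x"
  shows "2 powi \<lfloor>log 2 x\<rfloor> \<le> x" "x < 2 * 2 powi \<lfloor>log 2 x\<rfloor>"
proof -
  have "2 powi \<lfloor>log 2 x\<rfloor> = 2 powr \<lfloor>log 2 x\<rfloor>"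
    by (simp add: powr_real_of_int')
  moreover have "2 powr \<lfloor>log 2 x\<rfloor> \<le> 2 powr (log 2 x)"
    by (rule powr_mono) auto
  moreover have "2 powr (log 2 x) < 2 powr (1 + \<lfloor>log 2 x\<rfloor>)"
    by (rule powr_less_mono) linarith+
  ultimately show "2 powi \<lfloor>log 2 x\<rfloor> \<le> x" "x < 2 * 2 powi \<lfloor>log 2 x\<rfloor>"
    using assms by (auto simp: powr_add)
qed

lemma heaviest_class:
  fixes w :: "'a \<Rightarrow> real"
  assumes "finite S" "S \<noteq> {}"
  shows "\<exists>i\<in>f ` S. sum w S \<le> real (card (f ` S)) * sum w {x \<in> S. f x = i}"
proof -
  let ?g = "\<lambda>i. sum w {x \<in> S. f x = i}"
  have fin: "finite (f ` S)" and ne: "f ` S \<noteq> {}"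
    using assms by auto
  obtain i where i: "i \<in> f ` S" "?g i = Max (?g ` f ` S)"
    using Max_in[of "?g ` f ` S"] fin ne by (metis (no_types, lifting) finite_imageI image_iff image_is_empty)
  have "sum w S = (\<Sum>j\<in>f ` S. ?g j)"
    by (rule sum.image_gen[OF assms(1)])
  also have "\<dots> \<le> real (card (f ` S)) * ?g i"
    using fin by (intro sum_bounded_above) (simp add: i(2))
  finally show ?thesis
    using i(1) by blast
qed

text \<open>An interval \<open>[lo, hi]\<close> meets at most \<open>1 + \<lceil>log 2 (hi / lo)\<rceil>\<close> dyadic classes, because the integer parts of
  two logarithms differ by at most the rounded-up difference of the logarithms. The losses
  of the edge-weight, degree, volume and angle selections are instances of this count.\<close>

lemma heaviest_dyadic_class:
  fixes w v :: "'a \<Rightarrow> real"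
  assumes S: "finite S" "S \<noteq> {}" and w: "\<And>s. s \<in> S \<Longrightarrow> 0 \<le> w s"
    and lo: "0 < lo" and v: "\<And>s. s \<in> S \<Longrightarrow> lo \<le> v s \<and> v s \<le> hi"
  obtains t where "dyadic t" "{s \<in> S. t \<le> v s \<and> v s < 2 * t} \<noteq> {}"
    "sum w S \<le> (1 + of_int \<lceil>log 2 (hi / lo)\<rceil>) * sum w {s \<in> S. t \<le> v s \<and> v s < 2 * t}"
proof -
  let ?l = "\<lambda>s. \<lfloor>log 2 (v s)\<rfloor>"
  obtain s0 where "s0 \<in> S"
    using S by auto
  then have hi: "lo \<le> hi"
    using v by force
  obtain k where k: "k \<in> ?l ` S" "sum w S \<le> real (card (?l ` S)) * sum w {s \<in> S. ?l s = k}"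
    using heaviest_class[OF S] by (rule bexE)
  have "?l ` S \<subseteq> {\<lfloor>log 2 lo\<rfloor>..\<lfloor>log 2 hi\<rfloor>}"
  proof clarify
    fix s assume "s \<in> S"
    then have "lo \<le> v s" "v s \<le> hi"
      using v by auto
    then have "log 2 lo \<le> log 2 (v s)" "log 2 (v s) \<le> log 2 hi"
      using lo by auto
    then show "?l s \<in> {\<lfloor>log 2 lo\<rfloor>..\<lfloor>log 2 hi\<rfloor>}"
      by (auto intro: floor_mono)
  qed
  then have "card (?l ` S) \<le> card {\<lfloor>log 2 lo\<rfloor>..\<lfloor>log 2 hi\<rfloor>}"
    by (intro card_mono) auto
  moreover have "\<lfloor>log 2 hi\<rfloor> - \<lfloor>log 2 lo\<rfloor> \<le> \<lceil>log 2 (hi / lo)\<rceil>"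
    using lo hi by (simp add: log_divide) linarith
  moreover have "0 \<le> log 2 (hi / lo)"
    using lo hi by simp
  ultimately have "int (card (?l ` S)) \<le> 1 + \<lceil>log 2 (hi / lo)\<rceil>"
    by simp linarith
  then have card: "real (card (?l ` S)) \<le> 1 + of_int \<lceil>log 2 (hi / lo)\<rceil>"
    by linarith
  define t :: real where "t = 2 powi k"
  have sub: "{s \<in> S. ?l s = k} \<subseteq> {s \<in> S. t \<le> v s \<and> v s < 2 * t}"
  proof clarify
    fix s assume "s \<in> S" "k = ?l s"
    moreover from this have "0 < v s"
      using v lo by force
    ultimately show "t \<le> v s \<and> v s < 2 * t"
      unfolding t_def using powi_floor_log[of "v s"] by simp
  qed
  have "sum w S \<le> (1 + of_int \<lceil>log 2 (hi / lo)\<rceil>) * sum w {s \<in> S. ?l s = k}"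
    by (rule order_trans[OF k(2) mult_right_mono[OF card]]) (auto intro: sum_nonneg w)
  also have "\<dots> \<le> (1 + of_int \<lceil>log 2 (hi / lo)\<rceil>) * sum w {s \<in> S. t \<le> v s \<and> v s < 2 * t}"
    using card of_nat_0_le_iff[of "card (?l ` S)"] S(1) w sub
    by (intro mult_left_mono sum_mono2) (auto simp del: of_nat_0_le_iff)
  finally show thesis
    using that[of t] k(1) sub by (auto simp: t_def dyadic_def)
qed

text \<open>For the local volumes and the resolved angles the levels are counted upwards from a prescribed
  smallest value, which need not be a power of two; rescaling by it reduces to the dyadic case, and
  a nonempty class forces a nonnegative level.\<close>

lemma heaviest_level:
  fixes w v :: "'a \<Rightarrow> real"
  assumes S: "finite S" "S \<noteq> {}" and w: "\<And>s. s \<in> S \<Longrightarrow> 0 \<le> w s"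
    and lo: "0 < lo" and v: "\<And>s. s \<in> S \<Longrightarrow> lo \<le> v s \<and> v s \<le> hi"
  obtains j :: nat where "int j \<le> \<lceil>log 2 (hi / lo)\<rceil>" "{s \<in> S. 2 ^ j * lo \<le> v s \<and> v s < 2 ^ Suc j * lo} \<noteq> {}"
    "sum w S \<le> (1 + of_int \<lceil>log 2 (hi / lo)\<rceil>) * sum w {s \<in> S. 2 ^ j * lo \<le> v s \<and> v s < 2 ^ Suc j * lo}"
proof -
  have v': "\<And>s. s \<in> S \<Longrightarrow> 1 \<le> v s / lo \<and> v s / lo \<le> hi / lo"
    using v lo by (auto simp: field_simps)
  obtain t where t: "dyadic t" "{s \<in> S. t \<le> v s / lo \<and> v s / lo < 2 * t} \<noteq> {}"
    "sum w S \<le> (1 + of_int \<lceil>log 2 (hi / lo)\<rceil>) * sum w {s \<in> S. t \<le> v s / lo \<and> v s / lo < 2 * t}"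
    by (rule heaviest_dyadic_class[of S w 1 "\<lambda>s. v s / lo" "hi / lo"])
      (use S w v' in auto)
  obtain s where s: "s \<in> S" "t \<le> v s / lo" "v s / lo < 2 * t"
    using t(2) by auto
  then have "1 < 2 * t" "t \<le> hi / lo"
    using v'[OF s(1)] by linarith+
  obtain k :: int where k: "t = 2 powi k"
    using t(1) by (auto simp: dyadic_def)
  have "0 \<le> k"
  proof (rule ccontr)
    assume "\<not> 0 \<le> k"
    then have "k + 1 \<le> 0"
      by simp
    then have "(2::real) powi (k + 1) \<le> 2 powi 0"
      by (rule power_int_increasing) auto
    then show False
      using \<open>1 < 2 * t\<close> by (simp add: k power_int_add)
  qed
  then have tj: "t = 2 ^ nat k"
    by (simp add: k power_int_def)
  have "log 2 t \<le> log 2 (hi / lo)"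
    using \<open>t \<le> hi / lo\<close> dyadic_pos[OF t(1)] by simp
  then have "int (nat k) \<le> \<lceil>log 2 (hi / lo)\<rceil>"
    unfolding tj by (simp add: log_nat_power) linarith
  moreover have "{s \<in> S. t \<le> v s / lo \<and> v s / lo < 2 * t}
      = {s \<in> S. 2 ^ nat k * lo \<le> v s \<and> v s < 2 ^ Suc (nat k) * lo}"
    using lo by (auto simp: tj field_simps)
  ultimately show thesis
    using that[of "nat k"] t by simp
qed

text \<open>Powers of two in a range that is polynomial in \<open>X\<close> are determined by their logarithms, so there are
  only \<open>O(log X)\<close> of them. With \<open>X = 2 / \<delta>\<close> this is the source of every level count of the
  synchronisation.\<close>

lemma card_dyadic_values:
  fixes V :: "real set"
  assumes "2 \<le> X" "0 \<le> B" and V: "\<And>x. x \<in> V \<Longrightarrow> dyadic x \<and> X powr (- B) \<le> x \<and> x \<le> X powr B"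
  shows "real (card V) \<le> (2 + 2 * B) / ln 2 * ln X"
proof -
  let ?b = "B * log 2 X"
  have l: "1 \<le> log 2 X"
    using assms by simp
  have "V \<subseteq> (\<lambda>k. 2 powi k) ` {\<lfloor>- ?b\<rfloor>..\<lfloor>?b\<rfloor>}"
  proof
    fix x assume x: "x \<in> V"
    have "log 2 (X powr (- B)) \<le> log 2 x" "log 2 x \<le> log 2 (X powr B)"
      using V[OF x] assms dyadic_pos[of x] by auto
    then have "- ?b \<le> log 2 x" "log 2 x \<le> ?b"
      using assms by (auto simp: log_powr)
    then have "\<lfloor>log 2 x\<rfloor> \<in> {\<lfloor>- ?b\<rfloor>..\<lfloor>?b\<rfloor>}"
      by (auto intro: floor_mono)
    then show "x \<in> (\<lambda>k. 2 powi k) ` {\<lfloor>- ?b\<rfloor>..\<lfloor>?b\<rfloor>}"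
      using dyadic_eq_floor_log V[OF x] by blast
  qed
  then have "card V \<le> card {\<lfloor>- ?b\<rfloor>..\<lfloor>?b\<rfloor>}"
    by (intro surj_card_le) auto
  moreover have "0 \<le> ?b"
    using l assms by simp
  ultimately have "real (card V) \<le> 2 + 2 * ?b"
    by simp linarith
  also have "\<dots> \<le> 2 * log 2 X + 2 * ?b"
    using l by simp
  also have "\<dots> = (2 + 2 * B) / ln 2 * ln X"
    by (simp add: log_def field_simps)
  finally show ?thesis .
qed

section \<open>Grid cells\<close>

lemma grid_cell_eq:
  assumes "0 < h" "x \<in> grid_cell h k"
  shows "k = (\<chi> i. \<lfloor>x $ i / h\<rfloor>)"
  using assms by (auto simp: grid_cell_def vec_eq_iff field_simps intro!: floor_unique[symmetric])

lemma grid_disjoint: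
  assumes "0 < h" "Q \<in> grid h" "Q' \<in> grid h" "x \<in> Q" "x \<in> Q'"
  shows "Q = Q'"
  using assms grid_cell_eq[OF assms(1)] by (auto simp: grid_def)

lemma grid_cover:
  assumes "0 < h"
  obtains Q where "Q \<in> grid h" "x \<in> Q"
proof
  show "grid_cell h (\<chi> i. \<lfloor>x $ i / h\<rfloor>) \<in> grid h"
    unfolding grid_def by (auto simp: grid_def)
  have "h * \<lfloor>x $ i / h\<rfloor> \<le> x $ i \<and> x $ i < h * (\<lfloor>x $ i / h\<rfloor> + 1)" for i
  proof -
    have "h * \<lfloor>x $ i / h\<rfloor> \<le> h * (x $ i / h)"
      using assms by (intro mult_left_mono) linarith+
    moreover have "h * (x $ i / h) < h * (\<lfloor>x $ i / h\<rfloor> + 1)"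
      using assms by (intro mult_strict_left_mono) linarith+
    ultimately show ?thesis
      using assms by simp
  qed
  then show "x \<in> grid_cell h (\<chi> i. \<lfloor>x $ i / h\<rfloor>)"
    by (simp add: grid_cell_def)
qed

text \<open>The integer coordinates of a cell are recovered from any of its points by rounding down, so a
  bounded set only leaves finitely many choices.\<close>

lemma finite_cells_meeting_bounded:
  assumes "0 < h" "bounded S"
  shows "finite {Q \<in> grid h. Q \<inter> S \<noteq> {}}"
proof -
  obtain b where b: "\<And>x. x \<in> S \<Longrightarrow> norm x \<le> b"
    using assms(2) by (auto simp: bounded_iff)
  define F where "F = {\<lfloor>- (b / h)\<rfloor>..\<lfloor>b / h\<rfloor>}"
  have "{Q \<in> grid h. Q \<inter> S \<noteq> {}} \<subseteq> grid_cell h ` vec_lambda ` (PiE UNIV (\<lambda>_. F))"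
  proof
    fix Q assume "Q \<in> {Q \<in> grid h. Q \<inter> S \<noteq> {}}"
    then obtain x where x: "Q \<in> grid h" "x \<in> Q" "x \<in> S"
      by auto
    then obtain k where k: "Q = grid_cell h k" "k = (\<chi> i. \<lfloor>x $ i / h\<rfloor>)"
      using grid_cell_eq[OF assms(1)] by (auto simp: grid_def)
    have "\<bar>x $ i\<bar> \<le> b" for i
      using b[OF x(3)] component_le_norm_cart[of x i] by linarith
    then have "- (b / h) \<le> x $ i / h" "x $ i / h \<le> b / h" for i
      using assms(1) by (auto simp: field_simps abs_le_iff minus_le_iff)
    then have "(\<lambda>i. \<lfloor>x $ i / h\<rfloor>) \<in> PiE UNIV (\<lambda>_. F)"
      unfolding F_def by (auto simp del: floor_minus intro!: floor_mono)
    then show "Q \<in> grid_cell h ` vec_lambda ` (PiE UNIV (\<lambda>_. F))"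
      using k by blast
  qed
  then show ?thesis
    by (rule finite_subset) (auto intro!: finite_imageI finite_PiE simp: F_def)
qed

lemma box_subset_grid_cell:
  "box (\<chi> i. h * of_int (k $ i)) (\<chi> i. h * (of_int (k $ i) + 1)) \<subseteq> grid_cell h k"
  by (auto simp: grid_cell_def mem_box_cart less_imp_le)

lemma grid_cell_subset_cbox:
  "grid_cell h k \<subseteq> cbox (\<chi> i. h * of_int (k $ i)) (\<chi> i. h * (of_int (k $ i) + 1))"
  by (auto simp: grid_cell_def mem_box_cart less_imp_le)

lemma grid_cell_borel: "grid_cell h k \<in> sets borel"
proof -
  have "grid_cell h k = (\<Inter>i. {x. h * of_int (k $ i) \<le> x $ i} \<inter> {x. x $ i < h * (of_int (k $ i) + 1)})"
    by (auto simp: grid_cell_def)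
  moreover have "{x :: pt. h * of_int (k $ i) \<le> x $ i} \<in> sets borel"
      "{x :: pt. x $ i < h * (of_int (k $ i) + 1)} \<in> sets borel" for i
    by (auto intro: borel_closed borel_open closed_Collect_le open_Collect_less continuous_intros)
  ultimately show ?thesis
    by (auto intro!: sets.countable_INT')
qed

lemma content_cbox_cube:
  fixes l :: pt
  assumes "0 \<le> c"
  shows "measure lebesgue (cbox l (\<chi> i. l $ i + c)) = c ^ 3"
proof -
  have "cbox l (\<chi> i. l $ i + c) \<noteq> {}"
    using assms by (auto simp: interval_ne_empty_cart)
  then show ?thesis
    by (simp add: content_cbox_cart)
qed

lemma grid_lmeasurable: "Q \<in> grid h \<Longrightarrow> Q \<in> lmeasurable"
  using grid_cell_borel bounded_subset[OF bounded_cbox grid_cell_subset_cbox]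
  by (auto simp: grid_def intro!: bounded_set_imp_lmeasurable)

lemma vol_grid_cell:
  assumes "0 < h" "Q \<in> grid h"
  shows "vol Q = h ^ 3"
proof -
  obtain k where Q: "Q = grid_cell h k"
    using assms by (auto simp: grid_def)
  let ?l = "\<chi> i. h * of_int (k $ i) :: pt"
  have u: "(\<chi> i. h * (of_int (k $ i) + 1)) = (\<chi> i. ?l $ i + h)"
    by (simp add: vec_eq_iff algebra_simps)
  have c: "vol (cbox ?l (\<chi> i. ?l $ i + h)) = h ^ 3"
    using assms by (intro content_cbox_cube) auto
  have "vol Q \<le> h ^ 3"
    unfolding Q c[symmetric] using grid_cell_subset_cbox[of h k, unfolded u] grid_cell_borel
    by (intro measure_mono_fmeasurable) auto
  moreover have "vol (box ?l (\<chi> i. ?l $ i + h)) \<le> vol Q"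
    unfolding Q using box_subset_grid_cell[of h k, unfolded u] grid_lmeasurable[OF assms(2)]
    by (intro measure_mono_fmeasurable) (auto simp: Q)
  moreover have "vol (box ?l (\<chi> i. ?l $ i + h)) = h ^ 3"
    using c by (simp add: measure_lborel_box_eq measure_lborel_cbox_eq)
  ultimately show ?thesis
    by simp
qed

text \<open>A neighbourhood of a cell lies in a concentric cube; this is the upper bound for the local volumes.\<close>

lemma vol_near_grid_cell_le:
  assumes "0 < h" "0 \<le> s" "Q \<in> grid h" "S \<in> sets lebesgue"
  shows "vol (S \<inter> nbhd s Q) \<le> (h + 2 * s) ^ 3"
proof -
  obtain k where Q: "Q = grid_cell h k"
    using assms by (auto simp: grid_def)
  let ?l = "\<chi> i. h * of_int (k $ i) - s :: pt"
  have sub: "nbhd s Q \<subseteq> cbox ?l (\<chi> i. ?l $ i + (h + 2 * s))"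
  proof
    fix x assume "x \<in> nbhd s Q"
    then obtain y where y: "y \<in> grid_cell h k" "dist y x < s"
      by (auto simp: nbhd_def Q)
    have "h * of_int (k $ i) - s \<le> x $ i \<and> x $ i \<le> h * of_int (k $ i) - s + (h + 2 * s)" for i
    proof -
      have "\<bar>y $ i - x $ i\<bar> < s"
        using component_le_norm_cart[of "y - x" i] y(2) by (simp add: dist_norm)
      moreover have "h * of_int (k $ i) \<le> y $ i" "y $ i < h * of_int (k $ i) + h"
        using y(1) by (auto simp: grid_cell_def algebra_simps)
      ultimately show ?thesis
        by linarith
    qed
    then show "x \<in> cbox ?l (\<chi> i. ?l $ i + (h + 2 * s))"
      unfolding mem_box_cart by simp
  qed
  have "open (nbhd s Q)"
    by (auto simp: nbhd_def)
  then have "vol (S \<inter> nbhd s Q) \<le> vol (cbox ?l (\<chi> i. ?l $ i + (h + 2 * s)))"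
    using sub assms(4) by (intro measure_mono_fmeasurable) auto
  also have "\<dots> = (h + 2 * s) ^ 3"
    using assms by (intro content_cbox_cube) auto
  finally show ?thesis .
qed

section \<open>Masses and edge weights in one tag\<close>

lemma finite_values_attain_max:
  fixes g :: "'a \<Rightarrow> real"
  assumes "finite (g ` S)" "S \<noteq> {}"
  obtains x where "x \<in> S" "\<And>y. y \<in> S \<Longrightarrow> g y \<le> g x"
proof -
  have "Max (g ` S) \<in> g ` S"
    using assms by (intro Max_in) auto
  then obtain x where "x \<in> S" "g x = Max (g ` S)"
    by auto
  then show thesis
    using that[of x] assms by simp
qed

lemma sum_vol_pos_nonempty:
  assumes "0 < (\<Sum>i\<in>I. vol (F i))"
  obtains i where "i \<in> I" "F i \<noteq> {}"
proof (cases "\<forall>i\<in>I. F i = {}")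
  case True
  then have "(\<Sum>i\<in>I. vol (F i)) = 0"
    by simp
  then show thesis
    using assms by simp
qed (use that in blast)

lemma overlap_eq_card: "finite S \<Longrightarrow> overlap S Y x = real (card {T \<in> S. x \<in> Y T})"
  by (simp add: overlap_def indicator_def sum.If_cases Int_def)

lemma overlap_measurable:
  assumes "\<And>T. T \<in> S \<Longrightarrow> Y T \<in> sets lebesgue"
  shows "overlap S Y \<in> borel_measurable lebesgue"
  unfolding overlap_def using assms by (intro borel_measurable_sum borel_measurable_indicator)

lemma finite_incident: "finite E \<Longrightarrow> finite (incident E Q)"
  by (rule finite_subset[of _ "fst ` E"]) (force simp: incident_def)+

lemma card_incident_le: "finite E \<Longrightarrow> card (incident E Q) \<le> card E"
  using card_mono[of "fst ` E" "incident E Q"] card_image_le[of E fst]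
  by (force simp: incident_def image_iff)

lemma sum_edges_eq_sum_cells:
  fixes w :: "'p \<times> pt set \<Rightarrow> real"
  assumes "finite E"
  shows "sum w E = (\<Sum>Q\<in>snd ` E. \<Sum>P\<in>incident E Q. w (P, Q))"
proof -
  have "sum w {e \<in> E. snd e = Q} = (\<Sum>P\<in>incident E Q. w (P, Q))" for Q
    by (rule sum.reindex_bij_witness[where i = "\<lambda>P. (P, Q)" and j = fst]) (auto simp: incident_def)
  then show ?thesis
    using sum.image_gen[OF assms, of w snd] by simp
qed

lemma card_edges_eq_sum_cells:
  assumes "finite E"
  shows "real (card E) = (\<Sum>Q\<in>snd ` E. real (card (incident E Q)))"
  using sum_edges_eq_sum_cells[OF assms, of "\<lambda>_. 1"] by simp

text \<open>The facts about a single tag are collected in a chain of locales, one for each step of the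
  construction; \<open>h\<close> is the side of the grid cells.\<close>

locale cellular_tag =
  fixes c0 dil enl R0 a h :: real and D :: "('p, 't) tag"
  assumes input: "tag_input c0 dil enl R0 a D"
    and c0_pos: "0 < c0" and h_eq: "h = c0 * a"
begin

lemma a_pos: "0 < a"
  and side_le: "a \<le> side_b D" "side_b D \<le> side_r D"
  and finite_parents: "finite (parents D)"
  and finite_children: "finite (children D)"
  and mass_pos: "0 < mass D (shading D)"
  using input by (auto simp: tag_input_def)

lemma h_pos: "0 < h"
  using c0_pos a_pos by (simp add: h_eq)

lemma parent_in: "T \<in> children D \<Longrightarrow> parent D T \<in> parents D"
  using input by (auto simp: tag_input_def)

lemma finite_kids: "finite (kids D P)"
  using finite_children by (simp add: kids_def)

lemma kids_subset: "kids D P \<subseteq> children D"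
  by (auto simp: kids_def)

lemma sum_kids: "(\<Sum>P\<in>parents D. sum f (kids D P)) = sum f (children D)"
  unfolding kids_def
  by (rule sum.group[OF finite_children finite_parents]) (auto simp: parent_in)

lemma carrier_in_ball:
  assumes "T \<in> children D"
  shows "carrier D T \<subseteq> ball (centre D) (dil * radius D)"
  using assms parent_in[OF assms] input unfolding tag_input_def by blast

lemma shading_subset_carrier: "T \<in> children D \<Longrightarrow> shading D T \<subseteq> carrier D T"
  and shading_measurable: "T \<in> children D \<Longrightarrow> shading D T \<in> sets lebesgue"
  using input by (auto simp: tag_input_def)

lemma shading_in_ball: "T \<in> children D \<Longrightarrow> shading D T \<subseteq> ball (centre D) (dil * radius D)"
  using shading_subset_carrier carrier_in_ball by blast

lemma subshading_lmeasurable: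
  assumes "subshading D V" "T \<in> children D"
  shows "V T \<in> lmeasurable"
  using assms shading_in_ball[OF assms(2)]
  by (intro bounded_set_imp_lmeasurable bounded_subset[OF bounded_ball]) (auto simp: subshading_def)

lemma Y0_subset: "Y0 D mu T \<subseteq> shading D T"
  by (auto simp: Y0_def)

lemma subshading_Y0: "subshading D (Y0 D mu)"
  unfolding subshading_def
proof (intro ballI conjI Y0_subset)
  fix T assume T: "T \<in> children D"
  let ?f = "overlap (kids D (parent D T)) (shading D)"
  have f: "?f \<in> borel_measurable lebesgue"
    using kids_subset shading_measurable by (intro overlap_measurable) auto
  have "Y0 D mu T = shading D T \<inter> ({x \<in> space lebesgue. mu \<le> ?f x} \<inter> {x \<in> space lebesgue. ?f x < 2 * mu})"
    by (auto simp: Y0_def)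
  also have "\<dots> \<in> sets lebesgue"
    using f shading_measurable[OF T] by (intro sets.Int borel_measurable_le borel_measurable_less) auto
  finally show "Y0 D mu T \<in> sets lebesgue" .
qed

lemma subshading_shading: "subshading D (shading D)"
  by (auto simp: subshading_def shading_measurable)

lemma mass_nonneg: "0 \<le> mass D V"
  by (simp add: mass_def sum_nonneg)

lemma mass_mono:
  assumes "subshading D W" "subshading D V" "\<And>T. T \<in> children D \<Longrightarrow> V T \<subseteq> W T"
  shows "mass D V \<le> mass D W"
  unfolding mass_def using assms
  by (intro sum_mono measure_mono_fmeasurable subshading_lmeasurable) (auto simp: subshading_def)

text \<open>The cells at a parent are disjoint, so restricting a shading to the cells of an edge set splits its
  mass into the contributions of the edges. This turns every statement about masses into one about
  sums of edge weights.\<close>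

lemma mass_restrict_to:
  assumes V: "subshading D V" and E: "finite E" "E \<subseteq> parents D \<times> grid h"
  shows "subshading D (restrict_to D V E)"
    and "mass D (restrict_to D V E) = (\<Sum>(P, Q)\<in>E. \<Sum>T\<in>kids D P. vol (V T \<inter> Q))"
proof -
  have fin: "finite (E `` {P})" for P
    by (rule finite_Image[OF E(1)])
  have r: "restrict_to D V E T = (\<Union>Q\<in>E `` {parent D T}. V T \<inter> Q)" for T
    by (auto simp: restrict_to_def parent_shading_def)
  have m: "V T \<inter> Q \<in> lmeasurable" if "T \<in> children D" "(P, Q) \<in> E" for T P Q
    using that E(2) grid_lmeasurable[of Q h] subshading_lmeasurable[OF V]
    by (intro fmeasurable.Int) auto
  show "subshading D (restrict_to D V E)"
    unfolding subshading_def
  proof (intro ballI conjI)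
    fix T assume T: "T \<in> children D"
    show "restrict_to D V E T \<in> sets lebesgue"
      unfolding r using fin m[OF T] by (intro sets.finite_UN) auto
    show "restrict_to D V E T \<subseteq> shading D T"
      using V T by (auto simp: subshading_def restrict_to_def)
  qed
  have "vol (restrict_to D V E T) = (\<Sum>Q\<in>E `` {P}. vol (V T \<inter> Q))" if "T \<in> kids D P" for T P
  proof -
    have T: "T \<in> children D" "parent D T = P"
      using that by (auto simp: kids_def)
    have "pairwise (\<lambda>Q Q'. disjnt (V T \<inter> Q) (V T \<inter> Q')) (E `` {P})"
      using E(2) grid_disjoint[OF h_pos] by (fastforce simp: pairwise_def disjnt_iff)
    then show ?thesis
      unfolding r T(2) using fin m[OF T(1)] by (intro measure_UNION') auto
  qed
  then have "mass D (restrict_to D V E)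
      = (\<Sum>P\<in>parents D. \<Sum>T\<in>kids D P. \<Sum>Q\<in>E `` {P}. vol (V T \<inter> Q))"
    unfolding mass_def by (simp flip: sum_kids)
  also have "\<dots> = (\<Sum>P\<in>parents D. \<Sum>Q\<in>E `` {P}. \<Sum>T\<in>kids D P. vol (V T \<inter> Q))"
    by (intro sum.cong[OF refl] sum.swap)
  also have "\<dots> = (\<Sum>(P, Q)\<in>(SIGMA P:parents D. E `` {P}). \<Sum>T\<in>kids D P. vol (V T \<inter> Q))"
    using fin by (intro sum.Sigma finite_parents) auto
  also have "(SIGMA P:parents D. E `` {P}) = E"
    using E(2) by auto
  finally show "mass D (restrict_to D V E) = (\<Sum>(P, Q)\<in>E. \<Sum>T\<in>kids D P. vol (V T \<inter> Q))" .
qed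

lemma edge_weight_eq: "edge_weight D mu = (\<lambda>(P, Q). \<Sum>T\<in>kids D P. vol (Y0 D mu T \<inter> Q))"
  by auto

lemma edge_weight_nonneg: "0 \<le> edge_weight D mu e"
  by (cases e) (simp add: sum_nonneg)

lemma mass_restrict_Y0:
  assumes "finite E" "E \<subseteq> parents D \<times> grid h"
  shows "mass D (restrict_to D (Y0 D mu) E) = sum (edge_weight D mu) E"
  using mass_restrict_to(2)[OF subshading_Y0 assms] by (simp add: edge_weight_eq)

lemma sum_vol_parent_shading:
  assumes "finite E" "E \<subseteq> parents D \<times> grid h"
  shows "(\<Sum>P\<in>parents D. vol (parent_shading E P)) = real (card E) * h ^ 3"
proof -
  have fin: "finite (E `` {P})" for P
    by (rule finite_Image[OF assms(1)])
  have "vol (parent_shading E P) = (\<Sum>Q\<in>E `` {P}. h ^ 3)" for P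
  proof -
    have "pairwise (\<lambda>Q Q'. disjnt Q Q') (E `` {P})"
      using assms(2) grid_disjoint[OF h_pos] by (fastforce simp: pairwise_def disjnt_iff)
    moreover have g: "Q \<in> grid h" if "Q \<in> E `` {P}" for Q
      using that assms(2) by auto
    ultimately have "vol (\<Union>Q\<in>E `` {P}. Q) = (\<Sum>Q\<in>E `` {P}. vol Q)"
      using fin grid_lmeasurable[of _ h] by (intro measure_UNION') auto
    then have "vol (parent_shading E P) = (\<Sum>Q\<in>E `` {P}. vol Q)"
      by (simp add: parent_shading_def Image_singleton)
    also have "\<dots> = (\<Sum>Q\<in>E `` {P}. h ^ 3)"
      using g vol_grid_cell[OF h_pos] by (intro sum.cong) auto
    finally show ?thesis .
  qed
  then have "(\<Sum>P\<in>parents D. vol (parent_shading E P)) = (\<Sum>(P, Q)\<in>(SIGMA P:parents D. E `` {P}). h ^ 3)"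
    using fin finite_parents by (subst sum.Sigma[symmetric]) auto
  also have "(SIGMA P:parents D. E `` {P}) = E"
    using assms(2) by auto
  finally show ?thesis
    by simp
qed

definition ambient_cells :: "pt set set" where
  "ambient_cells = {Q \<in> grid h. Q \<inter> ball (centre D) (dil * radius D) \<noteq> {}}"

lemma finite_ambient_cells: "finite ambient_cells"
  unfolding ambient_cells_def by (rule finite_cells_meeting_bounded[OF h_pos]) auto

lemma active_cells_subset: "active_cells h D \<subseteq> ambient_cells"
proof
  fix Q assume "Q \<in> active_cells h D"
  then have Q: "Q \<in> grid h" "0 < (\<Sum>T\<in>children D. vol (shading D T \<inter> Q))"
    by (auto simp: active_cells_def)
  then obtain T where "T \<in> children D" "shading D T \<inter> Q \<noteq> {}"
    using sum_vol_pos_nonempty[of "\<lambda>T. shading D T \<inter> Q" "children D"] by blast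
  then show "Q \<in> ambient_cells"
    using Q(1) shading_in_ball[of T] by (auto simp: ambient_cells_def)
qed

lemma finite_active_cells: "finite (active_cells h D)"
  by (rule finite_subset[OF active_cells_subset finite_ambient_cells])

lemma E_plus_subset: "E_plus h D mu \<subseteq> parents D \<times> active_cells h D"
proof clarify
  fix P Q assume e: "(P, Q) \<in> E_plus h D mu"
  have "0 < (\<Sum>T\<in>kids D P. vol (Y0 D mu T \<inter> Q))"
    using e by (auto simp: E_plus_def)
  also have "\<dots> \<le> (\<Sum>T\<in>kids D P. vol (shading D T \<inter> Q))"
    using e kids_subset[of P] Y0_subset grid_lmeasurable[of Q h]
      subshading_lmeasurable[OF subshading_shading] subshading_Y0[of mu]
    by (intro sum_mono measure_mono_fmeasurable fmeasurable.Int)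
      (auto simp: E_plus_def subshading_def)
  also have "\<dots> \<le> (\<Sum>T\<in>children D. vol (shading D T \<inter> Q))"
    by (intro sum_mono2 finite_children kids_subset) auto
  finally show "P \<in> parents D \<and> Q \<in> active_cells h D"
    using e by (auto simp: E_plus_def active_cells_def)
qed

lemma finite_E_plus: "finite (E_plus h D mu)"
  using finite_parents finite_active_cells by (intro finite_subset[OF E_plus_subset]) auto

lemma E_plus_grid: "E_plus h D mu \<subseteq> parents D \<times> grid h"
  by (auto simp: E_plus_def)

text \<open>The total edge weight is the mass after the inner level selection: the cells that meet the ambient
  ball cover every child, and edges of weight zero contribute nothing.\<close>

lemma sum_E_plus: "sum (edge_weight D mu) (E_plus h D mu) = mass D (Y0 D mu)"
proof -
  let ?E = "parents D \<times> ambient_cells"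
  have E: "finite ?E" "?E \<subseteq> parents D \<times> grid h"
    using finite_parents finite_ambient_cells by (auto simp: ambient_cells_def)
  have "restrict_to D (Y0 D mu) ?E T = Y0 D mu T" if T: "T \<in> children D" for T
  proof -
    have "Y0 D mu T \<subseteq> parent_shading ?E (parent D T)"
    proof
      fix x assume "x \<in> Y0 D mu T"
      then have "x \<in> ball (centre D) (dil * radius D)"
        using Y0_subset shading_in_ball[OF T] by blast
      moreover obtain Q where "Q \<in> grid h" "x \<in> Q"
        using grid_cover[OF h_pos] .
      ultimately show "x \<in> parent_shading ?E (parent D T)"
        using parent_in[OF T] unfolding parent_shading_def ambient_cells_def by blast
    qed
    then show ?thesis
      by (auto simp: restrict_to_def)
  qed
  then have "mass D (Y0 D mu) = mass D (restrict_to D (Y0 D mu) ?E)"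
    by (simp add: mass_def)
  also have "\<dots> = sum (edge_weight D mu) ?E"
    by (rule mass_restrict_Y0[OF E])
  also have "\<dots> = sum (edge_weight D mu) (E_plus h D mu)"
  proof (rule sum.mono_neutral_right[OF E(1)])
    show "E_plus h D mu \<subseteq> ?E"
      using E_plus_subset active_cells_subset by blast
    show "\<forall>e\<in>?E - E_plus h D mu. edge_weight D mu e = 0"
    proof
      fix e assume "e \<in> ?E - E_plus h D mu"
      then have "\<not> 0 < edge_weight D mu e"
        using E(2) by (auto simp: E_plus_def)
      then show "edge_weight D mu e = 0"
        using edge_weight_nonneg[of mu e] by linarith
    qed
  qed
  finally show ?thesis ..
qed

end

section \<open>The joint construction\<close>

text \<open>The heaviest class is a maximum over infinitely many dyadic values, which exists because the
  classes are subsets of one finite set.\<close>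

lemma dyadic_maximizer_exists:
  fixes w :: "'b \<Rightarrow> real"
  assumes "finite A" "\<And>x. F x \<subseteq> A"
  shows "\<exists>x. dyadic x \<and> (\<forall>y. dyadic y \<longrightarrow> sum w (F y) \<le> sum w (F x))"
proof -
  have "finite ((\<lambda>x. sum w (F x)) ` Collect dyadic)"
    by (rule finite_subset[of _ "sum w ` Pow A"]) (use assms in auto)
  moreover have "Collect dyadic \<noteq> {}"
    by (auto simp: dyadic_def)
  ultimately obtain x where "x \<in> Collect dyadic" "\<And>y. y \<in> Collect dyadic \<Longrightarrow> sum w (F y) \<le> sum w (F x)"
    by (rule finite_values_attain_max) blast
  then show ?thesis
    by auto
qed

context cellular_tag
begin

lemma card_kids_le_N_max: "P \<in> parents D \<Longrightarrow> card (kids D P) \<le> N_max D"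
  unfolding N_max_def using finite_parents by (intro Max_ge) auto

lemma N_max_le: "N_max D \<le> card (children D)"
proof -
  have "N_max D \<in> (\<lambda>P. card (kids D P)) ` parents D"
    unfolding N_max_def using finite_parents input by (intro Max_in) (auto simp: tag_input_def)
  then show ?thesis
    using card_mono[OF finite_children kids_subset] by auto
qed

lemma N_max_ge_1: "1 \<le> N_max D"
proof -
  obtain T where T: "T \<in> children D"
    using sum_vol_pos_nonempty[of "shading D" "children D"] mass_pos by (auto simp: mass_def)
  then have "0 < card (kids D (parent D T))"
    using finite_kids by (auto simp: card_gt_0_iff kids_def)
  then show ?thesis
    using card_kids_le_N_max[OF parent_in[OF T]] by simp
qed

lemma overlap_kids_bounds:
  assumes "T \<in> kids D P" "P \<in> parents D" "x \<in> V T"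
  shows "1 \<le> overlap (kids D P) V x" "overlap (kids D P) V x \<le> N_max D"
proof -
  have "card {T \<in> kids D P. x \<in> V T} \<noteq> 0"
    using assms finite_kids by (auto simp: card_eq_0_iff)
  then show "1 \<le> overlap (kids D P) V x"
    unfolding overlap_eq_card[OF finite_kids] by simp
  have "card {T \<in> kids D P. x \<in> V T} \<le> N_max D"
    by (rule order_trans[OF card_mono[OF finite_kids] card_kids_le_N_max[OF assms(2)]]) auto
  then show "overlap (kids D P) V x \<le> N_max D"
    unfolding overlap_eq_card[OF finite_kids] by simp
qed

text \<open>The multiplicities on the shading are integers between \<open>1\<close> and \<open>N_max\<close>, so the admissible levels
  exhaust the shading and one of them keeps the average share of the mass.\<close>

lemma multiplicity_level_exists:
  "\<exists>k0::nat. int k0 \<le> \<lceil>log 2 (real (N_max D))\<rceil> \<and>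
     mass D (Y0 D (2 ^ k0)) \<ge> inverse (1 + of_int \<lceil>log 2 (real (N_max D))\<rceil>) * mass D (shading D)"
proof -
  define K where "K = nat \<lceil>log 2 (real (N_max D))\<rceil>"
  have "0 \<le> log 2 (real (N_max D))"
    using N_max_ge_1 by simp
  then have K: "int K = \<lceil>log 2 (real (N_max D))\<rceil>" "real K = \<lceil>log 2 (real (N_max D))\<rceil>"
    by (auto simp: K_def)
  have "vol (shading D T) \<le> (\<Sum>k\<le>K. vol (Y0 D (2 ^ k) T))" if T: "T \<in> children D" for T
  proof -
    have "shading D T \<subseteq> (\<Union>k\<le>K. Y0 D (2 ^ k) T)"
    proof
      fix x assume x: "x \<in> shading D T"
      define n where "n = overlap (kids D (parent D T)) (shading D) x"
      have n: "1 \<le> n" "n \<le> N_max D"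
        unfolding n_def using T x
        by (intro overlap_kids_bounds[of T]; auto simp: kids_def parent_in)+
      define k where "k = nat \<lfloor>log 2 n\<rfloor>"
      have l: "0 \<le> log 2 n" "log 2 n \<le> log 2 (real (N_max D))"
        using n by auto
      then have "k \<le> K"
        unfolding k_def K_def by (intro nat_mono) linarith
      moreover have "(2::real) powi \<lfloor>log 2 n\<rfloor> = 2 ^ k"
        using l by (simp add: k_def power_int_def)
      ultimately have "x \<in> Y0 D (2 ^ k) T"
        using powi_floor_log[of n] n x by (auto simp: Y0_def simp flip: n_def)
      then show "x \<in> (\<Union>k\<le>K. Y0 D (2 ^ k) T)"
        using \<open>k \<le> K\<close> by auto
    qed
    moreover have "Y0 D (2 ^ k) T \<in> lmeasurable" for k
      by (rule subshading_lmeasurable[OF subshading_Y0 T])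
    ultimately have "vol (shading D T) \<le> vol (\<Union>k\<le>K. Y0 D (2 ^ k) T)"
      using shading_measurable[OF T] by (intro measure_mono_fmeasurable fmeasurable.finite_UN) auto
    also have "\<dots> \<le> (\<Sum>k\<le>K. vol (Y0 D (2 ^ k) T))"
      using subshading_Y0 T by (intro measure_UNION_le) (auto simp: subshading_def)
    finally show ?thesis .
  qed
  then have "mass D (shading D) \<le> (\<Sum>T\<in>children D. \<Sum>k\<le>K. vol (Y0 D (2 ^ k) T))"
    unfolding mass_def by (rule sum_mono)
  also have "\<dots> = (\<Sum>k\<le>K. mass D (Y0 D (2 ^ k)))"
    unfolding mass_def by (rule sum.swap)
  finally have le: "mass D (shading D) \<le> (\<Sum>k\<le>K. mass D (Y0 D (2 ^ k)))" .
  obtain k where k: "k \<in> {..K}" "\<And>j. j \<in> {..K} \<Longrightarrow> mass D (Y0 D (2 ^ j)) \<le> mass D (Y0 D (2 ^ k))"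
    using finite_values_attain_max[of "\<lambda>k. mass D (Y0 D (2 ^ k))" "{..K}"] by blast
  have "(\<Sum>k\<le>K. mass D (Y0 D (2 ^ k))) \<le> (1 + real K) * mass D (Y0 D (2 ^ k))"
    using sum_bounded_above[of "{..K}", OF k(2)] by simp
  with le have "inverse (1 + real K) * mass D (shading D) \<le> mass D (Y0 D (2 ^ k))"
    by (simp add: field_simps)
  then show ?thesis
    using k(1) K by (intro exI[of _ k]) auto
qed

lemma finite_sub_E_plus: "E \<subseteq> E_plus h D mu \<Longrightarrow> finite E"
  using finite_E_plus finite_subset by blast

lemma E1_subset: "E1 h D mu om \<subseteq> E_plus h D mu"
  and E2_subset: "E2 h D mu om d \<subseteq> E1 h D mu om"
  by (auto simp: E1_def E2_def)

text \<open>The weights below half of the average carry at most half of the total weight \<open>\<Omega>\<close>, which is the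
  factor \<open>2\<close>. The remaining ones lie between \<open>\<Omega> / (2 card E_plus)\<close> and \<open>\<Omega>\<close>, which bounds the number of
  dyadic classes.\<close>

lemma edge_weight_level_exists:
  assumes pos: "0 < mass D (Y0 D mu)"
  obtains om where "dyadic om" "E1 h D mu om \<noteq> {}"
    "sum (edge_weight D mu) (E_plus h D mu)
      \<le> 2 * (1 + of_int \<lceil>log 2 (2 * real (card (E_plus h D mu)))\<rceil>) * sum (edge_weight D mu) (E1 h D mu om)"
proof -
  let ?w = "edge_weight D mu" and ?E = "E_plus h D mu"
  define Om where "Om = sum ?w ?E"
  define lo where "lo = Om / (2 * real (card ?E))"
  define S where "S = {e \<in> ?E. lo \<le> ?w e}"
  have Om: "0 < Om"
    using pos by (simp add: Om_def sum_E_plus)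
  then have "?E \<noteq> {}"
    by (auto simp: Om_def)
  then have card: "0 < real (card ?E)"
    using finite_E_plus by (auto simp: card_gt_0_iff)
  have lo: "0 < lo"
    using Om card by (simp add: lo_def)
  have S: "finite S" "S \<subseteq> ?E"
    by (auto simp: S_def finite_E_plus)
  have "sum ?w (?E - S) \<le> of_nat (card (?E - S)) * lo"
    by (rule sum_bounded_above) (auto simp: S_def)
  also have "\<dots> \<le> of_nat (card ?E) * lo"
    using lo finite_E_plus by (intro mult_right_mono) (auto intro: card_mono)
  also have "\<dots> = Om / 2"
    using card by (simp add: lo_def)
  finally have half: "Om \<le> 2 * sum ?w S"
    using sum.subset_diff[OF S(2) finite_E_plus, of ?w] by (simp add: Om_def)
  then have "S \<noteq> {}"
    using Om by auto
  have "?w e \<le> Om" if "e \<in> S" for e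
    unfolding Om_def using that S finite_E_plus by (intro member_le_sum edge_weight_nonneg) auto
  then have range: "\<And>e. e \<in> S \<Longrightarrow> lo \<le> ?w e \<and> ?w e \<le> Om"
    by (auto simp: S_def)
  obtain t where t: "dyadic t" "{e \<in> S. t \<le> ?w e \<and> ?w e < 2 * t} \<noteq> {}"
    "sum ?w S \<le> (1 + of_int \<lceil>log 2 (Om / lo)\<rceil>) * sum ?w {e \<in> S. t \<le> ?w e \<and> ?w e < 2 * t}"
    by (rule heaviest_dyadic_class[OF S(1) \<open>S \<noteq> {}\<close> edge_weight_nonneg[of mu] lo range])
  have "Om / lo = 2 * real (card ?E)"
    using Om card by (simp add: lo_def)
  moreover have E1: "{e \<in> S. t \<le> ?w e \<and> ?w e < 2 * t} = E1 h D mu t"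
    by (auto simp: S_def E1_def lo_def Om_def)
  ultimately have "sum ?w S \<le> (1 + of_int \<lceil>log 2 (2 * real (card ?E))\<rceil>) * sum ?w (E1 h D mu t)"
    using t(3) by simp
  then have le: "sum ?w ?E \<le> 2 * ((1 + of_int \<lceil>log 2 (2 * real (card ?E))\<rceil>) * sum ?w (E1 h D mu t))"
    using half unfolding Om_def by linarith
  show thesis
    by (rule that[OF t(1) t(2)[unfolded E1]]) (use le in \<open>simp only: mult.assoc\<close>)
qed

lemma right_degree_level_exists:
  assumes "E1 h D mu om \<noteq> {}"
  obtains d where "dyadic d" "E2 h D mu om d \<noteq> {}"
    "sum (edge_weight D mu) (E1 h D mu om)
      \<le> (1 + of_int \<lceil>log 2 (real (card (E1 h D mu om)))\<rceil>) * sum (edge_weight D mu) (E2 h D mu om d)"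
proof -
  let ?w = "edge_weight D mu" and ?E = "E1 h D mu om"
  have fin: "finite ?E"
    by (rule finite_sub_E_plus[OF E1_subset])
  have "1 \<le> right_degree ?E (snd e) \<and> right_degree ?E (snd e) \<le> card ?E" if "e \<in> ?E" for e
  proof -
    have "fst e \<in> incident ?E (snd e)"
      using that by (simp add: incident_def)
    then have "card (incident ?E (snd e)) \<noteq> 0"
      using finite_incident[OF fin] by (auto simp: card_eq_0_iff)
    then show ?thesis
      using card_incident_le[OF fin] by (simp add: right_degree_def)
  qed
  then have range: "\<And>e. e \<in> ?E \<Longrightarrow> 1 \<le> right_degree ?E (snd e) \<and> right_degree ?E (snd e) \<le> card ?E"
    by blast
  obtain t where "dyadic t"
    "{e \<in> ?E. t \<le> right_degree ?E (snd e) \<and> right_degree ?E (snd e) < 2 * t} \<noteq> {}"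
    "sum ?w ?E \<le> (1 + of_int \<lceil>log 2 (real (card ?E) / 1)\<rceil>)
      * sum ?w {e \<in> ?E. t \<le> right_degree ?E (snd e) \<and> right_degree ?E (snd e) < 2 * t}"
    by (rule heaviest_dyadic_class[OF fin assms edge_weight_nonneg[of mu] zero_less_one range])
  then show thesis
    using that[of t] by (simp add: E2_def)
qed

lemma joint_run_exists: "\<exists>mu om d. joint_run h D mu om d"
proof -
  obtain k0 where k0: "int k0 \<le> \<lceil>log 2 (real (N_max D))\<rceil>"
    "mass D (Y0 D (2 ^ k0)) \<ge> inverse (1 + of_int \<lceil>log 2 (real (N_max D))\<rceil>) * mass D (shading D)"
    using multiplicity_level_exists by blast
  define mu :: real where "mu = 2 ^ k0"
  obtain om where om: "dyadic om"
    "\<forall>om'. dyadic om' \<longrightarrow> sum (edge_weight D mu) (E1 h D mu om') \<le> sum (edge_weight D mu) (E1 h D mu om)"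
    using dyadic_maximizer_exists[of "E_plus h D mu" "E1 h D mu" "edge_weight D mu",
        OF finite_E_plus E1_subset] by auto
  obtain d where "dyadic d"
    "\<forall>d'. dyadic d' \<longrightarrow> sum (edge_weight D mu) (E2 h D mu om d') \<le> sum (edge_weight D mu) (E2 h D mu om d)"
    using dyadic_maximizer_exists[of "E1 h D mu om" "E2 h D mu om" "edge_weight D mu",
        OF finite_sub_E_plus[OF E1_subset] E2_subset] by auto
  then have "joint_run h D mu om d"
    unfolding joint_run_def using om k0 mu_def by blast
  then show ?thesis
    by blast
qed

end

locale joint_run_tag = cellular_tag +
  fixes mu om d :: real
  assumes run: "joint_run h D mu om d"
begin

abbreviation w where "w \<equiv> edge_weight D mu"
abbreviation levels where "levels \<equiv> (of_int \<lceil>log 2 (real (N_max D))\<rceil> :: real)"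

lemma levels_nonneg: "0 \<le> levels"
proof -
  have "0 \<le> log 2 (real (N_max D))"
    using N_max_ge_1 by simp
  then show ?thesis
    by simp
qed

lemma dyadic_levels: "dyadic mu" "dyadic om" "dyadic d"
  using run unfolding joint_run_def dyadic_def by (metis power_int_of_nat)+

lemma om_maximal: "dyadic om' \<Longrightarrow> sum w (E1 h D mu om') \<le> sum w (E1 h D mu om)"
  and d_maximal: "dyadic d' \<Longrightarrow> sum w (E2 h D mu om d') \<le> sum w (E2 h D mu om d)"
  using run unfolding joint_run_def by blast+

lemma mu_pos: "0 < mu" and om_pos: "0 < om" and d_pos: "0 < d"
  using dyadic_levels dyadic_pos by auto

lemma mass_Y0: "mass D (shading D) \<le> (1 + levels) * mass D (Y0 D mu)"
  using run levels_nonneg by (auto simp: joint_run_def field_simps)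

lemma mass_Y0_pos: "0 < mass D (Y0 D mu)"
proof -
  have "0 < (1 + levels) * mass D (Y0 D mu)"
    using mass_Y0 mass_pos by simp
  then show ?thesis
    using levels_nonneg by (simp add: zero_less_mult_iff)
qed

lemma E_plus_bounds: "1 \<le> real (card (E_plus h D mu))"
    "sum w (E_plus h D mu) \<le> 2 * (1 + of_int \<lceil>log 2 (2 * real (card (E_plus h D mu)))\<rceil>) * sum w (E1 h D mu om)"
proof -
  let ?c = "2 * (1 + of_int \<lceil>log 2 (2 * real (card (E_plus h D mu)))\<rceil>) :: real"
  have "E_plus h D mu \<noteq> {}"
    using mass_Y0_pos sum_E_plus[of mu] by auto
  then have "card (E_plus h D mu) \<noteq> 0"
    using finite_E_plus by (auto simp: card_eq_0_iff)
  then show 1: "1 \<le> real (card (E_plus h D mu))"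
    by linarith
  have c: "0 \<le> ?c"
  proof -
    have "0 \<le> log 2 (2 * real (card (E_plus h D mu)))"
      using 1 by simp
    then show ?thesis
      by simp
  qed
  obtain om' where "dyadic om'" "sum w (E_plus h D mu) \<le> ?c * sum w (E1 h D mu om')"
    using edge_weight_level_exists[OF mass_Y0_pos] by blast
  moreover have "?c * sum w (E1 h D mu om') \<le> ?c * sum w (E1 h D mu om)"
    using om_maximal[OF \<open>dyadic om'\<close>] c by (rule mult_left_mono)
  ultimately show "sum w (E_plus h D mu) \<le> ?c * sum w (E1 h D mu om)"
    by simp
qed

lemma finite_E1: "finite (E1 h D mu om)"
  by (rule finite_sub_E_plus[OF E1_subset])

lemma finite_E2: "finite (E2 h D mu om d)"
  by (rule finite_subset[OF E2_subset finite_E1])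

lemma E1_grid: "E1 h D mu om \<subseteq> parents D \<times> grid h"
  by (rule subset_trans[OF E1_subset E_plus_grid])

lemma E2_grid: "E2 h D mu om d \<subseteq> parents D \<times> grid h"
  by (rule subset_trans[OF E2_subset E1_grid])

lemma E1_bounds: "1 \<le> real (card (E1 h D mu om))"
    "sum w (E1 h D mu om) \<le> (1 + of_int \<lceil>log 2 (real (card (E1 h D mu om)))\<rceil>) * sum w (E2 h D mu om d)"
proof -
  let ?c = "1 + of_int \<lceil>log 2 (real (card (E1 h D mu om)))\<rceil> :: real"
  have "E1 h D mu om \<noteq> {}"
    using E_plus_bounds mass_Y0_pos sum_E_plus[of mu] by auto
  then have "card (E1 h D mu om) \<noteq> 0"
    using finite_E1 by (auto simp: card_eq_0_iff)
  then show 1: "1 \<le> real (card (E1 h D mu om))"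
    by linarith
  have "0 \<le> log 2 (real (card (E1 h D mu om)))"
    using 1 by simp
  then have c: "0 \<le> ?c"
    by simp
  obtain d' where "dyadic d'" "sum w (E1 h D mu om) \<le> ?c * sum w (E2 h D mu om d')"
    using right_degree_level_exists[OF \<open>E1 h D mu om \<noteq> {}\<close>] by blast
  moreover have "?c * sum w (E2 h D mu om d') \<le> ?c * sum w (E2 h D mu om d)"
    using d_maximal[OF \<open>dyadic d'\<close>] c by (rule mult_left_mono)
  ultimately show "sum w (E1 h D mu om) \<le> ?c * sum w (E2 h D mu om d)"
    by simp
qed

text \<open>The three selections lose the three factors of \<open>L_reg\<close>. Since the heaviest class is at least as heavy
  as the one found by counting, the loss does not depend on which admissible choice was made.\<close>

lemma L_reg_bounds:
  shows "1 \<le> L_reg h D mu om"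
    and "mass D (shading D) \<le> L_reg h D mu om * sum w (E2 h D mu om d)"
proof -
  let ?e = "2 * (1 + of_int \<lceil>log 2 (2 * real (card (E_plus h D mu)))\<rceil>) :: real"
  let ?f = "1 + of_int \<lceil>log 2 (real (card (E1 h D mu om)))\<rceil> :: real"
  have "0 \<le> log 2 (2 * real (card (E_plus h D mu)))" "0 \<le> log 2 (real (card (E1 h D mu om)))"
    using E_plus_bounds(1) E1_bounds(1) by auto
  then have ef: "1 \<le> ?e" "1 \<le> ?f"
    by auto
  have L: "L_reg h D mu om = (1 + levels) * (?e * (2 * ?f))"
    by (simp add: L_reg_def)
  have w2: "0 \<le> sum w (E2 h D mu om d)"
    by (intro sum_nonneg edge_weight_nonneg)
  have "1 * (1 * (2 * 1)) \<le> (1 + levels) * (?e * (2 * ?f))"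
    using levels_nonneg ef by (intro mult_mono) auto
  then show "1 \<le> L_reg h D mu om"
    by (simp add: L)
  have "mass D (shading D) \<le> (1 + levels) * mass D (Y0 D mu)"
    by (rule mass_Y0)
  also have "\<dots> \<le> (1 + levels) * (?e * (?f * sum w (E2 h D mu om d)))"
  proof (intro mult_left_mono)
    have "mass D (Y0 D mu) \<le> ?e * sum w (E1 h D mu om)"
      using E_plus_bounds(2) by (simp only: sum_E_plus)
    also have "\<dots> \<le> ?e * (?f * sum w (E2 h D mu om d))"
      using ef E1_bounds(2) by (intro mult_left_mono) auto
    finally show "mass D (Y0 D mu) \<le> ?e * (?f * sum w (E2 h D mu om d))" .
  qed (use levels_nonneg in simp)
  also have "\<dots> \<le> (1 + levels) * (?e * (2 * ?f * sum w (E2 h D mu om d)))"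
    using levels_nonneg ef w2 by (intro mult_left_mono mult_right_mono) auto
  also have "\<dots> = L_reg h D mu om * sum w (E2 h D mu om d)"
    by (simp add: L)
  finally show "mass D (shading D) \<le> L_reg h D mu om * sum w (E2 h D mu om d)" .
qed

lemma sum_E2_pos: "0 < sum w (E2 h D mu om d)"
proof -
  have "0 < L_reg h D mu om * sum w (E2 h D mu om d)"
    using L_reg_bounds(2) mass_pos by linarith
  then show ?thesis
    using L_reg_bounds(1) by (simp add: zero_less_mult_iff)
qed

lemma Q_plus_nonempty: "Q_plus h D mu om d \<noteq> {}"
  using sum_E2_pos by (auto simp: Q_plus_def)

text \<open>An edge subset that keeps or discards all edges at a cell together does not change the degree of a
  kept cell; this is why the volume selection has to be saturated.\<close>

lemma incident_saturated:
  assumes "E = {e \<in> E2 h D mu om d. R (snd e)}" "(P, Q) \<in> E"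
  shows "incident E Q = incident (E1 h D mu om) Q"
    and "d \<le> right_degree E Q" "right_degree E Q < 2 * d"
proof -
  show "incident E Q = incident (E1 h D mu om) Q"
    using assms by (auto simp: incident_def E2_def)
  then have "right_degree E Q = right_degree (E1 h D mu om) Q"
    by (simp add: right_degree_def)
  then show "d \<le> right_degree E Q" "right_degree E Q < 2 * d"
    using assms by (auto simp: E2_def)
qed

text \<open>The shaded part of a cell in one parent has labelled mass at least \<open>om\<close> and multiplicity below
  \<open>2 mu\<close>. Integrating the multiplicity bounds its volume, and hence the local volume, from below.\<close>

lemma local_volume_bounds:
  assumes s: "0 < s" and Q: "Q \<in> Q_plus h D mu om d"
  shows "om / (2 * mu) \<le> local_volume s h D mu om d Q"
    and "local_volume s h D mu om d Q \<le> (h + 2 * s) ^ 3"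
proof -
  obtain P where e: "(P, Q) \<in> E2 h D mu om d"
    using Q by (auto simp: Q_plus_def)
  then have P: "P \<in> parents D" and Qg: "Q \<in> grid h"
    using subsetD[OF E2_grid e] by auto
  have om: "om \<le> w (P, Q)"
    using subsetD[OF E2_subset e] unfolding E1_def by blast
  let ?Y = "Y_reg h D mu om d"
  have Y: "subshading D ?Y"
    unfolding Y_reg_def by (rule mass_restrict_to(1)[OF subshading_Y0 finite_E2 E2_grid])
  let ?U = "\<Union>T\<in>children D. ?Y T"
  have U: "?U \<in> lmeasurable"
    using Y by (intro fmeasurable.finite_UN finite_children subshading_lmeasurable)
  have nb: "open (nbhd s Q)" "Q \<subseteq> nbhd s Q"
    using s by (auto simp: nbhd_def)
  show "local_volume s h D mu om d Q \<le> (h + 2 * s) ^ 3"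
    unfolding local_volume_def using U s Qg h_pos by (intro vol_near_grid_cell_le) auto
  let ?B = "\<Union>T\<in>kids D P. Y0 D mu T \<inter> Q"
  have m: "Y0 D mu T \<inter> Q \<in> lmeasurable" if "T \<in> kids D P" for T
    using that kids_subset[of P] grid_lmeasurable[OF Qg] subshading_lmeasurable[OF subshading_Y0]
    by (intro fmeasurable.Int) auto
  have B: "?B \<in> lmeasurable"
    using m by (intro fmeasurable.finite_UN finite_kids)
  have "w (P, Q) = (\<Sum>T\<in>kids D P. \<integral>x. indicator (Y0 D mu T \<inter> Q) x \<partial>lebesgue)"
    using m by (auto intro!: sum.cong)
  also have "\<dots> = (\<integral>x. (\<Sum>T\<in>kids D P. indicator (Y0 D mu T \<inter> Q) x) \<partial>lebesgue)"
    using m by (intro Bochner_Integration.integral_sum[symmetric]) (simp add: lmeasurable_iff_integrable)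
  also have "\<dots> \<le> (\<integral>x. 2 * mu * indicator ?B x \<partial>lebesgue)"
  proof (rule integral_mono)
    show "integrable lebesgue (\<lambda>x. \<Sum>T\<in>kids D P. indicator (Y0 D mu T \<inter> Q) x :: real)"
      using m by (intro Bochner_Integration.integrable_sum) (simp add: lmeasurable_iff_integrable)
    show "integrable lebesgue (\<lambda>x. 2 * mu * indicator ?B x)"
      using B by (intro integrable_mult_right) (simp add: lmeasurable_iff_integrable)
    fix x
    show "(\<Sum>T\<in>kids D P. indicator (Y0 D mu T \<inter> Q) x) \<le> 2 * mu * indicator ?B x"
    proof (cases "x \<in> ?B")
      case True
      then obtain T0 where T0: "T0 \<in> kids D P" "x \<in> Y0 D mu T0"
        by auto
      have "(\<Sum>T\<in>kids D P. indicator (Y0 D mu T \<inter> Q) x) \<le> overlap (kids D P) (shading D) x"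
        unfolding overlap_def using Y0_subset by (intro sum_mono) (auto simp: indicator_def)
      also have "\<dots> \<le> 2 * mu"
        using T0 by (auto simp: Y0_def kids_def)
      finally show ?thesis
        using True by simp
    next
      case False
      then have "(\<Sum>T\<in>kids D P. indicator (Y0 D mu T \<inter> Q) x) = (0::real)"
        by (intro sum.neutral) auto
      then show ?thesis
        using False by simp
    qed
  qed
  also have "\<dots> = 2 * mu * vol ?B"
    by simp
  finally have "om \<le> 2 * mu * vol ?B"
    using om by linarith
  then have "om / (2 * mu) \<le> vol ?B"
    using mu_pos by (simp add: field_simps)
  also have "\<dots> \<le> local_volume s h D mu om d Q"
    unfolding local_volume_def
  proof (rule measure_mono_fmeasurable)
    show "?B \<subseteq> ?U \<inter> nbhd s Q"
      using e nb kids_subset by (fastforce simp: Y_reg_def restrict_to_def parent_shading_def kids_def)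
    show "?U \<inter> nbhd s Q \<in> lmeasurable"
      using U nb by (intro fmeasurable_Int_fmeasurable) auto
  qed (use B in auto)
  finally show "om / (2 * mu) \<le> local_volume s h D mu om d Q" .
qed

end

section \<open>The saturated local-volume selection\<close>

locale local_volume_tag = joint_run_tag +
  fixes s Cv :: real
  assumes s_pos: "0 < s" and Cv: "(h + 2 * s) ^ 3 \<le> Cv * a ^ 3"
begin

lemma local_volume_range:
  assumes "e \<in> E2 h D mu om d"
  shows "om / (2 * mu) \<le> local_volume s h D mu om d (snd e) \<and>
    local_volume s h D mu om d (snd e) \<le> Cv * a ^ 3"
  using local_volume_bounds[OF s_pos, of "snd e"] assms Cv by (force simp: Q_plus_def)

lemma lower_volume_pos: "0 < om / (2 * mu)"
  using om_pos mu_pos by simp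

lemma real_J_v: "real (J_v Cv a h D mu om d) = 1 + of_int \<lceil>log 2 (Cv * a ^ 3 / (om / (2 * mu)))\<rceil>"
proof -
  obtain e where "e \<in> E2 h D mu om d"
    using Q_plus_nonempty by (auto simp: Q_plus_def)
  then have "om / (2 * mu) \<le> Cv * a ^ 3"
    using local_volume_range[of e] by linarith
  moreover define X where "X = Cv * a ^ 3 / (om / (2 * mu))"
  ultimately have "1 \<le> X"
    using lower_volume_pos by (simp only: le_divide_eq_1_pos)
  then have "0 \<le> \<lceil>log 2 X\<rceil>"
    using zero_le_log_cancel_iff[of 2 X] by linarith
  moreover have "2 * Cv * a ^ 3 * mu / om = X"
    by (simp add: X_def)
  ultimately show ?thesis
    unfolding J_v_def X_def[symmetric] using Q_plus_nonempty by simp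
qed

lemma J_v_ge_1: "1 \<le> J_v Cv a h D mu om d"
  by (simp add: J_v_def)

lemma volume_selection_exists: "\<exists>E. volume_selection Cv a s h D mu om d E"
proof -
  let ?J = "{..<J_v Cv a h D mu om d}"
  have "?J \<noteq> {}"
    using J_v_ge_1 by (auto simp: lessThan_empty_iff)
  then obtain j where "j \<in> ?J"
    "\<And>i. i \<in> ?J \<Longrightarrow> sum w (volume_class s h D mu om d i) \<le> sum w (volume_class s h D mu om d j)"
    using finite_values_attain_max[of "\<lambda>j. sum w (volume_class s h D mu om d j)" ?J] by blast
  then show ?thesis
    unfolding volume_selection_def by auto
qed

end

locale volume_selected_tag = local_volume_tag +
  fixes E3
  assumes sel: "volume_selection Cv a s h D mu om d E3"
begin

abbreviation Y1 where "Y1 \<equiv> restrict_to D (Y0 D mu) E3"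

lemma E3_saturated: "\<exists>R. E3 = {e \<in> E2 h D mu om d. R (snd e)}"
proof -
  obtain j where "E3 = volume_class s h D mu om d j"
    using sel by (auto simp: volume_selection_def)
  then show ?thesis
    unfolding volume_class_def
    by (intro exI[of _ "\<lambda>Q. 2 ^ j * (om / (2 * mu)) \<le> local_volume s h D mu om d Q \<and>
        local_volume s h D mu om d Q < 2 ^ Suc j * (om / (2 * mu))"])
qed

lemma E3_subset: "E3 \<subseteq> E2 h D mu om d"
  using E3_saturated by auto

lemma finite_E3: "finite E3"
  by (rule finite_subset[OF E3_subset finite_E2])

lemma E3_grid: "E3 \<subseteq> parents D \<times> grid h"
  by (rule subset_trans[OF E3_subset E2_grid])

lemma subshading_Y1: "subshading D Y1"
  by (rule mass_restrict_to(1)[OF subshading_Y0 finite_E3 E3_grid])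

lemma mass_Y1: "mass D Y1 = sum w E3"
  by (rule mass_restrict_Y0[OF finite_E3 E3_grid])

lemma right_degree_E3:
  assumes "Q \<in> snd ` E3"
  shows "d \<le> right_degree E3 Q" "right_degree E3 Q < 2 * d"
proof -
  obtain P where P: "(P, Q) \<in> E3"
    using assms by auto
  obtain R where R: "E3 = {e \<in> E2 h D mu om d. R (snd e)}"
    using E3_saturated by auto
  show "d \<le> right_degree E3 Q" "right_degree E3 Q < 2 * d"
    by (rule incident_saturated(2,3)[OF R P])+
qed

text \<open>The \<open>J_v\<close> volume classes cover all possible local volumes, and the selected one is the heaviest.\<close>

lemma E2_weight_le: "sum w (E2 h D mu om d) \<le> real (J_v Cv a h D mu om d) * sum w E3"
proof -
  have ne: "E2 h D mu om d \<noteq> {}"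
    using Q_plus_nonempty by (auto simp: Q_plus_def)
  obtain j :: nat where j: "int j \<le> \<lceil>log 2 (Cv * a ^ 3 / (om / (2 * mu)))\<rceil>"
    "sum w (E2 h D mu om d) \<le> (1 + of_int \<lceil>log 2 (Cv * a ^ 3 / (om / (2 * mu)))\<rceil>) *
      sum w {e \<in> E2 h D mu om d. 2 ^ j * (om / (2 * mu)) \<le> local_volume s h D mu om d (snd e) \<and>
        local_volume s h D mu om d (snd e) < 2 ^ Suc j * (om / (2 * mu))}"
    by (rule heaviest_level[OF finite_E2 ne edge_weight_nonneg[of mu] lower_volume_pos local_volume_range])
  have le: "sum w (E2 h D mu om d) \<le> real (J_v Cv a h D mu om d) * sum w (volume_class s h D mu om d j)"
    using j(2) unfolding real_J_v volume_class_def .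
  have "real_of_int (int j) < real (J_v Cv a h D mu om d)"
    unfolding real_J_v using j(1) by linarith
  then have "sum w (volume_class s h D mu om d j) \<le> sum w E3"
    using sel by (auto simp: volume_selection_def)
  then have "real (J_v Cv a h D mu om d) * sum w (volume_class s h D mu om d j)
      \<le> real (J_v Cv a h D mu om d) * sum w E3"
    by (intro mult_left_mono) auto
  with le show ?thesis
    by linarith
qed

lemma mass_Y1_ge:
  "inverse (real (J_v Cv a h D mu om d) * L_reg h D mu om) * mass D (shading D) \<le> mass D Y1"
proof -
  have "mass D (shading D) \<le> L_reg h D mu om * sum w (E2 h D mu om d)"
    by (rule L_reg_bounds(2))
  also have "\<dots> \<le> L_reg h D mu om * (real (J_v Cv a h D mu om d) * sum w E3)"
    using L_reg_bounds(1) by (intro mult_left_mono E2_weight_le) auto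
  finally show ?thesis
    using L_reg_bounds(1) J_v_ge_1 by (simp add: mass_Y1 field_simps)
qed

lemma mass_Y1_pos: "0 < mass D Y1"
proof -
  have "0 < real (J_v Cv a h D mu om d) * L_reg h D mu om"
    using L_reg_bounds(1) J_v_ge_1 by (intro mult_pos_pos) auto
  then have "0 < inverse (real (J_v Cv a h D mu om d) * L_reg h D mu om) * mass D (shading D)"
    by (rule mult_pos_pos[OF positive_imp_inverse_positive mass_pos])
  then show ?thesis
    using mass_Y1_ge by linarith
qed

lemma child_point_in_parent_shading: "T \<in> kids D P \<Longrightarrow> Y1 T \<subseteq> parent_shading E3 P"
  by (auto simp: restrict_to_def kids_def)

text \<open>Inside the parent shading the selection removes nothing from the level set \<open>Y0\<close>, and on that
  level set the multiplicity is the one of the original shading.\<close>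

lemma inner_multiplicity:
  assumes "x \<in> (\<Union>T\<in>kids D P. Y1 T)"
  shows "mu \<le> overlap (kids D P) Y1 x" "overlap (kids D P) Y1 x < 2 * mu"
proof -
  obtain T0 where T0: "T0 \<in> kids D P" "x \<in> Y1 T0"
    using assms by auto
  let ?o = "overlap (kids D P) (shading D) x"
  have o: "mu \<le> ?o" "?o < 2 * mu"
    using T0 by (auto simp: kids_def restrict_to_def Y0_def)
  have "x \<in> parent_shading E3 P"
    using child_point_in_parent_shading T0 by blast
  then have "x \<in> Y1 T \<longleftrightarrow> x \<in> shading D T" if "T \<in> kids D P" for T
    using that o by (auto simp: restrict_to_def kids_def Y0_def)
  then have "overlap (kids D P) Y1 x = ?o"
    unfolding overlap_def by (intro sum.cong) (auto simp: indicator_def)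
  then show "mu \<le> overlap (kids D P) Y1 x" "overlap (kids D P) Y1 x < 2 * mu"
    using o by auto
qed

text \<open>Cells are disjoint, so the parents whose shading contains a point are those incident to the one
  retained cell that contains it.\<close>

lemma parents_at_point:
  assumes "(P, Q) \<in> E3" "x \<in> Q"
  shows "{P' \<in> parents D. x \<in> parent_shading E3 P'} = incident E3 Q"
proof -
  have "Q' = Q" if "(P', Q') \<in> E3" "x \<in> Q'" for P' Q'
    using that assms E3_grid grid_disjoint[OF h_pos, of Q' Q x] by blast
  then show ?thesis
    using assms(2) E3_grid by (auto simp: incident_def parent_shading_def)
qed

lemma outer_multiplicity:
  assumes "x \<in> (\<Union>P\<in>parents D. parent_shading E3 P)"
  shows "d \<le> (\<Sum>P\<in>parents D. indicator (parent_shading E3 P) x)"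
    and "(\<Sum>P\<in>parents D. indicator (parent_shading E3 P) x) < 2 * d"
proof -
  obtain P Q where e: "(P, Q) \<in> E3" "x \<in> Q"
    using assms by (auto simp: parent_shading_def)
  have "(\<Sum>P\<in>parents D. indicator (parent_shading E3 P) x)
      = real (card {P' \<in> parents D. x \<in> parent_shading E3 P'})"
    using overlap_eq_card[OF finite_parents] by (simp add: overlap_def)
  then have "(\<Sum>P\<in>parents D. indicator (parent_shading E3 P) x) = right_degree E3 Q"
    by (simp add: parents_at_point[OF e] right_degree_def)
  then show "d \<le> (\<Sum>P\<in>parents D. indicator (parent_shading E3 P) x)"
    "(\<Sum>P\<in>parents D. indicator (parent_shading E3 P) x) < 2 * d"
    using right_degree_E3[of Q] e by force+
qed

text \<open>At a point there are fewer than \<open>2 d\<close> parents, each contributing less than \<open>2 mu\<close> children.\<close>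

lemma total_multiplicity:
  assumes "x \<in> (\<Union>T\<in>children D. Y1 T)"
  shows "overlap (children D) Y1 x < 4 * mu * d"
proof -
  obtain T0 where T0: "T0 \<in> children D" "x \<in> Y1 T0"
    using assms by auto
  then obtain Q where e: "(parent D T0, Q) \<in> E3" "x \<in> Q"
    by (auto simp: restrict_to_def parent_shading_def)
  have "overlap (children D) Y1 x = (\<Sum>P\<in>parents D. overlap (kids D P) Y1 x)"
    unfolding overlap_def by (rule sum_kids[symmetric])
  also have "\<dots> = (\<Sum>P\<in>incident E3 Q. overlap (kids D P) Y1 x)"
  proof (rule sum.mono_neutral_right[OF finite_parents])
    show "incident E3 Q \<subseteq> parents D"
      using parents_at_point[OF e] by auto
    show "\<forall>P\<in>parents D - incident E3 Q. overlap (kids D P) Y1 x = 0"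
    proof
      fix P assume "P \<in> parents D - incident E3 Q"
      then have "x \<notin> parent_shading E3 P"
        using parents_at_point[OF e] by auto
      then have "\<And>T. T \<in> kids D P \<Longrightarrow> x \<notin> Y1 T"
        using child_point_in_parent_shading by blast
      then show "overlap (kids D P) Y1 x = 0"
        by (simp add: overlap_def)
    qed
  qed
  also have "\<dots> \<le> of_nat (card (incident E3 Q)) * (2 * mu)"
  proof (rule sum_bounded_above)
    fix P
    show "overlap (kids D P) Y1 x \<le> 2 * mu"
    proof (cases "x \<in> (\<Union>T\<in>kids D P. Y1 T)")
      case True
      then show ?thesis
        using inner_multiplicity(2)[OF True] by simp
    next
      case False
      then have "overlap (kids D P) Y1 x = 0"
        by (simp add: overlap_def)
      then show ?thesis
        using mu_pos by simp
    qed
  qed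
  also have "\<dots> = right_degree E3 Q * (2 * mu)"
    by (simp add: right_degree_def)
  also have "\<dots> < 2 * d * (2 * mu)"
    using mu_pos right_degree_E3(2)[of Q] e by (intro mult_strict_right_mono) force+
  finally show ?thesis
    by (simp add: mult_ac)
qed

end

section \<open>The angular selection\<close>

text \<open>Whenever some subfamily with a \<open>1 / A\<close> fraction of the members has its diameter smaller by a
  factor \<open>B\<close>, pass to it. Each step divides the diameter by \<open>B\<close> and costs a factor \<open>A\<close> in cardinality,
  and the process stops because every step removes members.\<close>

lemma stable_subfamily:
  fixes diam :: "'a set \<Rightarrow> real"
  assumes "finite S" "S \<noteq> {}" and AB: "1 \<le> A" "1 < B"
    and pos: "\<And>S'. finite S' \<Longrightarrow> S' \<noteq> {} \<Longrightarrow> 0 < diam S'"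
  shows "\<exists>S' j. S' \<subseteq> S \<and> S' \<noteq> {} \<and> diam S' * B ^ j \<le> diam S \<and>
    real (card S) \<le> A ^ j * real (card S') \<and>
    (\<forall>S''\<subseteq>S'. real (card S') \<le> A * real (card S'') \<longrightarrow> diam S' / B < diam S'')"
  using assms(1,2)
proof (induction S rule: finite_psubset_induct)
  case (psubset S)
  show ?case
  proof (cases "\<forall>S''\<subseteq>S. real (card S) \<le> A * real (card S'') \<longrightarrow> diam S / B < diam S''")
    case True
    then show ?thesis
      using psubset.prems by (intro exI[of _ S] exI[of _ "0::nat"]) auto
  next
    case False
    then obtain S2 where S2: "S2 \<subseteq> S" "real (card S) \<le> A * real (card S2)" "diam S2 \<le> diam S / B"
      by (auto simp: not_less)
    have "0 < card S"
      using psubset by (simp add: card_gt_0_iff)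
    then have "S2 \<noteq> {}"
      using S2(2) by auto
    have "diam S / B < diam S"
      using pos[OF psubset.hyps psubset.prems] AB by (simp add: field_simps)
    then have "S2 \<subset> S"
      using S2 by auto
    then obtain S' j where *: "S' \<subseteq> S2" "S' \<noteq> {}" "diam S' * B ^ j \<le> diam S2"
      "real (card S2) \<le> A ^ j * real (card S')"
      "\<forall>S''\<subseteq>S'. real (card S') \<le> A * real (card S'') \<longrightarrow> diam S' / B < diam S''"
      using psubset.IH[of S2] \<open>S2 \<noteq> {}\<close> by auto
    have "diam S' * B ^ j \<le> diam S / B"
      using *(3) S2(3) by linarith
    then have "diam S' * B ^ Suc j \<le> diam S"
      using AB by (simp add: field_simps)
    moreover have "A * real (card S2) \<le> A * (A ^ j * real (card S'))"
      using AB *(4) by (intro mult_left_mono) auto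
    then have "real (card S) \<le> A ^ Suc j * real (card S')"
      using S2(2) by simp
    ultimately show ?thesis
      using * S2(1) by (intro exI[of _ S'] exI[of _ "Suc j"]) auto
  qed
qed

context cellular_tag
begin

abbreviation "Aa \<equiv> A_ang a D"
abbreviation "Ba \<equiv> B_ang a D"
abbreviation "Ka \<equiv> K_ang a D"
abbreviation "qr \<equiv> q_res a D"
abbreviation "Lp \<equiv> L_plus a D"

lemma L_plus_ge_1: "1 \<le> Lp"
  by (simp add: L_plus_def)

lemma A_ang_ge_1: "1 \<le> Aa"
  by (simp add: A_ang_def)

lemma B_ang_gt_1: "1 < Ba"
  using L_plus_ge_1 by (simp add: B_ang_def)

lemma q_res_bounds: "0 < qr" "qr \<le> 1"
  using a_pos side_le by (auto simp: q_res_def)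

lemma resolved_diameter_bounds:
  assumes "finite S" "S \<noteq> {}"
  shows "qr \<le> resolved_diameter a D S" "resolved_diameter a D S \<le> 1"
proof -
  let ?f = "\<lambda>(P, P'). max qr (plane_angle (tangent_plane D P) (tangent_plane D P'))"
  have "Max (?f ` (S \<times> S)) \<in> ?f ` (S \<times> S)"
    using assms by (intro Max_in) auto
  then obtain P P' where "resolved_diameter a D S = ?f (P, P')"
    unfolding resolved_diameter_def by blast
  then show "qr \<le> resolved_diameter a D S" "resolved_diameter a D S \<le> 1"
    using q_res_bounds by (auto simp: plane_angle_def)
qed

lemma real_K_ang: "real Ka = 1 + of_int \<lceil>log Ba (inverse qr)\<rceil>"
  and real_J_theta: "real (J_theta a D) = 1 + of_int \<lceil>log 2 (1 / qr)\<rceil>"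
  and real_J_d: "real (J_d a D) = 1 + of_int \<lceil>log 2 (2 * Aa ^ Ka)\<rceil>"
proof -
  have q: "1 \<le> inverse qr"
    using q_res_bounds by (simp add: one_le_inverse_iff)
  then have "0 \<le> log Ba (inverse qr)" "0 \<le> log 2 (inverse qr)"
    using B_ang_gt_1 q_res_bounds by simp_all
  then have "0 \<le> \<lceil>log Ba (inverse qr)\<rceil>" "0 \<le> \<lceil>log 2 (inverse qr)\<rceil>"
    by linarith+
  then show "real Ka = 1 + of_int \<lceil>log Ba (inverse qr)\<rceil>"
    "real (J_theta a D) = 1 + of_int \<lceil>log 2 (1 / qr)\<rceil>"
    by (simp_all add: K_ang_def J_theta_def inverse_eq_divide)
  have "1 \<le> Aa ^ Ka"
    by (rule one_le_power[OF A_ang_ge_1])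
  then have "0 \<le> log 2 (2 * Aa ^ Ka)"
    by simp
  then have "0 \<le> \<lceil>log 2 (2 * Aa ^ Ka)\<rceil>"
    by linarith
  then show "real (J_d a D) = 1 + of_int \<lceil>log 2 (2 * Aa ^ Ka)\<rceil>"
    by (simp add: J_d_def)
qed

lemma J_ge_1: "1 \<le> real (J_theta a D)" "1 \<le> real (J_d a D)"
  by (simp_all add: J_theta_def J_d_def)

lemma c_floor_bounds: "0 < c_floor a D" "c_floor a D \<le> 1"
proof -
  have A: "1 \<le> Aa ^ Ka"
    by (rule one_le_power[OF A_ang_ge_1])
  have "1 * 1 \<le> real (J_theta a D) * real (J_d a D)"
    using J_ge_1 by (intro mult_mono) auto
  then have J: "1 \<le> real (J_theta a D) * real (J_d a D)"
    by simp
  show "0 < c_floor a D"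
    unfolding c_floor_def using A J by (intro divide_pos_pos) auto
  have "inverse (Aa ^ Ka) \<le> 1"
    using A by (simp add: inverse_le_1_iff)
  then show "c_floor a D \<le> 1"
    unfolding c_floor_def using J by (simp only: divide_le_eq_1) linarith
qed

text \<open>Resolved diameters lie between \<open>q_res\<close> and \<open>1\<close>, so at most \<open>K\<close> steps are possible.\<close>

lemma stable_subfamily_resolved:
  assumes "finite S" "S \<noteq> {}"
  shows "\<exists>S'. S' \<subseteq> S \<and> S' \<noteq> {} \<and> real (card S) \<le> Aa ^ Ka * real (card S') \<and>
    (\<forall>S''\<subseteq>S'. real (card S') \<le> Aa * real (card S'') \<longrightarrow>
       resolved_diameter a D S' / Ba < resolved_diameter a D S'')"
proof -
  let ?diam = "resolved_diameter a D"
  have "\<And>S'. finite S' \<Longrightarrow> S' \<noteq> {} \<Longrightarrow> 0 < ?diam S'"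
    using resolved_diameter_bounds(1) q_res_bounds(1) by (meson less_le_trans)
  then obtain S' j where S': "S' \<subseteq> S" "S' \<noteq> {}" "?diam S' * Ba ^ j \<le> ?diam S"
    "real (card S) \<le> Aa ^ j * real (card S')"
    "\<forall>S''\<subseteq>S'. real (card S') \<le> Aa * real (card S'') \<longrightarrow> ?diam S' / Ba < ?diam S''"
    using stable_subfamily[OF assms A_ang_ge_1 B_ang_gt_1, of ?diam] by auto
  have "finite S'"
    using S'(1) assms(1) finite_subset by blast
  have "qr * Ba ^ j \<le> ?diam S' * Ba ^ j"
    using resolved_diameter_bounds(1)[OF \<open>finite S'\<close> S'(2)] B_ang_gt_1 by (intro mult_right_mono) auto
  also have "\<dots> \<le> 1"
    using S'(3) resolved_diameter_bounds(2)[OF assms] by linarith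
  finally have "Ba ^ j \<le> inverse qr"
    using q_res_bounds by (simp add: field_simps)
  then have "log Ba (Ba ^ j) \<le> log Ba (inverse qr)"
    using B_ang_gt_1 q_res_bounds by (subst log_le_cancel_iff) auto
  then have "real j \<le> log Ba (inverse qr)"
    using B_ang_gt_1 by (simp add: log_nat_power)
  then have "real j \<le> real Ka"
    unfolding real_K_ang by linarith
  then have "Aa ^ j \<le> Aa ^ Ka"
    using A_ang_ge_1 by (intro power_increasing) auto
  then have "Aa ^ j * real (card S') \<le> Aa ^ Ka * real (card S')"
    by (intro mult_right_mono) auto
  with S' show ?thesis
    by (intro exI[of _ S']) auto
qed

text \<open>At every cell replace the incident parents by a stable subfamily, which costs the factor \<open>A ^ K\<close>. Then
  keep the heaviest of the \<open>J_theta\<close> classes of the resolved diameter and, inside it, the heaviest of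
  the \<open>J_d\<close> degree classes; the stable degrees lie between \<open>d0 / A ^ K\<close> and \<open>2 d0\<close> because the degrees
  of \<open>E\<close> lie in one dyadic class. All cells have the same volume, so counting edges is the same as
  measuring parent shadings.\<close>

lemma angular_selection_exists:
  assumes E: "finite E" "E \<subseteq> parents D \<times> grid h" "E \<noteq> {}" and d0: "0 < d0"
    and deg: "\<And>Q. Q \<in> snd ` E \<Longrightarrow> d0 \<le> right_degree E Q \<and> right_degree E Q < 2 * d0"
  shows "\<exists>G th dang. angular_output a D E G th dang (c_floor a D)"
proof -
  let ?diam = "resolved_diameter a D" and ?C = "snd ` E"
  have inc: "finite (incident E Q)" "incident E Q \<noteq> {}" if "Q \<in> ?C" for Q
    using that finite_incident[OF E(1)] by (auto simp: incident_def)
  have "\<forall>Q\<in>?C. \<exists>S'. S' \<subseteq> incident E Q \<and> S' \<noteq> {} \<and> real (card (incident E Q)) \<le> Aa ^ Ka * real (card S') \<and>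
    (\<forall>S''\<subseteq>S'. real (card S') \<le> Aa * real (card S'') \<longrightarrow> ?diam S' / Ba < ?diam S'')"
    by (intro ballI stable_subfamily_resolved inc)
  then obtain S where S0: "\<forall>Q\<in>?C. S Q \<subseteq> incident E Q \<and> S Q \<noteq> {} \<and>
    real (card (incident E Q)) \<le> Aa ^ Ka * real (card (S Q)) \<and>
    (\<forall>S''\<subseteq>S Q. real (card (S Q)) \<le> Aa * real (card S'') \<longrightarrow> ?diam (S Q) / Ba < ?diam S'')"
    by (rule bchoice[THEN exE])
  have S: "S Q \<subseteq> incident E Q" "S Q \<noteq> {}" "real (card (incident E Q)) \<le> Aa ^ Ka * real (card (S Q))"
    if "Q \<in> ?C" for Q
    using bspec[OF S0 that] by simp_all
  have stable: "?diam (S Q) / Ba < ?diam S''"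
    if "Q \<in> ?C" "S'' \<subseteq> S Q" "real (card (S Q)) \<le> Aa * real (card S'')" for Q S''
    using bspec[OF S0 that(1)] that(2,3) by simp
  have finS: "finite (S Q)" if "Q \<in> ?C" for Q
    by (rule finite_subset[OF S(1)[OF that] inc(1)[OF that]])
  define wt where "wt = (\<lambda>Q. real (card (S Q)))"
  have wt0: "0 \<le> wt Q" for Q
    by (simp add: wt_def)
  have C: "finite ?C" "?C \<noteq> {}"
    using E by auto
  have A: "1 \<le> Aa ^ Ka"
    by (rule one_le_power[OF A_ang_ge_1])
  have diam: "qr \<le> ?diam (S Q) \<and> ?diam (S Q) \<le> 1" if "Q \<in> ?C" for Q
    using resolved_diameter_bounds[OF finS[OF that] S(2)[OF that]] by simp
  obtain j where j: "{Q \<in> ?C. 2 ^ j * qr \<le> ?diam (S Q) \<and> ?diam (S Q) < 2 ^ Suc j * qr} \<noteq> {}"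
    "sum wt ?C \<le> (1 + of_int \<lceil>log 2 (1 / qr)\<rceil>) *
      sum wt {Q \<in> ?C. 2 ^ j * qr \<le> ?diam (S Q) \<and> ?diam (S Q) < 2 ^ Suc j * qr}"
    by (rule heaviest_level[OF C wt0 q_res_bounds(1) diam])
  define th where "th = 2 ^ j * qr"
  define C1 where "C1 = {Q \<in> ?C. th \<le> ?diam (S Q) \<and> ?diam (S Q) < 2 * th}"
  have C1_eq: "C1 = {Q \<in> ?C. 2 ^ j * qr \<le> ?diam (S Q) \<and> ?diam (S Q) < 2 ^ Suc j * qr}"
    by (simp add: C1_def th_def mult.assoc)
  have C1: "finite C1" "C1 \<noteq> {}" "C1 \<subseteq> ?C"
    using C(1) j(1) by (auto simp: C1_eq)
  have sum1: "sum wt ?C \<le> real (J_theta a D) * sum wt C1"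
    using j(2) by (simp only: real_J_theta C1_eq)
  have range: "d0 / Aa ^ Ka \<le> wt Q \<and> wt Q \<le> 2 * d0" if "Q \<in> C1" for Q
  proof
    have Q: "Q \<in> ?C"
      using that C1 by auto
    have "d0 \<le> Aa ^ Ka * wt Q"
      using deg[OF Q] S(3)[OF Q] unfolding right_degree_def wt_def by linarith
    then show "d0 / Aa ^ Ka \<le> wt Q"
      using A by (simp add: field_simps)
    have "card (S Q) \<le> card (incident E Q)"
      using S(1)[OF Q] inc(1)[OF Q] by (intro card_mono)
    then show "wt Q \<le> 2 * d0"
      using deg[OF Q] by (simp add: wt_def right_degree_def)
  qed
  have lo: "0 < d0 / Aa ^ Ka"
    using d0 A by (intro divide_pos_pos) auto
  obtain dang where dang: "dyadic dang" "{Q \<in> C1. dang \<le> wt Q \<and> wt Q < 2 * dang} \<noteq> {}"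
    "sum wt C1 \<le> (1 + of_int \<lceil>log 2 (2 * d0 / (d0 / Aa ^ Ka))\<rceil>) * sum wt {Q \<in> C1. dang \<le> wt Q \<and> wt Q < 2 * dang}"
    by (rule heaviest_dyadic_class[OF C1(1,2) wt0 lo range])
  define C2 where "C2 = {Q \<in> C1. dang \<le> wt Q \<and> wt Q < 2 * dang}"
  have "2 * d0 / (d0 / Aa ^ Ka) = 2 * Aa ^ Ka"
    using d0 by simp
  then have sum2: "sum wt C1 \<le> real (J_d a D) * sum wt C2"
    using dang(3) by (simp only: real_J_d C2_def)
  have C2: "C2 \<subseteq> C1"
    by (auto simp: C2_def)
  define G where "G = {(P, Q). Q \<in> C2 \<and> P \<in> S Q}"
  have G_E: "G \<subseteq> E"
  proof clarify
    fix P Q assume "(P, Q) \<in> G"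
    then have "Q \<in> ?C" "P \<in> S Q"
      using C1(3) C2 by (auto simp: G_def)
    then show "(P, Q) \<in> E"
      using S(1)[of Q] by (auto simp: incident_def)
  qed
  have incG: "incident G Q = S Q" if "Q \<in> C2" for Q
    using that by (auto simp: G_def incident_def)
  have sndG: "snd ` G = C2"
  proof (intro subset_antisym subsetI)
    fix Q assume Q: "Q \<in> C2"
    then obtain P where "P \<in> S Q"
      using S(2)[of Q] C1(3) C2 by blast
    then have "(P, Q) \<in> G"
      using Q by (simp add: G_def)
    then show "Q \<in> snd ` G"
      by force
  qed (auto simp: G_def)
  have finG: "finite G"
    using G_E E(1) finite_subset by blast
  have cG: "real (card G) = sum wt C2"
    unfolding card_edges_eq_sum_cells[OF finG] sndG wt_def
    by (intro sum.cong) (simp_all add: incG)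
  have "real (card E) = (\<Sum>Q\<in>?C. real (card (incident E Q)))"
    by (rule card_edges_eq_sum_cells[OF E(1)])
  also have "\<dots> \<le> (\<Sum>Q\<in>?C. Aa ^ Ka * wt Q)"
    using S(3) unfolding wt_def by (intro sum_mono)
  also have "\<dots> = Aa ^ Ka * sum wt ?C"
    by (simp add: sum_distrib_left)
  also have "\<dots> \<le> Aa ^ Ka * (real (J_theta a D) * sum wt C1)"
    using A sum1 by (intro mult_left_mono) auto
  also have "\<dots> \<le> Aa ^ Ka * (real (J_theta a D) * (real (J_d a D) * sum wt C2))"
    using A sum2 by (intro mult_left_mono) auto
  finally have le: "real (card E) \<le> Aa ^ Ka * (real (J_theta a D) * (real (J_d a D) * real (card G)))"
    by (simp only: cG)
  have "0 < Aa ^ Ka * (real (J_theta a D) * real (J_d a D))"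
    using A J_ge_1 by (intro mult_pos_pos) auto
  then have cE: "c_floor a D * real (card E) \<le> real (card G)"
    using le by (simp add: c_floor_def field_simps)
  have "c_floor a D * (\<Sum>P\<in>parents D. vol (parent_shading E P))
      \<le> (\<Sum>P\<in>parents D. vol (parent_shading G P))"
  proof -
    have "c_floor a D * real (card E) * h ^ 3 \<le> real (card G) * h ^ 3"
      using cE h_pos by (intro mult_right_mono) auto
    then show ?thesis
      using sum_vol_parent_shading[OF E(1,2)] sum_vol_parent_shading[OF finG] G_E E(2)
      by (auto simp: mult.assoc)
  qed
  moreover have "qr \<le> th"
    using q_res_bounds by (simp add: th_def)
  moreover have "th \<le> 1"
  proof -
    obtain Q where "Q \<in> C1"
      using C1(2) by auto
    then show ?thesis
      using diam[of Q] by (auto simp: C1_def)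
  qed
  moreover have "th / Ba < ?diam S''"
    if "Q \<in> C2" "S'' \<subseteq> S Q" "inverse Aa * real (card (S Q)) \<le> real (card S'')" for Q S''
  proof -
    have "real (card (S Q)) \<le> Aa * real (card S'')"
      using that(3) A_ang_ge_1 by (simp add: field_simps)
    then have "?diam (S Q) / Ba < ?diam S''"
      using that C1(3) C2 by (intro stable) auto
    moreover have "th / Ba \<le> ?diam (S Q) / Ba"
      using that(1) C2 B_ang_gt_1 by (intro divide_right_mono) (auto simp: C1_def)
    ultimately show ?thesis
      by linarith
  qed
  ultimately have "angular_output a D E G th dang (c_floor a D)"
    unfolding angular_output_def sndG using G_E dang(1) incG C2
    by (auto simp: C2_def C1_def wt_def right_degree_def)
  then show ?thesis
    by blast
qed

end

section \<open>Size of the retention constant\<close>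

lemma powr_quarters:
  fixes t :: real
  assumes "1 \<le> t"
  shows "1 \<le> t powr (1/2)" "t powr (1/2) \<le> t powr (3/4)" "t powr (3/4) \<le> t"
    "t powr (1/2) * t powr (1/2) = t" "t powr (3/4) * t powr (1/4) = t" "t powr (1/4) * t powr (1/2) = t powr (3/4)"
  using assms powr_mono[of "3/4" 1 t] powr_mono[of "1/2" "3/4" t] by (auto simp: ge_one_powr_ge_zero simp flip: powr_add)

text \<open>For large \<open>t\<close> the retention bound is smaller than every power: its logarithm is at most
  \<open>6 + 6 u + v \<le> 13 v\<close> with \<open>u = t powr (1/2)\<close> and \<open>v = t powr (3/4) = t / t powr (1/4)\<close>. This gives the explicit threshold \<open>(13 / eps) ^ 4\<close>.\<close>

lemma retention_bound_absorbed:
  fixes t eps :: real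
  assumes t: "1 \<le> t" "(13 / eps) ^ 4 \<le> t" and eps: "0 < eps"
  shows "12 * (1 + t) ^ 2 * exp (t powr (3/4) + 2 * t powr (1/2)) \<le> exp (eps * t)"
proof -
  define u v where "u = t powr (1/2)" and "v = t powr (3/4)"
  note q = powr_quarters[OF t(1), folded u_def v_def]
  have "1 + t = 1 + u * u"
    using q by simp
  also have "\<dots> \<le> 1 + (1 + 2 * u) + (1 + 2 * u)\<^sup>2 / 2"
  proof -
    have "(1 + 2 * u)\<^sup>2 = 1 + 4 * u + 4 * (u * u)"
      by (simp add: power2_eq_square algebra_simps)
    moreover have "0 \<le> u * u"
      by simp
    ultimately show ?thesis
      using q(1) by linarith
  qed
  also have "\<dots> \<le> exp (1 + 2 * u)"
    using q(1) by (intro exp_lower_Taylor_quadratic) auto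
  finally have "(1 + t) ^ 2 \<le> exp (1 + 2 * u) ^ 2"
    using t by (intro power_mono) auto
  moreover have "12 \<le> exp (4::real)"
    using exp_lower_Taylor_quadratic[of "4::real"] by simp
  ultimately have "12 * (1 + t) ^ 2 \<le> exp 4 * exp (1 + 2 * u) ^ 2"
    by (intro mult_mono) auto
  then have "12 * (1 + t) ^ 2 * exp (v + 2 * u) \<le> exp 4 * exp (1 + 2 * u) ^ 2 * exp (v + 2 * u)"
    by (intro mult_right_mono) auto
  also have "\<dots> = exp (6 + 6 * u + v)"
    by (simp add: power2_eq_square algebra_simps flip: exp_add)
  also have "\<dots> \<le> exp (eps * t)"
  proof -
    have "13 / eps = ((13 / eps) ^ 4) powr (1/4)"
      using eps by (simp add: powr_powr flip: powr_numeral)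
    also have "\<dots> \<le> t powr (1/4)"
      using t eps by (intro powr_mono2) auto
    finally have "13 \<le> eps * t powr (1/4)"
      using eps by (simp add: field_simps)
    then have "13 * v \<le> eps * t powr (1/4) * v"
      using q by (intro mult_right_mono) auto
    also have "\<dots> = eps * t"
      using q(5) by (simp add: mult_ac)
    finally show ?thesis
      using q(1,2) by simp
  qed
  finally show ?thesis
    by (simp add: u_def v_def)
qed

context cellular_tag
begin

lemma alpha_bounds: "0 < alpha a D" "alpha a D \<le> 1"
  using a_pos side_le by (auto simp: alpha_def)

lemma ln_inverse_q_res_le: "ln (inverse qr) \<le> Lp"
proof -
  have "inverse qr \<le> inverse (alpha a D)"
    using a_pos side_le by (simp add: alpha_def q_res_def divide_right_mono)
  then have "ln (inverse qr) \<le> ln (inverse (alpha a D))"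
    using q_res_bounds alpha_bounds by (subst ln_le_cancel_iff) auto
  then show ?thesis
    by (simp add: L_plus_def)
qed

text \<open>Since \<open>a / b \<ge> a / r\<close>, the logarithm of \<open>1 / q_res\<close> is at most \<open>L_plus\<close>. Hence \<open>K \<le> 2 + L_plus powr (1/4)\<close>,
  which gives the exponential factor, while \<open>J_theta\<close> and \<open>J_d\<close> are at most \<open>2 (1 + L_plus)\<close> and
  \<open>6 (1 + L_plus)\<close>.\<close>

lemma inverse_c_floor_le:
  "inverse (c_floor a D) \<le> 12 * (1 + Lp) ^ 2 * exp (Lp powr (3/4) + 2 * Lp powr (1/2))"
proof -
  note q = powr_quarters[OF L_plus_ge_1]
  have inv: "0 \<le> ln (inverse qr)" "1 \<le> inverse qr"
    using q_res_bounds by (auto simp: one_le_inverse_iff)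
  have B: "ln Ba = Lp powr (3/4)" and A: "ln Aa = Lp powr (1/2)"
    by (auto simp: A_ang_def B_ang_def)
  have "log Ba (inverse qr) = ln (inverse qr) / Lp powr (3/4)"
    by (simp add: log_def B)
  also have "\<dots> \<le> Lp / Lp powr (3/4)"
    using ln_inverse_q_res_le by (intro divide_right_mono) auto
  also have "\<dots> = Lp powr (1/4)"
    using q L_plus_ge_1 by (simp add: field_simps)
  finally have K: "real Ka \<le> 2 + Lp powr (1/4)"
    unfolding real_K_ang by linarith
  have "Aa ^ Ka = exp (real Ka * Lp powr (1/2))"
    by (simp add: A_ang_def exp_of_nat_mult)
  have AK: "real Ka * Lp powr (1/2) \<le> Lp powr (3/4) + 2 * Lp powr (1/2)"
  proof -
    have "real Ka * Lp powr (1/2) \<le> (2 + Lp powr (1/4)) * Lp powr (1/2)"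
      using K by (intro mult_right_mono) auto
    then show ?thesis
      using q(6) by (simp add: algebra_simps)
  qed
  have A1: "Aa ^ Ka \<le> exp (Lp powr (3/4) + 2 * Lp powr (1/2))"
    using AK \<open>Aa ^ Ka = exp (real Ka * Lp powr (1/2))\<close> by simp
  have ln2: "1 / ln 2 \<le> (2::real)"
    using ln2_ge_two_thirds by (simp add: field_simps)
  have half: "log 2 x \<le> 2 * ln x" if "1 \<le> x" for x :: real
  proof -
    have "(1 / ln 2) * ln x \<le> 2 * ln x"
      using that ln2 by (intro mult_right_mono) auto
    then show ?thesis
      by (simp add: log_def)
  qed
  have "log 2 (1 / qr) \<le> 2 * Lp"
    using half[of "1 / qr"] inv ln_inverse_q_res_le by (simp add: inverse_eq_divide)
  then have J1: "real (J_theta a D) \<le> 2 * (1 + Lp)"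
    unfolding real_J_theta using of_int_ceiling_le_add_one[of "log 2 (1 / qr)"] by argo
  have "log 2 (Aa ^ Ka) \<le> 2 * ln (Aa ^ Ka)"
    by (intro half one_le_power A_ang_ge_1)
  also have "ln (Aa ^ Ka) = real Ka * Lp powr (1/2)"
    using A_ang_ge_1 by (simp add: ln_realpow A)
  also have "2 * (real Ka * Lp powr (1/2)) \<le> 6 * Lp"
    using AK q by linarith
  finally have "log 2 (2 * Aa ^ Ka) \<le> 1 + 6 * Lp"
    using A_ang_ge_1 by (simp add: log_mult)
  then have J2: "real (J_d a D) \<le> 6 * (1 + Lp)"
    unfolding real_J_d using L_plus_ge_1 of_int_ceiling_le_add_one[of "log 2 (2 * Aa ^ Ka)"] by argo
  have "inverse (c_floor a D) = Aa ^ Ka * (real (J_theta a D) * real (J_d a D))"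
    by (simp add: c_floor_def divide_inverse mult.commute)
  also have "\<dots> \<le> exp (Lp powr (3/4) + 2 * Lp powr (1/2)) * ((2 * (1 + Lp)) * (6 * (1 + Lp)))"
    using A1 J1 J2 L_plus_ge_1 by (intro mult_mono) auto
  finally show ?thesis
    by (simp add: power2_eq_square algebra_simps)
qed

lemma c_floor_constant:
  assumes "ln (inverse (alpha a D)) \<le> 1"
  shows "inverse (c_floor a D) \<le> 48 * exp 3"
  using inverse_c_floor_le assms by (simp add: L_plus_def max_absorb1)

lemma c_floor_subpolynomial:
  assumes eps: "0 < eps" and small: "alpha a D < exp (- ((13 / eps) ^ 4) - 1)"
  shows "alpha a D powr eps \<le> c_floor a D"
proof -
  have "ln (alpha a D) < - ((13 / eps) ^ 4) - 1"
    using small alpha_bounds by (metis exp_less_cancel_iff exp_ln)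
  then have ln: "(13 / eps) ^ 4 + 1 < ln (inverse (alpha a D))"
    using alpha_bounds by (simp add: ln_inverse)
  moreover have "0 \<le> (13 / eps) ^ 4"
    using eps by simp
  ultimately have "1 \<le> ln (inverse (alpha a D))"
    by linarith
  then have L: "Lp = ln (inverse (alpha a D))" "(13 / eps) ^ 4 \<le> Lp"
    using ln unfolding L_plus_def by (simp_all only: max_absorb2)
  have "inverse (c_floor a D) \<le> exp (eps * Lp)"
    using inverse_c_floor_le retention_bound_absorbed[OF L_plus_ge_1 L(2) eps] by linarith
  also have "\<dots> = inverse (alpha a D powr eps)"
    using alpha_bounds by (simp add: L(1) ln_inverse powr_def exp_minus)
  finally show ?thesis
    using alpha_bounds c_floor_bounds by (simp add: inverse_le_iff_le)
qed

end

section \<open>Polynomial ranges of the parameters\<close>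

text \<open>The box is an axis-parallel box moved by the isometry that sends the coordinate vectors to the frame.\<close>

lemma vol_oriented_box:
  fixes u v w c :: pt
  assumes "orthonormal_frame u v w" "0 \<le> p" "0 \<le> q" "0 \<le> r"
  defines "S \<equiv> {x. \<bar>(x - c) \<bullet> u\<bar> \<le> p \<and> \<bar>(x - c) \<bullet> v\<bar> \<le> q \<and> \<bar>(x - c) \<bullet> w\<bar> \<le> r}"
  shows "S \<in> lmeasurable" "vol S = 8 * p * q * r"
proof -
  define f :: "pt \<Rightarrow> pt" where "f = (\<lambda>y. y $ 1 *\<^sub>R u + y $ 2 *\<^sub>R v + y $ 3 *\<^sub>R w)"
  have on: "u \<bullet> u = 1" "v \<bullet> v = 1" "w \<bullet> w = 1" "u \<bullet> v = 0" "u \<bullet> w = 0" "v \<bullet> w = 0"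
    "v \<bullet> u = 0" "w \<bullet> u = 0" "w \<bullet> v = 0"
    using assms(1) by (auto simp: orthonormal_frame_def norm_eq_1 inner_commute)
  have fi: "f y \<bullet> u = y $ 1" "f y \<bullet> v = y $ 2" "f y \<bullet> w = y $ 3" for y
    by (simp_all add: f_def inner_add_left on)
  have "linear f"
    by (rule linearI) (simp_all add: f_def algebra_simps)
  moreover have "f x \<bullet> f y = x \<bullet> y" for x y
  proof -
    have "f x \<bullet> f y = f x \<bullet> (y $ 1 *\<^sub>R u + y $ 2 *\<^sub>R v + y $ 3 *\<^sub>R w)"
      by (simp add: f_def)
    also have "\<dots> = x $ 1 * y $ 1 + x $ 2 * y $ 2 + x $ 3 * y $ 3"
      by (simp add: inner_add_right fi)
    finally show ?thesis
      by (simp add: inner_vec_def sum_3)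
  qed
  ultimately have f: "orthogonal_transformation f"
    by (simp add: orthogonal_transformation_def)
  define l h where "l = (vector [- p, - q, - r] :: pt)" and "h = (vector [p, q, r] :: pt)"
  have "S = (+) c ` f ` cbox l h"
  proof (intro subset_antisym subsetI)
    fix x assume x: "x \<in> S"
    obtain y where y: "x - c = f y"
      using orthogonal_transformation_surj[OF f] by (metis surjD)
    have "\<bar>y $ 1\<bar> \<le> p" "\<bar>y $ 2\<bar> \<le> q" "\<bar>y $ 3\<bar> \<le> r"
      using x fi[of y, folded y] by (auto simp: S_def)
    then have "y \<in> cbox l h"
      by (auto simp: mem_box_cart forall_3 l_def h_def abs_le_iff)
    then show "x \<in> (+) c ` f ` cbox l h"
      using y by (auto simp: image_iff algebra_simps intro!: bexI[of _ y])
  next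
    fix x assume "x \<in> (+) c ` f ` cbox l h"
    then show "x \<in> S"
      by (auto simp: S_def fi mem_box_cart forall_3 l_def h_def)
  qed
  then show "S \<in> lmeasurable"
    using f by (simp add: measurable_translation measurable_orthogonal_image)
  have "cbox l h \<noteq> {}"
    using assms by (auto simp: interval_ne_empty_cart forall_3 l_def h_def)
  then have "vol (cbox l h) = (\<Prod>i\<in>UNIV. h $ i - l $ i)"
    by (simp add: content_cbox_cart)
  also have "\<dots> = (\<Prod>i\<in>{1, 2, 3}. h $ i - l $ i)"
    by (simp only: UNIV_3)
  also have "\<dots> = 8 * p * q * r"
    by (simp add: l_def h_def)
  finally have "vol (cbox l h) = 8 * p * q * r" .
  then show "vol S = 8 * p * q * r"
    using f \<open>S = (+) c ` f ` cbox l h\<close> by (simp add: measure_translation measure_orthogonal_image)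
qed

context cellular_tag
begin

lemma parents_nonempty: "parents D \<noteq> {}"
  using input by (auto simp: tag_input_def)

lemma frame: "P \<in> parents D \<Longrightarrow> orthonormal_frame (frame_a D P) (frame_b D P) (frame_r D P)"
  using input by (auto simp: tag_input_def)

lemma vol_box_of:
  assumes "P \<in> parents D"
  shows "box_of 1 a D P \<in> lmeasurable" "vol (box_of 1 a D P) = a * side_b D * side_r D"
  using vol_oriented_box[OF frame[OF assms], of "a / 2" "side_b D / 2" "side_r D / 2" "box_centre D P"]
    a_pos side_le by (simp_all add: box_of_def)

text \<open>The box contains a segment of length \<open>side_r\<close> through its centre, and it lies in the ambient ball.\<close>

lemma side_r_le:
  assumes "0 \<le> dil"
  shows "side_r D \<le> 2 * dil * R0"
proof -
  obtain P where P: "P \<in> parents D"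
    using parents_nonempty by auto
  let ?w = "frame_r D P" and ?c = "box_centre D P"
  have on: "norm ?w = 1" "?w \<bullet> ?w = 1" "frame_a D P \<bullet> ?w = 0" "frame_b D P \<bullet> ?w = 0"
    using frame[OF P] by (auto simp: orthonormal_frame_def norm_eq_1)
  have mem: "?c + t *\<^sub>R ?w \<in> box_of 1 a D P" if "\<bar>t\<bar> \<le> side_r D / 2" for t
    using that on a_pos side_le by (simp add: box_of_def inner_commute)
  have "box_of 1 a D P \<subseteq> ball (centre D) (dil * radius D)"
    using input P by (auto simp: tag_input_def)
  then have b: "dist (centre D) (?c + t *\<^sub>R ?w) < dil * radius D" if "\<bar>t\<bar> \<le> side_r D / 2" for t
    using mem[OF that] by auto
  define t where "t = side_r D / 2"
  have t: "side_r D = t + t" "\<bar>t\<bar> \<le> side_r D / 2" "\<bar>- t\<bar> \<le> side_r D / 2"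
    using a_pos side_le by (auto simp: t_def)
  have "dist (?c + t *\<^sub>R ?w) (?c + (- t) *\<^sub>R ?w) = norm (t *\<^sub>R ?w + t *\<^sub>R ?w)"
    by (simp add: dist_norm)
  also have "\<dots> = norm (side_r D *\<^sub>R ?w)"
    by (simp only: t(1) scaleR_add_left)
  also have "\<dots> = side_r D"
    using on a_pos side_le by simp
  finally have "side_r D \<le> dist (centre D) (?c + t *\<^sub>R ?w) + dist (centre D) (?c + (- t) *\<^sub>R ?w)"
    using dist_triangle3[of "?c + t *\<^sub>R ?w" "?c + (- t) *\<^sub>R ?w" "centre D"] by simp
  also have "\<dots> < 2 * (dil * radius D)"
    using b[OF t(2)] b[OF t(3)] by simp
  also have "\<dots> \<le> 2 * (dil * R0)"
    using input assms by (intro mult_left_mono) (auto simp: tag_input_def)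
  finally show ?thesis
    by simp
qed

lemma mass_le_carriers: "mass D (shading D) \<le> real (card (children D)) * (a * side_b D * side_r D)"
  unfolding mass_def
proof (rule sum_bounded_above)
  fix T assume T: "T \<in> children D"
  have "shading D T \<subseteq> box_of 1 a D (parent D T)"
    using input T unfolding tag_input_def by blast
  then have "vol (shading D T) \<le> vol (box_of 1 a D (parent D T))"
    using shading_measurable[OF T] vol_box_of(1)[OF parent_in[OF T]] by (intro measure_mono_fmeasurable)
  then show "vol (shading D T) \<le> a * side_b D * side_r D"
    by (simp add: vol_box_of(2)[OF parent_in[OF T]])
qed

text \<open>A lower bound for the mass forces the boxes to be thick: their volume \<open>a b r\<close> is at least the mass
  divided by the number of children, while \<open>b\<close> and \<open>r\<close> are bounded by the size of the ambient ball.
  Hence \<open>q_res = a / b\<close> is bounded below, which makes the range of angles polynomial in \<open>\<delta>\<close>.\<close>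

lemma q_res_lower:
  assumes R: "side_r D \<le> R" "0 < R" and N: "real (card (children D)) \<le> N" "0 < N"
    and W: "1 \<le> mass D (shading D) * W" "0 < W"
  shows "1 \<le> qr * (W * N * R ^ 3)"
proof -
  have b: "0 < side_b D" "side_b D \<le> R"
    using a_pos side_le R by linarith+
  have "1 \<le> mass D (shading D) * W"
    by (rule W)
  also have "\<dots> \<le> (N * (a * R * R)) * W"
  proof (rule mult_right_mono)
    have "real (card (children D)) * (a * side_b D * side_r D) \<le> N * (a * R * R)"
      using N R b a_pos side_le by (intro mult_mono) auto
    then show "mass D (shading D) \<le> N * (a * R * R)"
      using mass_le_carriers by linarith
  qed (use W in simp)
  also have "\<dots> = qr * (W * N * R ^ 2 * side_b D)"
    using b by (simp add: q_res_def power2_eq_square)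
  also have "\<dots> \<le> qr * (W * N * R ^ 2 * R)"
    using b W N R q_res_bounds by (intro mult_left_mono) auto
  finally show ?thesis
    by (simp add: power3_eq_cube power2_eq_square mult.assoc)
qed

end

context joint_run_tag
begin

lemma levels_le: "1 + levels \<le> 2 * real (N_max D)"
proof -
  have "log 2 (real (N_max D)) \<le> real (N_max D)"
    using N_max_ge_1 less_exp[of "N_max D"] by (intro log2_of_power_le) simp_all
  then have "\<lceil>log 2 (real (N_max D))\<rceil> \<le> int (N_max D)"
    by (simp add: ceiling_le_iff)
  then have "levels \<le> real (N_max D)"
    by linarith
  then show ?thesis
    using N_max_ge_1 by linarith
qed

lemma mu_range: "1 \<le> mu" "mu \<le> 2 * real (card (children D))"
proof -
  obtain k0 :: nat where k0: "mu = 2 ^ k0" "int k0 \<le> \<lceil>log 2 (real (N_max D))\<rceil>"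
    using run by (auto simp: joint_run_def)
  then show "1 \<le> mu"
    by simp
  have "real k0 \<le> 1 + log 2 (real (N_max D))"
    using k0(2) by linarith
  then have "2 powr real k0 \<le> 2 powr (1 + log 2 (real (N_max D)))"
    by simp
  then have "mu \<le> 2 * real (N_max D)"
    using N_max_ge_1 by (simp add: powr_add k0(1) powr_realpow)
  then show "mu \<le> 2 * real (card (children D))"
    using N_max_le by linarith
qed

lemma d_range: "1/2 < d" "d \<le> real (card (parents D))"
proof -
  obtain P Q where e: "(P, Q) \<in> E2 h D mu om d"
    using Q_plus_nonempty by (auto simp: Q_plus_def)
  let ?I = "incident (E1 h D mu om) Q"
  have I: "P \<in> ?I" "finite ?I" "?I \<subseteq> parents D"
    using e E2_subset E1_grid finite_incident[OF finite_E1] by (auto simp: incident_def)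
  then have "1 \<le> card ?I" "card ?I \<le> card (parents D)"
    using finite_parents by (auto simp: card_mono Suc_le_eq card_gt_0_iff)
  moreover have "d \<le> real (card ?I)" "real (card ?I) < 2 * d"
    using e by (auto simp: E2_def right_degree_def)
  ultimately show "1/2 < d" "d \<le> real (card (parents D))"
    by linarith+
qed

lemma om_le: "om \<le> mass D (shading D)"
proof -
  obtain e where "e \<in> E2 h D mu om d"
    using Q_plus_nonempty by (auto simp: Q_plus_def)
  then have e: "e \<in> E1 h D mu om" "e \<in> E_plus h D mu"
    using E2_subset E1_subset by blast+
  have "om \<le> w e"
    using e(1) unfolding E1_def by blast
  also have "\<dots> \<le> sum w (E_plus h D mu)"
    using e(2) finite_E_plus by (intro member_le_sum edge_weight_nonneg)
  also have "\<dots> \<le> mass D (shading D)"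
    unfolding sum_E_plus using Y0_subset by (intro mass_mono subshading_shading subshading_Y0)
  finally show ?thesis .
qed

text \<open>An edge of level \<open>om\<close> weighs less than \<open>2 om\<close> and at least half of the average weight, the total weight is at least the mass
  divided by the number of inner levels, and there are at most as many edges as pairs of parents and
  active cells.\<close>

lemma om_ge:
  "mass D (shading D) \<le> om * (8 * real (card (children D)) * real (card (parents D)) * real (card (active_cells h D)))"
proof -
  let ?n = "real (card (E_plus h D mu))"
  have n: "1 \<le> ?n"
    by (rule E_plus_bounds)
  obtain e where "e \<in> E2 h D mu om d"
    using Q_plus_nonempty by (auto simp: Q_plus_def)
  then have "e \<in> E1 h D mu om"
    using E2_subset by blast
  then have "sum w (E_plus h D mu) / (2 * ?n) \<le> w e" "w e < 2 * om"
    unfolding E1_def by blast+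
  then have "mass D (Y0 D mu) / (2 * ?n) \<le> 2 * om"
    unfolding sum_E_plus by linarith
  then have Y0: "mass D (Y0 D mu) \<le> 4 * om * ?n"
    using n by (simp add: field_simps)
  have n_le: "?n \<le> real (card (parents D)) * real (card (active_cells h D))"
  proof -
    have "card (E_plus h D mu) \<le> card (parents D \<times> active_cells h D)"
      using finite_parents finite_active_cells by (intro card_mono E_plus_subset) auto
    then show ?thesis
      by (simp add: card_cartesian_product flip: of_nat_mult)
  qed
  have "mass D (shading D) \<le> (1 + levels) * mass D (Y0 D mu)"
    by (rule mass_Y0)
  also have "\<dots> \<le> (2 * real (card (children D))) * (4 * om * ?n)"
    using levels_le levels_nonneg N_max_le Y0 mass_nonneg by (intro mult_mono) auto
  also have "\<dots> \<le> (2 * real (card (children D))) * (4 * om * (real (card (parents D)) * real (card (active_cells h D))))"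
    using n_le om_pos by (intro mult_left_mono) auto
  finally show ?thesis
    by (simp add: mult_ac)
qed

end

section \<open>Mass retained by the angular selection\<close>

context volume_selected_tag
begin

lemma angular_output_exists: "\<exists>G th dang c. angular_output a D E3 G th dang c"
proof -
  have "E3 \<noteq> {}"
    using mass_Y1_pos mass_Y1 by auto
  then show ?thesis
    using angular_selection_exists[OF finite_E3 E3_grid _ d_pos] right_degree_E3 by blast
qed

end

locale angular_tag = volume_selected_tag +
  fixes G th dang c
  assumes ang: "angular_output a D E3 G th dang c"
begin

abbreviation Y2 where "Y2 \<equiv> restrict_to D Y1 G"

lemma G_subset: "G \<subseteq> E3"
  and c_ge: "c_floor a D \<le> c"
  and c_volume: "c * (\<Sum>P\<in>parents D. vol (parent_shading E3 P)) \<le> (\<Sum>P\<in>parents D. vol (parent_shading G P))"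
  and right_degree_G: "Q \<in> snd ` G \<Longrightarrow> dang \<le> right_degree G Q \<and> right_degree G Q < 2 * dang"
  and th_bounds: "qr \<le> th" "th \<le> 1"
  and dyadic_dang: "dyadic dang"
  using ang unfolding angular_output_def by blast+

lemma c_pos: "0 < c"
  using c_ge c_floor_bounds by linarith

lemma finite_G: "finite G" and G_grid: "G \<subseteq> parents D \<times> grid h"
  using finite_subset[OF G_subset finite_E3] subset_trans[OF G_subset E3_grid] by auto

lemma subshading_Y2: "subshading D Y2"
  by (rule mass_restrict_to(1)[OF subshading_Y1 finite_G G_grid])

lemma card_G_ge: "c * real (card E3) \<le> real (card G)"
proof -
  have "c * real (card E3) * h ^ 3 \<le> real (card G) * h ^ 3"
    using c_volume unfolding sum_vol_parent_shading[OF finite_E3 E3_grid] sum_vol_parent_shading[OF finite_G G_grid]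
    by (simp add: mult.assoc)
  then show ?thesis
    using h_pos by simp
qed

text \<open>The retained fraction of parent shading is a retained fraction of edges because all cells have the
  same volume, and a retained fraction of mass, up to a factor \<open>2\<close>, because all edge weights lie in
  one dyadic class.\<close>

lemma mass_Y2_ge: "c / 2 * mass D Y1 \<le> mass D Y2"
proof -
  have E1: "om \<le> w e" "w e < 2 * om" if "e \<in> E3" for e
    using subsetD[OF E2_subset subsetD[OF E3_subset that]] unfolding E1_def by blast+
  have "Y2 T = restrict_to D (Y0 D mu) G T" for T
    using G_subset by (auto simp: restrict_to_def parent_shading_def)
  then have Y2: "mass D Y2 = sum w G"
    using mass_restrict_Y0[OF finite_G G_grid, of mu] by (simp add: mass_def)
  have "sum w E3 \<le> of_nat (card E3) * (2 * om)"
    using E1 by (intro sum_bounded_above) (simp add: less_imp_le)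
  then have "c / 2 * mass D Y1 \<le> c / 2 * (real (card E3) * (2 * om))"
    unfolding mass_Y1 using c_pos by (intro mult_left_mono) auto
  also have "\<dots> = (c * real (card E3)) * om"
    by simp
  also have "\<dots> \<le> real (card G) * om"
    using card_G_ge om_pos by (intro mult_right_mono) auto
  also have "\<dots> \<le> sum w G"
    using E1 G_subset by (intro sum_bounded_below) auto
  finally show ?thesis
    by (simp add: Y2)
qed

lemma dang_range: "1/2 < dang" "dang \<le> real (card (parents D))"
proof -
  have "0 < c / 2 * mass D Y1"
    using c_pos mass_Y1_pos by simp
  then have "0 < mass D Y2"
    using mass_Y2_ge by linarith
  then have "G \<noteq> {}"
    by (auto simp: mass_def restrict_to_def parent_shading_def)
  then obtain P Q where e: "(P, Q) \<in> G"
    by auto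
  let ?I = "incident G Q"
  have I: "P \<in> ?I" "finite ?I" "?I \<subseteq> parents D"
    using e G_grid finite_incident[OF finite_G] by (auto simp: incident_def)
  then have "1 \<le> card ?I" "card ?I \<le> card (parents D)"
    using finite_parents by (auto simp: card_mono Suc_le_eq card_gt_0_iff)
  moreover have "dang \<le> real (card ?I)" "real (card ?I) < 2 * dang"
    using right_degree_G[of Q] e by (force simp: right_degree_def)+
  ultimately show "1/2 < dang" "dang \<le> real (card (parents D))"
    by linarith+
qed

lemma inverse_c_le: "inverse c \<le> inverse (c_floor a D)"
  using c_ge c_floor_bounds by (intro le_imp_inverse_le)

end

section \<open>Comparing sums over tags\<close>

lemma heaviest_fibre:
  fixes w :: "'a \<Rightarrow> real"
  assumes "finite S" "S \<noteq> {}"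
  obtains x0 where "x0 \<in> S" "sum w S \<le> real (card (f ` S)) * sum w {x \<in> S. f x = f x0}"
  using heaviest_class[OF assms, of f w] by auto

lemma card_image_Pair_le:
  assumes "finite S"
  shows "card ((\<lambda>x. (f x, g x)) ` S) \<le> card (f ` S) * card (g ` S)"
proof -
  have "card ((\<lambda>x. (f x, g x)) ` S) \<le> card (f ` S \<times> g ` S)"
    using assms by (intro card_mono) auto
  then show ?thesis
    by (simp add: card_cartesian_product)
qed

text \<open>An inequality between sums of one quantity passes to any quantity comparable with it, at the
  cost of the ratio of the comparison constants.\<close>

lemma comparable_sums:
  fixes m cm cp fr :: real
  assumes pos: "0 < m" "0 < cm" "0 < cp" "0 \<le> fr"
    and lower: "\<And>A. A \<in> T1 \<Longrightarrow> cm * m * p A \<le> F1 A"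
    and upper: "\<And>A. A \<in> T \<Longrightarrow> F A \<le> cp * m * q A"
    and le: "fr * (\<Sum>A\<in>T. q A) \<le> (\<Sum>A\<in>T1. p A)"
  shows "inverse (cp / cm) * fr * (\<Sum>A\<in>T. F A) \<le> (\<Sum>A\<in>T1. F1 A)"
proof -
  have "(\<Sum>A\<in>T. F A) \<le> cp * m * (\<Sum>A\<in>T. q A)"
    using upper by (simp add: sum_distrib_left sum_mono)
  then have "inverse (cp / cm) * fr * (\<Sum>A\<in>T. F A) \<le> inverse (cp / cm) * fr * (cp * m * (\<Sum>A\<in>T. q A))"
    using pos by (intro mult_left_mono) auto
  also have "\<dots> = cm * m * (fr * (\<Sum>A\<in>T. q A))"
    using pos by (simp add: field_simps)
  also have "\<dots> \<le> cm * m * (\<Sum>A\<in>T1. p A)"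
    using le pos by (intro mult_left_mono) auto
  also have "\<dots> \<le> (\<Sum>A\<in>T1. F1 A)"
    using lower by (simp add: sum_distrib_left sum_mono)
  finally show ?thesis .
qed

text \<open>The comparison can also be read backwards: the denominator is comparable with the represented mass
  with the inverted constants.\<close>

lemma comparable_denominators:
  fixes rho km kp fr :: real
  assumes pos: "0 < rho" "0 < km" "0 < kp" "0 \<le> fr"
    and T1: "T1 \<subseteq> T"
    and comp: "\<And>A. A \<in> T \<Longrightarrow> km * rho * q A \<le> F A \<and> F A \<le> kp * rho * q A"
    and le: "fr * (\<Sum>A\<in>T. F A) \<le> (\<Sum>A\<in>T1. F A)"
  shows "inverse (kp / km) * fr * (\<Sum>A\<in>T. q A) \<le> (\<Sum>A\<in>T1. q A)"
proof -
  have "inverse (inverse km / inverse kp) * fr * (\<Sum>A\<in>T. q A) \<le> (\<Sum>A\<in>T1. q A)"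
  proof (rule comparable_sums[where m = "inverse rho" and p = F and q = F])
    fix A assume "A \<in> T1"
    then have "F A \<le> kp * rho * q A"
      using comp T1 by auto
    then show "inverse kp * inverse rho * F A \<le> q A"
      using pos by (simp add: field_simps)
  next
    fix A assume "A \<in> T"
    then have "km * rho * q A \<le> F A"
      using comp by auto
    then show "q A \<le> inverse km * inverse rho * F A"
      using pos by (simp add: field_simps)
  qed (use pos le in auto)
  moreover have "inverse km / inverse kp = kp / km"
    by (simp add: field_simps)
  ultimately show ?thesis
    by simp
qed

section \<open>Synchronisation of a family of tags\<close>

definition volume_constant :: "real \<Rightarrow> real \<Rightarrow> real" where
  "volume_constant c0 Cnb = max 1 ((c0 + 2 * Cnb) ^ 3)"

text \<open>An exponent such that every parameter to be synchronised lies between \<open>(2 / \<delta>) powr (- B)\<close> and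
  \<open>(2 / \<delta>) powr B\<close>. The logarithm accounts for the size of the ambient balls, which enters through the
  lower bound for the angles; the constant \<open>4\<close> leaves room for numerical factors, since \<open>2 \<le> 2 / \<delta>\<close>.\<close>

definition range_exponent :: "real \<Rightarrow> real \<Rightarrow> real \<Rightarrow> real \<Rightarrow> real" where
  "range_exponent dil R0 Ccomp Cmass = 4 + \<bar>Cmass\<bar> + 3 * \<bar>Ccomp\<bar> + log 2 (max 1 ((2 * dil * R0) ^ 3))"

definition level_constant :: "real \<Rightarrow> real \<Rightarrow> real \<Rightarrow> real \<Rightarrow> real" where
  "level_constant dil R0 Ccomp Cmass = (2 + 2 * range_exponent dil R0 Ccomp Cmass) / ln 2"

lemma range_exponent_ge: "4 \<le> range_exponent dil R0 Ccomp Cmass"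
  by (simp add: range_exponent_def)

lemma level_constant_pos: "0 < level_constant dil R0 Ccomp Cmass"
  unfolding level_constant_def using range_exponent_ge[of dil R0 Ccomp Cmass]
  by (intro divide_pos_pos) auto

locale tag_family =
  fixes c0 Cnb dil enl R0 Ccomp Cmass \<delta> a :: real
    and Tags :: "'g set" and D :: "'g \<Rightarrow> ('p, 't) tag"
  assumes c0: "0 < c0" and Cnb: "0 < Cnb" and dil: "1 \<le> dil" and R0: "0 < R0"
    and delta: "0 < \<delta>" "\<delta> < 1"
    and finite_Tags: "finite Tags" and Tags_nonempty: "Tags \<noteq> {}"
    and inputs: "A \<in> Tags \<Longrightarrow> tag_input c0 dil enl R0 a (D A)"
    and complexity: "real (card Tags) + Max ((\<lambda>A. real (card (parents (D A)) + card (children (D A)) +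
        card (active_cells (c0 * a) (D A)))) ` Tags) \<le> \<delta> powr (- Ccomp)"
    and masses: "A \<in> Tags \<Longrightarrow> \<delta> powr Cmass \<le> mass (D A) (shading (D A)) \<and>
        mass (D A) (shading (D A)) \<le> \<delta> powr (- Cmass)"
begin

abbreviation "h \<equiv> c0 * a"
abbreviation "s \<equiv> Cnb * a"
abbreviation "Cv \<equiv> volume_constant c0 Cnb"
abbreviation "M A V \<equiv> mass (D A) V"
abbreviation "X \<equiv> 2 / \<delta>"
abbreviation "B \<equiv> range_exponent dil R0 Ccomp Cmass"
abbreviation "Clev \<equiv> level_constant dil R0 Ccomp Cmass"

lemma tag: "A \<in> Tags \<Longrightarrow> cellular_tag c0 dil enl R0 a h (D A)"
  using inputs c0 by unfold_locales auto

lemma X_ge_2: "2 \<le> X"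
  using delta by (simp add: field_simps)

lemma two_le_X_powr: "2 \<le> X powr 1"
  using X_ge_2 delta by simp

lemma delta_powr_le: "\<delta> powr e \<le> X powr \<bar>e\<bar>"
proof -
  have "\<delta> powr e \<le> \<delta> powr (- \<bar>e\<bar>)"
    using delta by (intro powr_mono') auto
  also have "\<dots> = (1 / \<delta>) powr \<bar>e\<bar>"
    using delta by (simp add: powr_minus powr_divide inverse_eq_divide)
  also have "\<dots> \<le> X powr \<bar>e\<bar>"
    using delta by (intro powr_mono2) (auto simp: field_simps)
  finally show ?thesis .
qed

lemma cards_le:
  assumes "A \<in> Tags"
  shows "real (card (parents (D A))) \<le> X powr \<bar>Ccomp\<bar>"
    "real (card (children (D A))) \<le> X powr \<bar>Ccomp\<bar>"
    "real (card (active_cells h (D A))) \<le> X powr \<bar>Ccomp\<bar>"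
proof -
  let ?n = "\<lambda>A. real (card (parents (D A)) + card (children (D A)) + card (active_cells h (D A)))"
  have "?n A \<le> Max (?n ` Tags)"
    using assms finite_Tags by (intro Max_ge) auto
  also have "\<dots> \<le> \<delta> powr (- Ccomp)"
    using complexity by linarith
  also have "\<dots> \<le> X powr \<bar>Ccomp\<bar>"
    using delta_powr_le[of "- Ccomp"] by simp
  finally show "real (card (parents (D A))) \<le> X powr \<bar>Ccomp\<bar>"
    "real (card (children (D A))) \<le> X powr \<bar>Ccomp\<bar>"
    "real (card (active_cells h (D A))) \<le> X powr \<bar>Ccomp\<bar>"
    by linarith+
qed

lemma mass_range:
  assumes "A \<in> Tags"
  shows "M A (shading (D A)) \<le> X powr \<bar>Cmass\<bar>" "1 \<le> M A (shading (D A)) * X powr \<bar>Cmass\<bar>"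
proof -
  show "M A (shading (D A)) \<le> X powr \<bar>Cmass\<bar>"
    using masses[OF assms] delta_powr_le[of "- Cmass"] by simp
  have "1 = \<delta> powr Cmass * \<delta> powr (- Cmass)"
    using delta by (simp flip: powr_add)
  also have "\<dots> \<le> M A (shading (D A)) * X powr \<bar>Cmass\<bar>"
    using masses[OF assms] delta_powr_le[of "- Cmass"]
      cellular_tag.mass_nonneg[OF tag[OF assms], of "shading (D A)"] by (intro mult_mono) auto
  finally show "1 \<le> M A (shading (D A)) * X powr \<bar>Cmass\<bar>" .
qed

text \<open>Lower bounds for parameters are obtained in the form: parameter times a power of \<open>2 / \<delta>\<close> is at least
  \<open>1\<close>.\<close>

lemma lower_from_product:
  assumes "1 \<le> t * X powr e" "e \<le> B"
  shows "X powr (- B) \<le> t"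
proof -
  have "X powr (- B) \<le> X powr (- e)"
    using assms X_ge_2 by (intro powr_mono) auto
  also have "\<dots> = 1 / X powr e"
    by (simp add: powr_minus divide_inverse)
  also have "\<dots> \<le> t"
    using assms(1) X_ge_2 delta by (simp add: pos_divide_le_eq)
  finally show ?thesis .
qed

lemma powr_le_B: "t \<le> X powr e \<Longrightarrow> e \<le> B \<Longrightarrow> t \<le> X powr B"
  using X_ge_2 powr_mono[of e B X] by linarith

lemma card_levels_le:
  assumes "\<And>A. A \<in> T \<Longrightarrow> dyadic (f A) \<and> X powr (- B) \<le> f A \<and> f A \<le> X powr B"
  shows "real (card (f ` T)) \<le> Clev * ln (2 / \<delta>)"
  unfolding level_constant_def
  using assms range_exponent_ge[of dil R0 Ccomp Cmass] by (intro card_dyadic_values X_ge_2) auto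

lemma volume_constant_bound: "(h + 2 * s) ^ 3 \<le> Cv * a ^ 3"
proof -
  have "0 < a"
    using Tags_nonempty tag cellular_tag.a_pos by blast
  have "(h + 2 * s) ^ 3 = (c0 + 2 * Cnb) ^ 3 * a ^ 3"
    by (simp add: power_mult_distrib[symmetric] algebra_simps)
  also have "\<dots> \<le> Cv * a ^ 3"
    using \<open>0 < a\<close> by (intro mult_right_mono) (auto simp: volume_constant_def)
  finally show ?thesis .
qed

lemma s_pos: "0 < s"
  using Tags_nonempty tag cellular_tag.a_pos Cnb by (metis ex_in_conv mult_pos_pos)

lemma exponent_bounds:
  "1 + \<bar>Ccomp\<bar> \<le> B" "\<bar>Ccomp\<bar> \<le> B" "\<bar>Cmass\<bar> \<le> B" "3 + 3 * \<bar>Ccomp\<bar> + \<bar>Cmass\<bar> \<le> B" "1 \<le> B"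
  "1 + \<bar>Cmass\<bar> + \<bar>Ccomp\<bar> + log 2 (max 1 ((2 * dil * R0) ^ 3)) \<le> B"
proof -
  have "0 \<le> log 2 (max 1 ((2 * dil * R0) ^ 3))"
    by simp
  then show "1 + \<bar>Ccomp\<bar> \<le> B" "\<bar>Ccomp\<bar> \<le> B" "\<bar>Cmass\<bar> \<le> B" "3 + 3 * \<bar>Ccomp\<bar> + \<bar>Cmass\<bar> \<le> B" "1 \<le> B"
    "1 + \<bar>Cmass\<bar> + \<bar>Ccomp\<bar> + log 2 (max 1 ((2 * dil * R0) ^ 3)) \<le> B"
    unfolding range_exponent_def by linarith+
qed

lemma degree_range:
  assumes "A \<in> Tags" "1/2 < t" "t \<le> real (card (parents (D A)))"
  shows "X powr (- B) \<le> t \<and> t \<le> X powr B"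
proof
  have "1 \<le> t * 2"
    using assms by simp
  also have "\<dots> \<le> t * X powr 1"
    using assms by (intro mult_left_mono two_le_X_powr) auto
  finally show "X powr (- B) \<le> t"
    by (rule lower_from_product) (rule exponent_bounds)
  show "t \<le> X powr B"
    using assms(3) cards_le(1)[OF assms(1)] exponent_bounds(2)
    by (intro powr_le_B[of t "\<bar>Ccomp\<bar>"]) linarith+
qed

text \<open>Output angles are not dyadic, so they are synchronised through the largest power of two below them.\<close>

lemma angle_level_range:
  assumes A: "A \<in> Tags" and th: "q_res a (D A) \<le> th" "th \<le> 1"
  defines "t \<equiv> 2 powi \<lfloor>log 2 th\<rfloor>"
  shows "t \<le> th" "th < 2 * t" "X powr (- B) \<le> t \<and> t \<le> X powr B"
proof -
  interpret cellular_tag c0 dil enl R0 a h "D A"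
    by (rule tag[OF A])
  have "0 < th"
    using th q_res_bounds by linarith
  then show t: "t \<le> th" "th < 2 * t"
    unfolding t_def by (rule powi_floor_log)+
  let ?R = "2 * dil * R0"
  define cr where "cr = log 2 (max 1 (?R ^ 3))"
  have R: "0 < ?R" "side_r (D A) \<le> ?R"
    using dil R0 side_r_le by auto
  have "max 1 (?R ^ 3) = 2 powr cr"
    by (simp add: cr_def)
  also have "\<dots> \<le> X powr cr"
    using X_ge_2 by (intro powr_mono2) (auto simp: cr_def)
  finally have Rcr: "?R ^ 3 \<le> X powr cr"
    by simp
  have X0: "0 < X"
    using X_ge_2 by linarith
  have "1 \<le> q_res a (D A) * (X powr \<bar>Cmass\<bar> * X powr \<bar>Ccomp\<bar> * ?R ^ 3)"
    using R cards_le(2)[OF A] mass_range(2)[OF A] X0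
    by (intro q_res_lower) (auto simp del: power_mult_distrib)
  also have "\<dots> \<le> (t * 2) * (X powr \<bar>Cmass\<bar> * X powr \<bar>Ccomp\<bar> * X powr cr)"
    using th t Rcr R q_res_bounds by (intro mult_mono) auto
  also have "\<dots> = t * (2 * (X powr \<bar>Cmass\<bar> * X powr \<bar>Ccomp\<bar> * X powr cr))"
    by simp
  also have "\<dots> \<le> t * (X powr 1 * (X powr \<bar>Cmass\<bar> * X powr \<bar>Ccomp\<bar> * X powr cr))"
    using X0 t \<open>0 < th\<close> by (intro mult_left_mono mult_right_mono two_le_X_powr) auto
  also have "\<dots> = t * X powr (1 + \<bar>Cmass\<bar> + \<bar>Ccomp\<bar> + cr)"
    by (simp only: powr_add mult.assoc)
  finally have "X powr (- B) \<le> t"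
    by (rule lower_from_product) (use exponent_bounds(6) in \<open>simp only: cr_def\<close>)
  moreover have "t \<le> X powr B"
    using t th exponent_bounds(5) X_ge_2 by (intro powr_le_B[of _ 0]) auto
  ultimately show "X powr (- B) \<le> t \<and> t \<le> X powr B"
    by blast
qed

end

locale tag_family_run = tag_family +
  fixes mu om d :: "'a \<Rightarrow> real"
  assumes runs: "A \<in> Tags \<Longrightarrow> joint_run h (D A) (mu A) (om A) (d A)"
begin

abbreviation "Jv A \<equiv> real (J_v Cv a h (D A) (mu A) (om A) (d A))"
abbreviation "Lreg A \<equiv> L_reg h (D A) (mu A) (om A)"
abbreviation "Jv_max \<equiv> Max (Jv ` Tags)"
abbreviation "Lreg_max \<equiv> Max (Lreg ` Tags)"

lemma tag_run:
  assumes "A \<in> Tags"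
  shows "local_volume_tag c0 dil enl R0 a h (D A) (mu A) (om A) (d A) s Cv"
proof -
  interpret cellular_tag c0 dil enl R0 a h "D A"
    by (rule tag[OF assms])
  show ?thesis
    using runs[OF assms] s_pos volume_constant_bound by unfold_locales
qed

lemma nonempty_cells:
  assumes "A \<in> Tags"
  shows "Q_plus h (D A) (mu A) (om A) (d A) \<noteq> {}"
proof -
  interpret local_volume_tag c0 dil enl R0 a h "D A" "mu A" "om A" "d A" s Cv
    by (rule tag_run[OF assms])
  show ?thesis
    by (rule Q_plus_nonempty)
qed

lemma selection_exists:
  assumes "A \<in> Tags"
  shows "\<exists>E. volume_selection Cv a s h (D A) (mu A) (om A) (d A) E"
proof -
  interpret local_volume_tag c0 dil enl R0 a h "D A" "mu A" "om A" "d A" s Cv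
    by (rule tag_run[OF assms])
  show ?thesis
    by (rule volume_selection_exists)
qed

lemma maxima:
  assumes "A \<in> Tags"
  shows "1 \<le> Jv A" "Jv A \<le> Jv_max" "1 \<le> Lreg A" "Lreg A \<le> Lreg_max"
proof -
  interpret local_volume_tag c0 dil enl R0 a h "D A" "mu A" "om A" "d A" s Cv
    by (rule tag_run[OF assms])
  show "1 \<le> Jv A" "1 \<le> Lreg A"
    using J_v_ge_1 L_reg_bounds(1) by auto
  show "Jv A \<le> Jv_max" "Lreg A \<le> Lreg_max"
    using assms finite_Tags by auto
qed

lemma parameter_ranges:
  assumes "A \<in> Tags"
  shows "dyadic (mu A) \<and> X powr (- B) \<le> mu A \<and> mu A \<le> X powr B"
    and "dyadic (om A) \<and> X powr (- B) \<le> om A \<and> om A \<le> X powr B"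
    and "dyadic (d A) \<and> X powr (- B) \<le> d A \<and> d A \<le> X powr B"
proof -
  interpret local_volume_tag c0 dil enl R0 a h "D A" "mu A" "om A" "d A" s Cv
    by (rule tag_run[OF assms])
  let ?c = "X powr \<bar>Ccomp\<bar>"
  show "dyadic (d A) \<and> X powr (- B) \<le> d A \<and> d A \<le> X powr B"
    using dyadic_levels degree_range[OF assms d_range] by blast
  have "mu A \<le> 2 * ?c"
    using mu_range(2) cards_le(2)[OF assms] by linarith
  also have "\<dots> \<le> X powr 1 * ?c"
    by (intro mult_right_mono two_le_X_powr) auto
  also have "\<dots> = X powr (1 + \<bar>Ccomp\<bar>)"
    by (simp only: powr_add)
  finally have "mu A \<le> X powr B"
    using exponent_bounds(1) by (rule powr_le_B)
  moreover have "X powr (- B) \<le> mu A"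
    by (rule lower_from_product[of _ 0]) (use mu_range(1) exponent_bounds(5) X_ge_2 in auto)
  ultimately show "dyadic (mu A) \<and> X powr (- B) \<le> mu A \<and> mu A \<le> X powr B"
    using dyadic_levels by blast
  have "om A \<le> X powr \<bar>Cmass\<bar>"
    using om_le mass_range(1)[OF assms] by linarith
  then have upper: "om A \<le> X powr B"
    using exponent_bounds(3) by (rule powr_le_B)
  have eight: "8 \<le> X powr 3"
  proof -
    have "8 = (2::real) * (2 * 2)"
      by simp
    also have "\<dots> \<le> X powr 1 * (X powr 1 * X powr 1)"
      by (intro mult_mono two_le_X_powr) auto
    also have "\<dots> = X powr (1 + (1 + 1))"
      by (simp only: powr_add)
    finally show ?thesis
      by simp
  qed
  have "1 \<le> M A (shading (D A)) * X powr \<bar>Cmass\<bar>"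
    by (rule mass_range(2)[OF assms])
  also have "\<dots> \<le> (om A * (8 * real (card (children (D A))) * real (card (parents (D A))) *
      real (card (active_cells h (D A))))) * X powr \<bar>Cmass\<bar>"
    by (intro mult_right_mono om_ge) auto
  also have "\<dots> \<le> (om A * (X powr 3 * ?c * ?c * ?c)) * X powr \<bar>Cmass\<bar>"
    using om_pos cards_le[OF assms] eight by (intro mult_right_mono mult_left_mono mult_mono) auto
  also have "\<dots> = om A * X powr (3 + 3 * \<bar>Ccomp\<bar> + \<bar>Cmass\<bar>)"
  proof -
    have "3 + 3 * \<bar>Ccomp\<bar> + \<bar>Cmass\<bar> = 3 + \<bar>Ccomp\<bar> + \<bar>Ccomp\<bar> + \<bar>Ccomp\<bar> + \<bar>Cmass\<bar>"
      by simp
    then show ?thesis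
      by (simp only: powr_add mult.assoc)
  qed
  finally have "X powr (- B) \<le> om A"
    by (rule lower_from_product) (rule exponent_bounds)
  then show "dyadic (om A) \<and> X powr (- B) \<le> om A \<and> om A \<le> X powr B"
    using upper dyadic_levels by blast
qed

text \<open>The tags are split according to the values of the three dyadic parameters, and the class with the
  largest input mass is kept. Weighing by the input mass makes the choice of tags independent of the
  later volume selections, and it bounds the input mass of the kept tags as well.\<close>

lemma first_tag_selection:
  obtains A0 where "A0 \<in> Tags"
    "(\<Sum>A\<in>Tags. M A (shading (D A))) \<le> real (card (mu ` Tags)) * real (card (om ` Tags)) * real (card (d ` Tags)) *
      (\<Sum>A | A \<in> Tags \<and> mu A = mu A0 \<and> om A = om A0 \<and> d A = d A0. M A (shading (D A)))"
proof -
  let ?f = "\<lambda>A. (mu A, om A, d A)" and ?w = "\<lambda>A. M A (shading (D A))"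
  obtain A0 where A0: "A0 \<in> Tags" "sum ?w Tags \<le> real (card (?f ` Tags)) * sum ?w {A \<in> Tags. ?f A = ?f A0}"
    by (rule heaviest_fibre[OF finite_Tags Tags_nonempty])
  have "card (?f ` Tags) \<le> card (mu ` Tags) * card ((\<lambda>A. (om A, d A)) ` Tags)"
    by (rule card_image_Pair_le[OF finite_Tags])
  also have "\<dots> \<le> card (mu ` Tags) * (card (om ` Tags) * card (d ` Tags))"
    by (intro mult_left_mono card_image_Pair_le[OF finite_Tags]) auto
  finally have "real (card (?f ` Tags)) \<le> real (card (mu ` Tags)) * real (card (om ` Tags)) * real (card (d ` Tags))"
    by (simp only: of_nat_mult[symmetric] of_nat_le_iff mult.assoc)
  moreover have "0 \<le> sum ?w {A \<in> Tags. ?f A = ?f A0}"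
    by (intro sum_nonneg) (use tag cellular_tag.mass_nonneg in blast)
  ultimately have "real (card (?f ` Tags)) * sum ?w {A \<in> Tags. ?f A = ?f A0} \<le>
      real (card (mu ` Tags)) * real (card (om ` Tags)) * real (card (d ` Tags)) * sum ?w {A \<in> Tags. ?f A = ?f A0}"
    by (rule mult_right_mono)
  with A0 show thesis
    using that[of A0] by simp
qed

end

text \<open>A subfamily with volume selections in its tags; the assumption \<open>kept\<close> is what the heaviest class of
  tags satisfies.\<close>

locale first_selection = tag_family_run +
  fixes Tags1 :: "'a set" and Lmu Lom Ld :: nat and E3
  assumes Tags1: "Tags1 \<subseteq> Tags" "Tags1 \<noteq> {}"
    and counts: "1 \<le> Lmu" "1 \<le> Lom" "1 \<le> Ld"
    and kept: "(\<Sum>A\<in>Tags. M A (shading (D A))) \<le>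
      real Lmu * real Lom * real Ld * (\<Sum>A\<in>Tags1. M A (shading (D A)))"
    and selections: "A \<in> Tags1 \<Longrightarrow> volume_selection Cv a s h (D A) (mu A) (om A) (d A) (E3 A)"
begin

abbreviation "Yin A \<equiv> shading (D A)"
abbreviation "Ysel A \<equiv> restrict_to (D A) (Y0 (D A) (mu A)) (E3 A)"
abbreviation "frac1 \<equiv> inverse (real Lmu * real Lom * real Ld * Jv_max * Lreg_max)"

lemma tag_selected:
  assumes "A \<in> Tags1"
  shows "volume_selected_tag c0 dil enl R0 a h (D A) (mu A) (om A) (d A) s Cv (E3 A)"
proof -
  interpret local_volume_tag c0 dil enl R0 a h "D A" "mu A" "om A" "d A" s Cv
    using assms Tags1 by (intro tag_run) auto
  show ?thesis
    using selections[OF assms] by unfold_locales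
qed

lemma output_exists:
  assumes "A \<in> Tags1"
  shows "\<exists>G th dang c. angular_output a (D A) (E3 A) G th dang c"
proof -
  interpret volume_selected_tag c0 dil enl R0 a h "D A" "mu A" "om A" "d A" s Cv "E3 A"
    by (rule tag_selected[OF assms])
  show ?thesis
    by (rule angular_output_exists)
qed

lemma finite_Tags1: "finite Tags1"
  using Tags1(1) finite_Tags by (rule finite_subset)

lemma maxima_ge_1: "1 \<le> Jv_max" "1 \<le> Lreg_max"
proof -
  obtain A where "A \<in> Tags"
    using Tags_nonempty by auto
  then show "1 \<le> Jv_max" "1 \<le> Lreg_max"
    using maxima[of A] by linarith+
qed

lemma Lprod_ge_1: "1 \<le> real Lmu * real Lom * real Ld"
proof -
  have "1 \<le> Lmu * Lom * Ld"
    using counts by simp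
  then show ?thesis
    by (simp only: of_nat_mult[symmetric] real_of_nat_ge_one_iff)
qed

lemma frac1_pos: "0 < frac1"
  using maxima_ge_1 counts by (intro positive_imp_inverse_positive mult_pos_pos) linarith+

lemma mass_Y1_ge_max:
  assumes "A \<in> Tags1"
  shows "inverse (Jv_max * Lreg_max) * M A (Yin A) \<le> M A (Ysel A)" "M A (Ysel A) \<le> M A (Yin A)" "0 < M A (Ysel A)"
proof -
  have A: "A \<in> Tags"
    using assms Tags1 by auto
  interpret volume_selected_tag c0 dil enl R0 a h "D A" "mu A" "om A" "d A" s Cv "E3 A"
    by (rule tag_selected[OF assms])
  have "Jv A * Lreg A \<le> Jv_max * Lreg_max"
    using maxima[OF A] by (intro mult_mono) auto
  moreover have "0 < Jv A * Lreg A"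
    using maxima[OF A] by (intro mult_pos_pos) auto
  ultimately have "inverse (Jv_max * Lreg_max) \<le> inverse (Jv A * Lreg A)"
    by (rule le_imp_inverse_le)
  then have "inverse (Jv_max * Lreg_max) * M A (Yin A) \<le> inverse (Jv A * Lreg A) * M A (Yin A)"
    by (rule mult_right_mono) (rule mass_nonneg)
  then show "inverse (Jv_max * Lreg_max) * M A (Yin A) \<le> M A (Ysel A)"
    using mass_Y1_ge by linarith
  show "M A (Ysel A) \<le> M A (Yin A)"
    using subshading_Y1 by (intro mass_mono subshading_shading) (auto simp: subshading_def)
  show "0 < M A (Ysel A)"
    by (rule mass_Y1_pos)
qed

text \<open>Each kept tag retains at least the worst of the local fractions, and the kept tags carry the share of
  the input mass given by the level counts.\<close>

lemma frac1_le: "frac1 * (\<Sum>A\<in>Tags. M A (Yin A)) \<le> (\<Sum>A\<in>Tags1. M A (Ysel A))"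
proof -
  let ?L = "real Lmu * real Lom * real Ld"
  have L: "0 < ?L"
    using Lprod_ge_1 by linarith
  have "inverse ?L * (\<Sum>A\<in>Tags. M A (Yin A)) \<le> (\<Sum>A\<in>Tags1. M A (Yin A))"
    using kept L by (simp only: inverse_eq_divide) (simp add: field_simps)
  moreover have "0 \<le> inverse (Jv_max * Lreg_max)"
    using maxima_ge_1 by simp
  ultimately have "inverse (Jv_max * Lreg_max) * (inverse ?L * (\<Sum>A\<in>Tags. M A (Yin A)))
      \<le> inverse (Jv_max * Lreg_max) * (\<Sum>A\<in>Tags1. M A (Yin A))"
    by (rule mult_left_mono)
  also have "\<dots> = (\<Sum>A\<in>Tags1. inverse (Jv_max * Lreg_max) * M A (Yin A))"
    by (rule sum_distrib_left)
  also have "\<dots> \<le> (\<Sum>A\<in>Tags1. M A (Ysel A))"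
    by (intro sum_mono mass_Y1_ge_max)
  finally show ?thesis
    by (simp only: inverse_mult_distrib mult_ac)
qed

lemma frac1_input_le: "frac1 * (\<Sum>A\<in>Tags. M A (Yin A)) \<le> (\<Sum>A\<in>Tags1. M A (Yin A))"
  by (rule order_trans[OF frac1_le]) (intro sum_mono mass_Y1_ge_max)

text \<open>Both the selected and the original shadings are subshadings, so represented mass may be replaced by
  labelled mass at either end of an inequality.\<close>

lemma represented:
  assumes "A \<in> Tags" "represents_mass cm cp m (D A) F" "subshading (D A) V"
  shows "cm * m * M A V \<le> F V" "F V \<le> cp * m * M A V"
  using assms by (auto simp: represents_mass_def)

lemma subshadings:
  "A \<in> Tags \<Longrightarrow> subshading (D A) (Yin A)"
  "A \<in> Tags1 \<Longrightarrow> subshading (D A) (Ysel A)"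
  by (rule cellular_tag.subshading_shading[OF tag], assumption)
    (rule volume_selected_tag.subshading_Y1[OF tag_selected])

lemma represented_first:
  assumes "0 < m" "0 < cm" "cm \<le> cp" and F: "\<forall>A\<in>Tags. represents_mass cm cp m (D A) (F A)"
  shows "inverse (cp / cm) * frac1 * (\<Sum>A\<in>Tags. F A (Yin A)) \<le> (\<Sum>A\<in>Tags1. F A (Ysel A))"
    and "inverse (cp / cm) * frac1 * (\<Sum>A\<in>Tags. F A (Yin A)) \<le> (\<Sum>A\<in>Tags1. F A (Yin A))"
proof -
  have up: "F A (Yin A) \<le> cp * m * M A (Yin A)" if "A \<in> Tags" for A
    by (rule represented(2)[OF that bspec[OF F that] subshadings(1)[OF that]])
  have lo: "cm * m * M A V \<le> F A V" if "A \<in> Tags1" "subshading (D A) V" for A V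
    by (rule represented(1)[OF subsetD[OF Tags1(1) that(1)] bspec[OF F subsetD[OF Tags1(1) that(1)]] that(2)])
  have pos: "0 < cp" "0 \<le> frac1"
    using assms frac1_pos by auto
  show "inverse (cp / cm) * frac1 * (\<Sum>A\<in>Tags. F A (Yin A)) \<le> (\<Sum>A\<in>Tags1. F A (Ysel A))"
    by (rule comparable_sums[OF assms(1,2) pos _ up frac1_le]) (intro lo subshadings)
  show "inverse (cp / cm) * frac1 * (\<Sum>A\<in>Tags. F A (Yin A)) \<le> (\<Sum>A\<in>Tags1. F A (Yin A))"
    by (rule comparable_sums[OF assms(1,2) pos _ up frac1_input_le])
      (use Tags1 in \<open>auto intro: lo subshadings\<close>)
qed

lemma denominators_first:
  assumes rep: "0 < m" "0 < cm" "cm \<le> cp" "\<forall>A\<in>Tags. represents_mass cm cp m (D A) (F A)"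
    and den: "0 < rho" "0 < km" "km \<le> kp" "\<forall>A\<in>Tags. km * rho * denominator (D A) \<le> F A (Yin A) \<and>
      F A (Yin A) \<le> kp * rho * denominator (D A)"
  shows "inverse (kp / km) * inverse (cp / cm) * frac1 * (\<Sum>A\<in>Tags. denominator (D A))
    \<le> (\<Sum>A\<in>Tags1. denominator (D A))"
proof -
  have "0 \<le> inverse (cp / cm)"
    using rep by simp
  then have pos: "0 \<le> inverse (cp / cm) * frac1"
    by (rule mult_nonneg_nonneg) (rule less_imp_le[OF frac1_pos])
  have kp: "0 < kp"
    using den by linarith
  have "inverse (kp / km) * (inverse (cp / cm) * frac1) * (\<Sum>A\<in>Tags. denominator (D A))
    \<le> (\<Sum>A\<in>Tags1. denominator (D A))"
    by (rule comparable_denominators[OF den(1,2) kp pos Tags1(1) bspec[OF den(4)] represented_first(2)[OF rep]])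
  then show ?thesis
    by (simp only: mult.assoc)
qed

end

locale second_selection = first_selection +
  fixes G th dang c
  assumes outputs: "A \<in> Tags1 \<Longrightarrow> angular_output a (D A) (E3 A) (G A) (th A) (dang A) (c A)"
begin

abbreviation "Yang A \<equiv> restrict_to (D A) (Ysel A) (G A)"
abbreviation "c_min \<equiv> Min ((\<lambda>A. c_floor a (D A)) ` Tags1)"

lemma tag_angular:
  assumes "A \<in> Tags1"
  shows "angular_tag c0 dil enl R0 a h (D A) (mu A) (om A) (d A) s Cv (E3 A) (G A) (th A) (dang A) (c A)"
proof -
  interpret volume_selected_tag c0 dil enl R0 a h "D A" "mu A" "om A" "d A" s Cv "E3 A"
    by (rule tag_selected[OF assms])
  show ?thesis
    using outputs[OF assms] by unfold_locales
qed

lemma retention_upper: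
  assumes "A \<in> Tags1"
  shows "inverse (c A) \<le> 12 * (1 + L_plus a (D A)) ^ 2 *
    exp (L_plus a (D A) powr (3/4) + 2 * L_plus a (D A) powr (1/2))"
proof -
  interpret angular_tag c0 dil enl R0 a h "D A" "mu A" "om A" "d A" s Cv "E3 A" "G A" "th A" "dang A" "c A"
    by (rule tag_angular[OF assms])
  show ?thesis
    by (rule order_trans[OF inverse_c_le inverse_c_floor_le])
qed

lemma retention_constant:
  assumes "A \<in> Tags1" "ln (inverse (alpha a (D A))) \<le> 1"
  shows "inverse (c A) \<le> 48 * exp 3"
proof -
  interpret angular_tag c0 dil enl R0 a h "D A" "mu A" "om A" "d A" s Cv "E3 A" "G A" "th A" "dang A" "c A"
    by (rule tag_angular[OF assms(1)])
  show ?thesis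
    by (rule order_trans[OF inverse_c_le c_floor_constant[OF assms(2)]])
qed

lemma retention_subpolynomial:
  assumes "A \<in> Tags1" "0 < eps" "alpha a (D A) < exp (- ((13 / eps) ^ 4) - 1)"
  shows "alpha a (D A) powr eps \<le> c A"
proof -
  interpret angular_tag c0 dil enl R0 a h "D A" "mu A" "om A" "d A" s Cv "E3 A" "G A" "th A" "dang A" "c A"
    by (rule tag_angular[OF assms(1)])
  show ?thesis
    by (rule order_trans[OF c_floor_subpolynomial[OF assms(2,3)] c_ge])
qed

definition th_level :: "'a \<Rightarrow> real" where
  "th_level A = 2 powi \<lfloor>log 2 (th A)\<rfloor>"

lemma angular_ranges:
  assumes "A \<in> Tags1"
  shows "th_level A \<le> th A" "th A < 2 * th_level A"
    and "dyadic (th_level A) \<and> X powr (- B) \<le> th_level A \<and> th_level A \<le> X powr B"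
    and "dyadic (dang A) \<and> X powr (- B) \<le> dang A \<and> dang A \<le> X powr B"
proof -
  have A: "A \<in> Tags"
    using assms Tags1 by auto
  interpret angular_tag c0 dil enl R0 a h "D A" "mu A" "om A" "d A" s Cv "E3 A" "G A" "th A" "dang A" "c A"
    by (rule tag_angular[OF assms])
  show "th_level A \<le> th A" "th A < 2 * th_level A"
    unfolding th_level_def by (rule angle_level_range[OF A th_bounds])+
  show "dyadic (th_level A) \<and> X powr (- B) \<le> th_level A \<and> th_level A \<le> X powr B"
    using angle_level_range(3)[OF A th_bounds] by (auto simp: th_level_def dyadic_def)
  show "dyadic (dang A) \<and> X powr (- B) \<le> dang A \<and> dang A \<le> X powr B"
    using degree_range[OF A dang_range] dyadic_dang by blast
qed

lemma c_min_bounds: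
  assumes "A \<in> Tags1"
  shows "c_min \<le> c A" "c_min \<le> 1" "0 < c_min"
proof -
  interpret angular_tag c0 dil enl R0 a h "D A" "mu A" "om A" "d A" s Cv "E3 A" "G A" "th A" "dang A" "c A"
    by (rule tag_angular[OF assms])
  have le: "c_min \<le> c_floor a (D A)"
    using assms finite_Tags1 by (intro Min_le) auto
  then show "c_min \<le> c A" "c_min \<le> 1"
    using c_ge c_floor_bounds by linarith+
  have "c_min \<in> (\<lambda>A. c_floor a (D A)) ` Tags1"
    using assms finite_Tags1 by (intro Min_in) auto
  then obtain A' where "A' \<in> Tags1" "c_min = c_floor a (D A')"
    by auto
  then show "0 < c_min"
    using cellular_tag.c_floor_bounds(1)[OF tag] Tags1 by auto
qed

text \<open>The second split weighs tags by the mass after the volume selection. Angular outputs are then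
  controlled tag by tag, and the original masses are controlled because they are larger.\<close>

lemma second_tag_selection:
  obtains A0 where "A0 \<in> Tags1"
    "(\<Sum>A\<in>Tags1. M A (Ysel A)) \<le> real (card (th_level ` Tags1)) * real (card (dang ` Tags1)) *
      (\<Sum>A | A \<in> Tags1 \<and> th_level A = th_level A0 \<and> dang A = dang A0. M A (Ysel A))"
proof -
  let ?f = "\<lambda>A. (th_level A, dang A)" and ?w = "\<lambda>A. M A (Ysel A)"
  obtain A0 where A0: "A0 \<in> Tags1" "sum ?w Tags1 \<le> real (card (?f ` Tags1)) * sum ?w {A \<in> Tags1. ?f A = ?f A0}"
    by (rule heaviest_fibre[OF finite_Tags1 Tags1(2)])
  have "real (card (?f ` Tags1)) \<le> real (card (th_level ` Tags1)) * real (card (dang ` Tags1))"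
    using card_image_Pair_le[OF finite_Tags1, of th_level dang]
    by (simp only: of_nat_mult[symmetric] of_nat_le_iff)
  moreover have "0 \<le> sum ?w {A \<in> Tags1. ?f A = ?f A0}"
    by (intro sum_nonneg) (use mass_Y1_ge_max(3) in \<open>auto intro: less_imp_le\<close>)
  ultimately have "real (card (?f ` Tags1)) * sum ?w {A \<in> Tags1. ?f A = ?f A0} \<le>
      real (card (th_level ` Tags1)) * real (card (dang ` Tags1)) * sum ?w {A \<in> Tags1. ?f A = ?f A0}"
    by (rule mult_right_mono)
  with A0 show thesis
    using that[of A0] by simp
qed

context
  fixes Tags2 :: "'a set" and Lth Ldang :: nat
  assumes Tags2: "Tags2 \<subseteq> Tags1"
    and counts2: "1 \<le> Lth" "1 \<le> Ldang"
    and kept2: "(\<Sum>A\<in>Tags1. M A (Ysel A)) \<le> real Lth * real Ldang * (\<Sum>A\<in>Tags2. M A (Ysel A))"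
begin

abbreviation "frac2 \<equiv> c_min / (2 * real Lth * real Ldang)"

lemma frac2_bounds: "0 < frac2"
    "frac2 * (\<Sum>A\<in>Tags1. M A (Ysel A)) \<le> c_min / 2 * (\<Sum>A\<in>Tags2. M A (Ysel A))"
proof -
  have c: "0 < c_min"
    using c_min_bounds Tags1(2) by auto
  have L: "0 < real Lth" "0 < real Ldang"
    using counts2 by auto
  then show "0 < frac2"
    using c by simp
  have "frac2 * (\<Sum>A\<in>Tags1. M A (Ysel A)) \<le> frac2 * (real Lth * real Ldang * (\<Sum>A\<in>Tags2. M A (Ysel A)))"
    using kept2 c L by (intro mult_left_mono) auto
  also have "\<dots> = c_min / 2 * (\<Sum>A\<in>Tags2. M A (Ysel A))"
    using L by simp
  finally show "frac2 * (\<Sum>A\<in>Tags1. M A (Ysel A)) \<le> c_min / 2 * (\<Sum>A\<in>Tags2. M A (Ysel A))" .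
qed

lemma frac2_le: "frac2 * (\<Sum>A\<in>Tags1. M A (Ysel A)) \<le> (\<Sum>A\<in>Tags2. M A (Yang A))"
proof -
  have "c_min / 2 * M A (Ysel A) \<le> M A (Yang A)" if "A \<in> Tags2" for A
  proof -
    have A: "A \<in> Tags1"
      using that Tags2 by auto
    have "c_min / 2 * M A (Ysel A) \<le> c A / 2 * M A (Ysel A)"
      using c_min_bounds(1)[OF A] mass_Y1_ge_max(3)[OF A] by (intro mult_right_mono) auto
    then show ?thesis
      using angular_tag.mass_Y2_ge[OF tag_angular[OF A]] by linarith
  qed
  then have "c_min / 2 * (\<Sum>A\<in>Tags2. M A (Ysel A)) \<le> (\<Sum>A\<in>Tags2. M A (Yang A))"
    by (simp add: sum_distrib_left sum_mono)
  then show ?thesis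
    using frac2_bounds(2) by linarith
qed

lemma frac2_input_le: "frac2 * frac1 * (\<Sum>A\<in>Tags. M A (Yin A)) \<le> (\<Sum>A\<in>Tags2. M A (Yin A))"
proof -
  have "frac2 * (frac1 * (\<Sum>A\<in>Tags. M A (Yin A))) \<le> frac2 * (\<Sum>A\<in>Tags1. M A (Ysel A))"
    using frac2_bounds(1) by (intro mult_left_mono frac1_le) auto
  also have "\<dots> \<le> c_min / 2 * (\<Sum>A\<in>Tags2. M A (Ysel A))"
    by (rule frac2_bounds)
  also have "\<dots> \<le> 1 * (\<Sum>A\<in>Tags2. M A (Ysel A))"
  proof (rule mult_right_mono)
    show "c_min / 2 \<le> 1"
      using c_min_bounds(2) Tags1(2) by fastforce
    show "0 \<le> (\<Sum>A\<in>Tags2. M A (Ysel A))"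
      using mass_Y1_ge_max(3) Tags2 by (intro sum_nonneg) (auto intro: less_imp_le)
  qed
  also have "\<dots> \<le> (\<Sum>A\<in>Tags2. M A (Yin A))"
    using mass_Y1_ge_max(2) Tags2 by (simp add: subset_iff sum_mono)
  finally show ?thesis
    by (simp only: mult.assoc)
qed

lemma represented_second:
  assumes "0 < m" "0 < cm" "cm \<le> cp" and F: "\<forall>A\<in>Tags. represents_mass cm cp m (D A) (F A)"
  shows "inverse (cp / cm) * frac2 * (\<Sum>A\<in>Tags1. F A (Ysel A)) \<le> (\<Sum>A\<in>Tags2. F A (Yang A))"
    and "inverse (cp / cm) * (frac2 * frac1) * (\<Sum>A\<in>Tags. F A (Yin A)) \<le> (\<Sum>A\<in>Tags2. F A (Yin A))"
proof -
  have T2: "A \<in> Tags" "A \<in> Tags1" if "A \<in> Tags2" for A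
    using that Tags1 Tags2 by auto
  have up: "F A V \<le> cp * m * M A V" if "A \<in> Tags" "subshading (D A) V" for A V
    by (rule represented(2)[OF that(1) bspec[OF F that(1)] that(2)])
  have lo: "cm * m * M A V \<le> F A V" if "A \<in> Tags2" "subshading (D A) V" for A V
    by (rule represented(1)[OF T2(1)[OF that(1)] bspec[OF F T2(1)[OF that(1)]] that(2)])
  have "0 < frac2 * frac1"
    by (intro mult_pos_pos frac2_bounds(1) frac1_pos)
  then have pos: "0 < cp" "0 \<le> frac2" "0 \<le> frac2 * frac1"
    using assms less_imp_le[OF frac2_bounds(1)] by linarith+
  show "inverse (cp / cm) * frac2 * (\<Sum>A\<in>Tags1. F A (Ysel A)) \<le> (\<Sum>A\<in>Tags2. F A (Yang A))"
  proof (rule comparable_sums[OF assms(1,2) pos(1,2) _ _ frac2_le])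
    fix A assume "A \<in> Tags2"
    then show "cm * m * M A (Yang A) \<le> F A (Yang A)"
      using T2 angular_tag.subshading_Y2[OF tag_angular] by (intro lo) auto
  next
    fix A assume "A \<in> Tags1"
    then show "F A (Ysel A) \<le> cp * m * M A (Ysel A)"
      using Tags1 by (intro up subshadings) auto
  qed
  show "inverse (cp / cm) * (frac2 * frac1) * (\<Sum>A\<in>Tags. F A (Yin A)) \<le> (\<Sum>A\<in>Tags2. F A (Yin A))"
    by (rule comparable_sums[OF assms(1,2) pos(1,3) _ _ frac2_input_le])
      (use T2 in \<open>auto intro: lo up subshadings\<close>)
qed

lemma denominators_second:
  assumes rep: "0 < m" "0 < cm" "cm \<le> cp" "\<forall>A\<in>Tags. represents_mass cm cp m (D A) (F A)"
    and den: "0 < rho" "0 < km" "km \<le> kp" "\<forall>A\<in>Tags. km * rho * denominator (D A) \<le> F A (Yin A) \<and>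
      F A (Yin A) \<le> kp * rho * denominator (D A)"
  shows "inverse (kp / km) * inverse (cp / cm) * (frac2 * frac1) * (\<Sum>A\<in>Tags. denominator (D A))
    \<le> (\<Sum>A\<in>Tags2. denominator (D A))"
proof -
  have "0 \<le> inverse (cp / cm)"
    using rep by simp
  then have pos: "0 \<le> inverse (cp / cm) * (frac2 * frac1)"
    by (rule mult_nonneg_nonneg) (intro mult_nonneg_nonneg less_imp_le[OF frac1_pos] less_imp_le[OF frac2_bounds(1)])
  have kp: "0 < kp"
    using den by linarith
  have "inverse (kp / km) * (inverse (cp / cm) * (frac2 * frac1)) * (\<Sum>A\<in>Tags. denominator (D A))
    \<le> (\<Sum>A\<in>Tags2. denominator (D A))"
    by (rule comparable_denominators[OF den(1,2) kp pos subset_trans[OF Tags2 Tags1(1)] bspec[OF den(4)]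
          represented_second(2)[OF rep]])
  then show ?thesis
    by (simp only: mult.assoc)
qed

end

end

text \<open>The absolute constants come from the bound \<open>inverse c \<le> 12 (1 + L)\<^sup>2 exp (L powr (3/4) + 2 L powr (1/2))\<close>,
  whose value at \<open>L = 1\<close> is \<open>48 exp 3\<close>. The common parameters are exact values taken from one tag of the
  heaviest class, so that all tags of the class agree with them; in particular the degree thresholds
  cannot separate tags of one class. The level counts are the numbers of values that occur.\<close>

theorem theorem10p7:
  shows
  "\<exists>Cang Cang1 :: real. \<exists>alpha0 :: real \<Rightarrow> real. (\<forall>eps>0. 0 < alpha0 eps) \<and>
   (\<forall>c0 Cnb dil enl R0 :: real.
     0 < c0 \<and> c0 \<le> 1 / 10 ^ 3 \<and> 0 < Cnb \<and> 1 \<le> dil \<and> 1 \<le> enl \<and> 0 < R0 \<longrightarrow>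
   (\<exists>Cv::real. 1 \<le> Cv \<and>
   (\<forall>Ccomp Cmass :: real. \<exists>C::real. 0 < C \<and>
   (\<forall>(\<delta>::real) (a::real) (Tags :: 'g set) (D :: 'g \<Rightarrow> ('p, 't) tag).
     let h = c0 * a;
         s = Cnb * a;
         Y = (\<lambda>A. shading (D A))
     in
     0 < \<delta> \<and> \<delta> < 1 \<and> finite Tags \<and> Tags \<noteq> {} \<and>
     (\<forall>A\<in>Tags. tag_input c0 dil enl R0 a (D A)) \<and>
     real (card Tags) +
       Max ((\<lambda>A. real (card (parents (D A)) + card (children (D A)) + card (active_cells h (D A)))) ` Tags)
       \<le> \<delta> powr (- Ccomp) \<and>
     (\<forall>A\<in>Tags. \<delta> powr Cmass \<le> mass (D A) (Y A) \<and> mass (D A) (Y A) \<le> \<delta> powr (- Cmass))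
     \<longrightarrow>
     (\<forall>A\<in>Tags. \<exists>mu om d. joint_run h (D A) mu om d) \<and>
     (\<forall>mu om d :: 'g \<Rightarrow> real.
       (\<forall>A\<in>Tags. joint_run h (D A) (mu A) (om A) (d A)) \<longrightarrow>
       (let Jv = (\<lambda>A. real (J_v Cv a h (D A) (mu A) (om A) (d A)));
            Lreg = (\<lambda>A. L_reg h (D A) (mu A) (om A));
            Jv_max = Max (Jv ` Tags);
            Lreg_max = Max (Lreg ` Tags)
        in
        (\<forall>A\<in>Tags. \<forall>Q\<in>Q_plus h (D A) (mu A) (om A) (d A).
           om A / (2 * mu A) \<le> local_volume s h (D A) (mu A) (om A) (d A) Q \<and>
           local_volume s h (D A) (mu A) (om A) (d A) Q \<le> Cv * a ^ 3) \<and>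
        (\<exists>Tags1 \<subseteq> Tags. \<exists>mus oms ds :: real. \<exists>Lmu Lom Ld :: nat.
           Tags1 \<noteq> {} \<and> dyadic mus \<and> dyadic oms \<and> dyadic ds \<and>
           1 \<le> Lmu \<and> 1 \<le> Lom \<and> 1 \<le> Ld \<and>
           real Lmu \<le> C * ln (2 / \<delta>) \<and> real Lom \<le> C * ln (2 / \<delta>) \<and> real Ld \<le> C * ln (2 / \<delta>) \<and>
           (\<forall>A\<in>Tags1. mus \<le> mu A \<and> mu A < 2 * mus \<and>
                       oms \<le> om A \<and> om A < 2 * oms \<and>
                       ds \<le> d A \<and> d A < 2 * ds) \<and>
           (\<forall>A\<in>Tags1. Q_plus h (D A) (mu A) (om A) (d A) \<noteq> {}) \<and>
           (\<forall>A\<in>Tags1. \<exists>E. volume_selection Cv a s h (D A) (mu A) (om A) (d A) E) \<and>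
           (\<forall>E3 :: 'g \<Rightarrow> ('p \<times> pt set) set.
             (\<forall>A\<in>Tags1. volume_selection Cv a s h (D A) (mu A) (om A) (d A) (E3 A)) \<longrightarrow>
             (let Z = (\<lambda>A. parent_shading (E3 A));
                  Y1 = (\<lambda>A. restrict_to (D A) (Y0 (D A) (mu A)) (E3 A));
                  frac1 = inverse (real Lmu * real Lom * real Ld * Jv_max * Lreg_max)
              in
              (\<forall>A\<in>Tags1.
                 \<comment> \<open>(P2)\<close>
                 (\<forall>P\<in>parents (D A). \<forall>T\<in>kids (D A) P. Y1 A T \<subseteq> Z A P) \<and>
                 \<comment> \<open>(P3)\<close>
                 (\<forall>P\<in>parents (D A). \<forall>x\<in>(\<Union>T\<in>kids (D A) P. Y1 A T).
                    mu A \<le> overlap (kids (D A) P) (Y1 A) x \<and>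
                    overlap (kids (D A) P) (Y1 A) x < 2 * mu A) \<and>
                 \<comment> \<open>(P4)\<close>
                 (\<forall>x\<in>(\<Union>P\<in>parents (D A). Z A P).
                    d A \<le> (\<Sum>P\<in>parents (D A). indicator (Z A P) x) \<and>
                    (\<Sum>P\<in>parents (D A). indicator (Z A P) x) < 2 * d A) \<and>
                 \<comment> \<open>(P5)\<close>
                 (\<forall>x\<in>(\<Union>T\<in>children (D A). Y1 A T).
                    overlap (children (D A)) (Y1 A) x < 4 * mu A * d A) \<and>
                 mass (D A) (Y1 A) \<ge> inverse (Jv A * Lreg A) * mass (D A) (Y A)) \<and>
              \<comment> \<open>(G1)\<close>
              (\<Sum>A\<in>Tags1. mass (D A) (Y1 A)) \<ge> frac1 * (\<Sum>A\<in>Tags. mass (D A) (Y A)) \<and>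
              \<comment> \<open>(G1) for the represented fine mass and for the labelled denominator\<close>
              (\<forall>m cm cp :: real. \<forall>F :: 'g \<Rightarrow> ('t \<Rightarrow> pt set) \<Rightarrow> real.
                 0 < m \<and> 0 < cm \<and> cm \<le> cp \<and> (\<forall>A\<in>Tags. represents_mass cm cp m (D A) (F A)) \<longrightarrow>
                 (\<Sum>A\<in>Tags1. F A (Y1 A)) \<ge> inverse (cp / cm) * frac1 * (\<Sum>A\<in>Tags. F A (Y A)) \<and>
                 (\<Sum>A\<in>Tags1. F A (Y A)) \<ge> inverse (cp / cm) * frac1 * (\<Sum>A\<in>Tags. F A (Y A)) \<and>
                 (\<forall>rho km kp :: real.
                    0 < rho \<and> 0 < km \<and> km \<le> kp \<and>
                    (\<forall>A\<in>Tags. km * rho * denominator (D A) \<le> F A (Y A) \<and>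
                               F A (Y A) \<le> kp * rho * denominator (D A)) \<longrightarrow>
                    (\<Sum>A\<in>Tags1. denominator (D A)) \<ge>
                      inverse (kp / km) * inverse (cp / cm) * frac1 * (\<Sum>A\<in>Tags. denominator (D A)))) \<and>
              \<comment> \<open>the common input degree\<close>
              (\<forall>A\<in>Tags1. \<forall>Q\<in>snd ` E3 A. ds \<le> right_degree (E3 A) Q \<and> right_degree (E3 A) Q < 2 * ds) \<and>
              \<comment> \<open>the angular part\<close>
              ((\<forall>A\<in>Tags. \<forall>A'\<in>Tags.
                  A_ang a (D A) = A_ang a (D A') \<and> B_ang a (D A) = B_ang a (D A') \<and>
                  K_ang a (D A) = K_ang a (D A') \<and> q_res a (D A) = q_res a (D A')) \<longrightarrow>
               (\<forall>A\<in>Tags1. \<exists>G th dang c. angular_output a (D A) (E3 A) G th dang c) \<and>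
               (\<forall>(G :: 'g \<Rightarrow> ('p \<times> pt set) set) (th :: 'g \<Rightarrow> real) (dang :: 'g \<Rightarrow> real) (c :: 'g \<Rightarrow> real).
                 (\<forall>A\<in>Tags1. angular_output a (D A) (E3 A) (G A) (th A) (dang A) (c A)) \<longrightarrow>
                 (let Y2 = (\<lambda>A. restrict_to (D A) (Y1 A) (G A));
                      c_min = Min ((\<lambda>A. c_floor a (D A)) ` Tags1)
                  in
                  \<exists>Tags2 \<subseteq> Tags1. \<exists>ths dangs :: real. \<exists>Lth Ldang :: nat.
                    let frac2 = c_min / (2 * real Lth * real Ldang) in
                    dyadic ths \<and> dyadic dangs \<and> 1 \<le> Lth \<and> 1 \<le> Ldang \<and>
                    real Lth \<le> C * ln (2 / \<delta>) \<and> real Ldang \<le> C * ln (2 / \<delta>) \<and>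
                    (\<forall>A\<in>Tags2. ths \<le> th A \<and> th A < 2 * ths \<and>
                                dangs \<le> dang A \<and> dang A < 2 * dangs) \<and>
                    \<comment> \<open>(A1) to (A4)\<close>
                    (\<forall>A\<in>Tags2.
                       angular_output a (D A) (E3 A) (G A) (th A) (dang A) (c A) \<and>
                       inverse (c A) \<le> Cang * (1 + L_plus a (D A)) ^ 2 *
                         exp (L_plus a (D A) powr (3/4) + 2 * L_plus a (D A) powr (1/2)) \<and>
                       (ln (inverse (alpha a (D A))) \<le> 1 \<longrightarrow> inverse (c A) \<le> Cang1) \<and>
                       (\<forall>eps>0. alpha a (D A) < alpha0 eps \<longrightarrow> alpha a (D A) powr eps \<le> c A) \<and>
                       mass (D A) (Y2 A) \<ge> c A / 2 * mass (D A) (Y1 A)) \<and>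
                    \<comment> \<open>(G2)\<close>
                    (\<Sum>A\<in>Tags2. mass (D A) (Y2 A)) \<ge> frac2 * (\<Sum>A\<in>Tags1. mass (D A) (Y1 A)) \<and>
                    \<comment> \<open>one global low/high split at any degree threshold\<close>
                    (\<forall>tau::real.
                       (ds < tau \<and> (\<forall>A\<in>Tags1. d A < tau)) \<or>
                       (tau \<le> ds \<and> (\<forall>A\<in>Tags1. tau \<le> d A) \<and>
                        (\<forall>A\<in>Tags2. \<forall>Q\<in>snd ` G A.
                           dangs \<le> right_degree (G A) Q \<and> right_degree (G A) Q < 2 * dangs))) \<and>
                    \<comment> \<open>(G2) for the represented fine mass and for the labelled denominator\<close>
                    (\<forall>m cm cp :: real. \<forall>F :: 'g \<Rightarrow> ('t \<Rightarrow> pt set) \<Rightarrow> real.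
                       0 < m \<and> 0 < cm \<and> cm \<le> cp \<and> (\<forall>A\<in>Tags. represents_mass cm cp m (D A) (F A)) \<longrightarrow>
                       (\<Sum>A\<in>Tags2. F A (Y2 A)) \<ge> inverse (cp / cm) * frac2 * (\<Sum>A\<in>Tags1. F A (Y1 A)) \<and>
                       (\<Sum>A\<in>Tags2. F A (Y A)) \<ge>
                         inverse (cp / cm) * (frac2 * frac1) * (\<Sum>A\<in>Tags. F A (Y A)) \<and>
                       (\<forall>rho km kp :: real.
                          0 < rho \<and> 0 < km \<and> km \<le> kp \<and>
                          (\<forall>A\<in>Tags. km * rho * denominator (D A) \<le> F A (Y A) \<and>
                                     F A (Y A) \<le> kp * rho * denominator (D A)) \<longrightarrow>
                          (\<Sum>A\<in>Tags2. denominator (D A)) \<ge>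
                            inverse (kp / km) * inverse (cp / cm) * (frac2 * frac1) *
                              (\<Sum>A\<in>Tags. denominator (D A))))))))))))))))"
proof (rule exI[of _ 12], rule exI[of _ "48 * exp 3"],
    rule exI[of _ "\<lambda>eps. exp (- ((13 / eps) ^ 4) - 1)"], intro conjI allI impI, goal_cases)
  case (1 eps)
  show ?case
    by simp
next
  case (2 c0 Cnb dil enl R0)
  note params = this
  show ?case
  proof (rule exI[of _ "volume_constant c0 Cnb"], intro conjI allI, goal_cases)
    case 1
    show ?case
      by (simp add: volume_constant_def)
  next
    case (2 Ccomp Cmass)
    show ?case
    proof (rule exI[of _ "level_constant dil R0 Ccomp Cmass"], intro conjI allI, goal_cases)
      case 1
      show ?case
        by (rule level_constant_pos)
    next
      case (2 \<delta> a Tags D)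
      show ?case
        unfolding Let_def
      proof (intro impI, goal_cases)
        case 1
        interpret tag_family c0 Cnb dil enl R0 Ccomp Cmass \<delta> a Tags D
          using params 1 by unfold_locales auto
        show ?case
        proof (intro conjI allI impI, goal_cases)
          case 1
          show ?case
            using cellular_tag.joint_run_exists[OF tag] by blast
        next
          case (2 mu om d)
          interpret tag_family_run c0 Cnb dil enl R0 Ccomp Cmass \<delta> a Tags D mu om d
            using 2 by unfold_locales auto
          show ?case
          proof (intro ballI, goal_cases)
            case (1 A Q)
            interpret local_volume_tag c0 dil enl R0 a h "D A" "mu A" "om A" "d A" s Cv
              by (rule tag_run[OF 1(1)])
            show ?case
              using local_volume_range 1(2) by (auto simp: Q_plus_def)
          qed
        next
          case (3 mu om d)
          interpret tag_family_run c0 Cnb dil enl R0 Ccomp Cmass \<delta> a Tags D mu om d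
            using 3 by unfold_locales auto
          obtain A0 where A0: "A0 \<in> Tags"
            "(\<Sum>A\<in>Tags. M A (shading (D A))) \<le> real (card (mu ` Tags)) * real (card (om ` Tags)) * real (card (d ` Tags)) *
              (\<Sum>A | A \<in> Tags \<and> mu A = mu A0 \<and> om A = om A0 \<and> d A = d A0. M A (shading (D A)))"
            by (rule first_tag_selection)
          define Tags1 where "Tags1 = {A \<in> Tags. mu A = mu A0 \<and> om A = om A0 \<and> d A = d A0}"
          have Tags1: "Tags1 \<subseteq> Tags" "Tags1 \<noteq> {}"
            using A0(1) by (auto simp: Tags1_def)
          have same: "mu A = mu A0" "om A = om A0" "d A = d A0" if "A \<in> Tags1" for A
            using that by (auto simp: Tags1_def)
          have counts: "1 \<le> card (f ` Tags)" for f :: "'g \<Rightarrow> real"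
            using finite_Tags Tags_nonempty by (simp add: Suc_le_eq card_gt_0_iff)
          \<comment> \<open>The cases are, in this order: the subfamily is nonempty, the parameters are dyadic (2 to 4), the level
            counts are positive (5 to 7) and logarithmic (8 to 10), the parameters agree, cells remain,
            volume selections exist, and their consequences.\<close>
          show ?case
          proof (rule exI[of _ Tags1], rule conjI[OF Tags1(1)], rule exI[of _ "mu A0"], rule exI[of _ "om A0"],
              rule exI[of _ "d A0"], rule exI[of _ "card (mu ` Tags)"], rule exI[of _ "card (om ` Tags)"],
              rule exI[of _ "card (d ` Tags)"], intro conjI, goal_cases)
            case 1
            show ?case
              by (rule Tags1(2))
          next
            case 2
            show ?case
              using parameter_ranges(1)[OF A0(1)] by blast
          next
            case 3
            show ?case
              using parameter_ranges(2)[OF A0(1)] by blast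
          next
            case 4
            show ?case
              using parameter_ranges(3)[OF A0(1)] by blast
          next
            case 5
            show ?case
              by (rule counts)
          next
            case 6
            show ?case
              by (rule counts)
          next
            case 7
            show ?case
              by (rule counts)
          next
            case 8
            show ?case
              by (rule card_levels_le[OF parameter_ranges(1)])
          next
            case 9
            show ?case
              by (rule card_levels_le[OF parameter_ranges(2)])
          next
            case 10
            show ?case
              by (rule card_levels_le[OF parameter_ranges(3)])
          next
            case 11
            show ?case
              using same parameter_ranges[OF A0(1)] dyadic_pos by auto
          next
            case 12
            show ?case
              by (intro ballI nonempty_cells subsetD[OF Tags1(1)])
          next
            case 13
            show ?case
              by (intro ballI selection_exists subsetD[OF Tags1(1)])
          next
            case 14
            show ?case
            proof (intro allI impI, goal_cases)
              case (1 E3)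
              interpret first_selection c0 Cnb dil enl R0 Ccomp Cmass \<delta> a Tags D mu om d Tags1
                "card (mu ` Tags)" "card (om ` Tags)" "card (d ` Tags)" E3
                using Tags1 counts A0(2) 1 by unfold_locales (auto simp: Tags1_def)
              \<comment> \<open>The cases are the local conclusions, the global inequality, its versions for represented mass and
                denominators, the common input degree, and the angular part.\<close>
              show ?case
              proof (intro conjI, goal_cases)
                case 1
                show ?case
                proof (rule ballI)
                  fix A assume "A \<in> Tags1"
                  then interpret volume_selected_tag c0 dil enl R0 a h "D A" "mu A" "om A" "d A" s Cv "E3 A"
                    by (rule tag_selected)
                  show "(\<forall>P\<in>parents (D A). \<forall>T\<in>kids (D A) P. Y1 T \<subseteq> parent_shading (E3 A) P) \<and>
                    (\<forall>P\<in>parents (D A). \<forall>x\<in>(\<Union>T\<in>kids (D A) P. Y1 T).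
                      mu A \<le> overlap (kids (D A) P) Y1 x \<and> overlap (kids (D A) P) Y1 x < 2 * mu A) \<and>
                    (\<forall>x\<in>(\<Union>P\<in>parents (D A). parent_shading (E3 A) P).
                      d A \<le> (\<Sum>P\<in>parents (D A). indicator (parent_shading (E3 A) P) x) \<and>
                      (\<Sum>P\<in>parents (D A). indicator (parent_shading (E3 A) P) x) < 2 * d A) \<and>
                    (\<forall>x\<in>(\<Union>T\<in>children (D A). Y1 T). overlap (children (D A)) Y1 x < 4 * mu A * d A) \<and>
                    inverse (Jv A * Lreg A) * mass (D A) (shading (D A)) \<le> mass (D A) Y1"
                    by (intro conjI ballI child_point_in_parent_shading inner_multiplicity outer_multiplicity
                        total_multiplicity mass_Y1_ge)
                qed
              next
                case 2
                show ?case
                  by (rule frac1_le)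
              next
                case 3
                show ?case
                  by (intro allI impI conjI; elim conjE)
                    (rule represented_first denominators_first; assumption)+
              next
                case 4
                show ?case
                proof (intro ballI)
                  fix A Q assume "A \<in> Tags1" "Q \<in> snd ` E3 A"
                  then show "d A0 \<le> right_degree (E3 A) Q \<and> right_degree (E3 A) Q < 2 * d A0"
                    using volume_selected_tag.right_degree_E3[OF tag_selected, of A Q] same(3) by simp
                qed
              next
                case 5
                show ?case
                proof (intro impI conjI allI, goal_cases)
                  case 1
                  show ?case
                    by (intro ballI output_exists)
                next
                  case (2 G th dang c)
                  interpret second_selection c0 Cnb dil enl R0 Ccomp Cmass \<delta> a Tags D mu om d Tags1
                    "card (mu ` Tags)" "card (om ` Tags)" "card (d ` Tags)" E3 G th dang c
                    using 2 by unfold_locales auto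
                  obtain A1 where A1: "A1 \<in> Tags1"
                    "(\<Sum>A\<in>Tags1. M A (Ysel A)) \<le> real (card (th_level ` Tags1)) * real (card (dang ` Tags1)) *
                      (\<Sum>A | A \<in> Tags1 \<and> th_level A = th_level A1 \<and> dang A = dang A1. M A (Ysel A))"
                    by (rule second_tag_selection)
                  define Tags2 where "Tags2 = {A \<in> Tags1. th_level A = th_level A1 \<and> dang A = dang A1}"
                  have Tags2: "Tags2 \<subseteq> Tags1"
                    by (auto simp: Tags2_def)
                  have same2: "th_level A = th_level A1" "dang A = dang A1" if "A \<in> Tags2" for A
                    using that by (auto simp: Tags2_def)
                  have counts2: "1 \<le> card (f ` Tags1)" for f :: "'g \<Rightarrow> real"
                    using finite_Tags1 Tags1(2) by (simp add: Suc_le_eq card_gt_0_iff)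
                  note second = Tags2 counts2 counts2 A1(2)[folded Tags2_def]
                  \<comment> \<open>The cases are: dyadic parameters (1 and 2), positive (3 and 4) and logarithmic (5 and 6) level
                    counts, agreement of the parameters, the angular conclusions in each tag, the global
                    inequality, the split by degree, and the versions for represented mass and denominators.\<close>
                  show ?case
                  proof (rule exI[of _ Tags2], rule conjI[OF Tags2], rule exI[of _ "th_level A1"],
                      rule exI[of _ "dang A1"], rule exI[of _ "card (th_level ` Tags1)"],
                      rule exI[of _ "card (dang ` Tags1)"], intro conjI, goal_cases)
                    case 1
                    show ?case
                      using angular_ranges(3)[OF A1(1)] by blast
                  next
                    case 2
                    show ?case
                      using angular_ranges(4)[OF A1(1)] by blast
                  next
                    case 3
                    show ?case
                      by (rule counts2)
                  next
                    case 4
                    show ?case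
                      by (rule counts2)
                  next
                    case 5
                    show ?case
                      by (rule card_levels_le[OF angular_ranges(3)])
                  next
                    case 6
                    show ?case
                      by (rule card_levels_le[OF angular_ranges(4)])
                  next
                    case 7
                    show ?case
                    proof (rule ballI)
                      fix A assume "A \<in> Tags2"
                      then show "th_level A1 \<le> th A \<and> th A < 2 * th_level A1 \<and> dang A1 \<le> dang A \<and> dang A < 2 * dang A1"
                        using angular_ranges[of A] same2[of A] Tags2 dyadic_pos[of "dang A"] by auto
                    qed
                  next
                    case 8
                    show ?case
                    proof (intro ballI conjI allI impI, goal_cases)
                      case (1 A)
                      then show ?case
                        using outputs Tags2 by auto
                    next
                      case (2 A)
                      then show ?case
                        by (intro retention_upper subsetD[OF Tags2])
                    next
                      case (3 A)
                      then show ?case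
                        by (intro retention_constant subsetD[OF Tags2])
                    next
                      case (4 A eps)
                      then show ?case
                        by (intro retention_subpolynomial subsetD[OF Tags2])
                    next
                      case (5 A)
                      then show ?case
                        using angular_tag.mass_Y2_ge[OF tag_angular] Tags2 by auto
                    qed
                  next
                    case 9
                    show ?case
                      by (rule frac2_le[OF second])
                  next
                    case 10
                    show ?case
                    proof (rule allI)
                      fix tau :: real
                      have "\<forall>A\<in>Tags2. \<forall>Q\<in>snd ` G A. dang A1 \<le> right_degree (G A) Q \<and> right_degree (G A) Q < 2 * dang A1"
                      proof (intro ballI)
                        fix A Q assume "A \<in> Tags2" "Q \<in> snd ` G A"
                        then show "dang A1 \<le> right_degree (G A) Q \<and> right_degree (G A) Q < 2 * dang A1"
                          using angular_tag.right_degree_G[OF tag_angular, of A Q] same2(2)[of A] Tags2 by auto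
                      qed
                      then show "d A0 < tau \<and> (\<forall>A\<in>Tags1. d A < tau) \<or>
                          tau \<le> d A0 \<and> (\<forall>A\<in>Tags1. tau \<le> d A) \<and>
                          (\<forall>A\<in>Tags2. \<forall>Q\<in>snd ` G A. dang A1 \<le> right_degree (G A) Q \<and> right_degree (G A) Q < 2 * dang A1)"
                        using same(3) by (cases "d A0 < tau") auto
                    qed
                  next
                    case 11
                    show ?case
                      by (intro allI impI conjI; elim conjE)
                        (rule represented_second[OF second] denominators_second[OF second]; assumption)+
                  qed
                qed
              qed
            qed
          qed
        qed
      qed
    qed
  qed
qed

end
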